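(* Let $n\ge2$, let $D\subset\mathbb R^n$ be a bounded domain, let $w$ be a weight satisfying the $A_2$-condition with $w\in C^1(D)$ and $\int_D w(x)^{-\frac n2}\,dx<+\infty$, and let $f\in L_2(D)$. Then there exists a unique weak solution $u\in\overset{\circ}{W}{}^1_2(D,w)$ of the Dirichlet problem $$\operatorname{div}(w(x)\nabla u)=f\ \text{ in } D,\qquad u|_{\partial D}=0 .$$
   Context: A weight is a locally summable function $w:\mathbb R^n\to[0,\infty)$. It satisfies the $A_2$-condition if $\sup_{B}\left(\frac1{|B|}\int_B w\right)\left(\frac1{|B|}\int_B w^{-1}\right)<+\infty$ over all balls $B\subset\mathbb R^n$. $W^1_2(D,w)$ is the space of locally summable, weakly differentiable $u:D\to\mathbb R$ with finite norm $\left(\int_D|u|^2w\,dx\right)^{1/2}+\left(\int_D|\nabla u|^2w\,dx\right)^{1/2}$, and $\overset{\circ}{W}{}^1_2(D,w)$ is the closure of $C_0^\infty(D)$ in it; it is considered with the inner product $\langle u,v\rangle=\int_D\nabla u\cdot\nabla v\,w(x)\,dx$. The boundary condition is expressed by membership in $\overset{\circ}{W}{}^1_2(D,w)$. A weak solution is a function $u\in\overset{\circ}{W}{}^1_2(D,w)$ with $-\int_D\nabla u\cdot\nabla\phi\,w(x)\,dx=\int_Df\phi\,dx$ for all $\phi\in\overset{\circ}{W}{}^1_2(D,w)$. *)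

theory Defs
  imports "HOL-Analysis.Analysis"
begin

text \<open>
  Functions on an open set \<open>D\<close> are total functions of which only the values on \<open>D\<close> are used.
  Elements of Lebesgue and Sobolev spaces are functions rather than classes modulo null sets, so
  uniqueness in such a space means equality almost everywhere on \<open>D\<close>.
\<close>

definition locally_summable ::
  "'a::euclidean_space set \<Rightarrow> ('a \<Rightarrow> 'b::{banach,second_countable_topology}) \<Rightarrow> bool" where
  "locally_summable D u \<longleftrightarrow>
     (\<forall>K. compact K \<and> K \<subseteq> D \<longrightarrow> set_integrable lebesgue K u)"

definition weight :: "('a::euclidean_space \<Rightarrow> real) \<Rightarrow> bool" where
  "weight w \<longleftrightarrow> (\<forall>x. 0 \<le> w x) \<and> locally_summable UNIV w"

text \<open>
  The reciprocal of \<open>w\<close> is taken in \<^typ>\<open>ennreal\<close>, so that it is infinite at the zeros of \<open>w\<close>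
  (in \<^typ>\<open>real\<close> it would be 0 there).
\<close>

definition A2_condition :: "('a::euclidean_space \<Rightarrow> real) \<Rightarrow> bool" where
  "A2_condition w \<longleftrightarrow>
     (SUP (c, r) \<in> UNIV \<times> {0<..}.
        ((\<integral>\<^sup>+x\<in>ball c r. ennreal (w x) \<partial>lebesgue) / emeasure lebesgue (ball c r)) *
        ((\<integral>\<^sup>+x\<in>ball c r. inverse (ennreal (w x)) \<partial>lebesgue) / emeasure lebesgue (ball c r)))
     < \<infinity>"

text \<open>To be used for open \<open>S\<close> only, because derivatives are taken in full neighbourhoods.\<close>

primrec C_k_on :: "nat \<Rightarrow> 'a::euclidean_space set \<Rightarrow> ('a \<Rightarrow> real) \<Rightarrow> bool" where
  "C_k_on 0 S g \<longleftrightarrow> continuous_on S g"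
| "C_k_on (Suc k) S g \<longleftrightarrow>
     g differentiable_on S \<and> (\<forall>b\<in>Basis. C_k_on k S (\<lambda>x. frechet_derivative g (at x) b))"

text \<open>The space $C_0^\infty(D)$, its elements being extended by 0 to the whole space.\<close>

definition test_functions :: "'a::euclidean_space set \<Rightarrow> ('a \<Rightarrow> real) set" where
  "test_functions D =
     {\<phi>. (\<forall>k. C_k_on k UNIV \<phi>) \<and> compact (closure {x. \<phi> x \<noteq> 0}) \<and> closure {x. \<phi> x \<noteq> 0} \<subseteq> D}"

definition has_weak_gradient ::
  "'a::euclidean_space set \<Rightarrow> ('a \<Rightarrow> real) \<Rightarrow> ('a \<Rightarrow> 'a) \<Rightarrow> bool" where
  "has_weak_gradient D u G \<longleftrightarrow>
     locally_summable D u \<and> locally_summable D G \<and>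
     (\<forall>\<phi>\<in>test_functions D. \<forall>b\<in>Basis.
        (LINT x:D|lebesgue. u x * frechet_derivative \<phi> (at x) b) =
        - (LINT x:D|lebesgue. (G x \<bullet> b) * \<phi> x))"

text \<open>The weak gradient is determined up to a null subset of \<open>D\<close>; an arbitrary version is chosen.\<close>

definition weak_gradient ::
  "'a::euclidean_space set \<Rightarrow> ('a \<Rightarrow> real) \<Rightarrow> 'a \<Rightarrow> 'a" where
  "weak_gradient D u = (SOME G. has_weak_gradient D u G)"

definition sobolev_W12 ::
  "'a::euclidean_space set \<Rightarrow> ('a \<Rightarrow> real) \<Rightarrow> ('a \<Rightarrow> real) set" where
  "sobolev_W12 D w =
     {u. locally_summable D u \<and> (\<exists>G. has_weak_gradient D u G) \<and>
         set_integrable lebesgue D (\<lambda>x. \<bar>u x\<bar>\<^sup>2 * w x) \<and>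
         set_integrable lebesgue D (\<lambda>x. (norm (weak_gradient D u x))\<^sup>2 * w x)}"

definition sobolev_norm ::
  "'a::euclidean_space set \<Rightarrow> ('a \<Rightarrow> real) \<Rightarrow> ('a \<Rightarrow> real) \<Rightarrow> real" where
  "sobolev_norm D w u =
     sqrt (LINT x:D|lebesgue. \<bar>u x\<bar>\<^sup>2 * w x) +
     sqrt (LINT x:D|lebesgue. (norm (weak_gradient D u x))\<^sup>2 * w x)"

definition sobolev_W12_0 ::
  "'a::euclidean_space set \<Rightarrow> ('a \<Rightarrow> real) \<Rightarrow> ('a \<Rightarrow> real) set" where
  "sobolev_W12_0 D w =
     {u \<in> sobolev_W12 D w.
        \<forall>\<epsilon>>0. \<exists>\<phi>\<in>test_functions D. sobolev_norm D w (\<lambda>x. u x - \<phi> x) < \<epsilon>}"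

definition energy_inner ::
  "'a::euclidean_space set \<Rightarrow> ('a \<Rightarrow> real) \<Rightarrow> ('a \<Rightarrow> real) \<Rightarrow> ('a \<Rightarrow> real) \<Rightarrow> real" where
  "energy_inner D w u v =
     (LINT x:D|lebesgue. (weak_gradient D u x \<bullet> weak_gradient D v x) * w x)"

definition L2_on :: "'a::euclidean_space set \<Rightarrow> ('a \<Rightarrow> real) set" where
  "L2_on D =
     {f. set_borel_measurable lebesgue D f \<and> set_integrable lebesgue D (\<lambda>x. \<bar>f x\<bar>\<^sup>2)}"

text \<open>
  Weak solutions of \<open>div (w \<nabla>u) = f\<close> in \<open>D\<close>, \<open>u = 0\<close> on the boundary of \<open>D\<close>. The integral of
  \<open>f \<phi>\<close> is required to exist, since a divergent integral would have the value 0 here; the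
  integral in \<^const>\<open>energy_inner\<close> converges by the Cauchy-Schwarz inequality.
\<close>

definition dirichlet_weak_solution ::
  "'a::euclidean_space set \<Rightarrow> ('a \<Rightarrow> real) \<Rightarrow> ('a \<Rightarrow> real) \<Rightarrow> ('a \<Rightarrow> real) \<Rightarrow> bool" where
  "dirichlet_weak_solution D w f u \<longleftrightarrow>
     u \<in> sobolev_W12_0 D w \<and>
     (\<forall>\<phi>\<in>sobolev_W12_0 D w.
        set_integrable lebesgue D (\<lambda>x. f x * \<phi> x) \<and>
        - energy_inner D w u \<phi> = (LINT x:D|lebesgue. f x * \<phi> x))"

end

theory Submission
  imports Defs
begin

text \<open>
  Existence is the Dirichlet principle: minimise $\int |\nabla u|^2 w + 2 \int f u$ over test
  functions. By the parallelogram identity a minimising sequence is Cauchy in the energy norm; two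
  inequalities for test functions then make it converge in $W^1_2(D,w)$ and make $\int f u$ a
  bounded functional.

  Poincare: $\int u^2 w \le C \int |\nabla u|^2 w$. If $T$ is large compared with $D$, integrating
  $\nabla u$ along the segments from $x$ to $x + Tz$, with $z$ in a small ball away from 0, bounds
  $|u(x)|$ by $\int_0^T A_t|\nabla u|(x)\,dt$ up to a constant, where $A_t$ is the mean over the
  ball of radius $t$. The $A_2$-condition makes the $A_t$ bounded on $L_2(w)$ uniformly in $t$.

  Sobolev: $\int u^2 \le C \int |\nabla u|^2 w$. Gagliardo's argument for $|u|^{2(n-1)/n}$, whose
  gradient is $\frac{2(n-1)}{n} |u|^{(n-2)/n} \nabla |u|$, is followed by the Hoelder inequality with
  the three factors $u^2$, $|\nabla u|^2 w$ and $w^{-n/2}$ to the powers $\frac{n-2}{2n}$,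
  $\frac12$ and $\frac1n$.
\<close>

text \<open>The exponents in the Sobolev argument are tuned so that the integral of u^2 enters to
  the power (n-1)/n on the left and (n-2)/(2n) on the right. Dividing leaves the power 1/2, but only
  if that integral is finite, which is clear for test functions. The bound without weight reaches
  the closure by Fatou's lemma, and the Euler equation reaches it by density in the energy norm. The
  limit of a minimising sequence must have a weak gradient. On the bounded set D, 1/w \<le> 1 +
  w^(-n/2) is summable because n \<ge> 2, so convergence in the weighted L2 space implies
  convergence in L1(D), and the identity that defines weak gradients passes to the limit. Functions
  are not identified a.e. and \<open>weak_gradient\<close> is an arbitrary version. Gradients are
  therefore treated as elements of L2 for the measure w dx on D, which has the same null sets as
  Lebesgue measure there. Uniqueness: the difference of two solutions has energy 0, hence vanishes
  a.e. by the Sobolev inequality.\<close>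

section \<open>The Hoelder and Gagliardo inequalities\<close>

text \<open>Pitfalls: \<open>epow 0 0 = 0\<close>, and \<open>epow top p = top\<close> even for \<open>p \<le> 0\<close>.\<close>

definition epow :: "ennreal \<Rightarrow> real \<Rightarrow> ennreal" where
  "epow x p = (if x = top then top else ennreal (enn2real x powr p))"

lemma epow_0 [simp]: "epow 0 p = 0"
  by (simp add: epow_def)

lemma epow_top [simp]: "epow top p = top"
  by (simp add: epow_def)

lemma epow_ennreal: "0 \<le> r \<Longrightarrow> epow (ennreal r) p = ennreal (r powr p)"
  by (simp add: epow_def)

lemma epow_eq_0_iff [simp]: "epow x p = 0 \<longleftrightarrow> x = 0"
  by (cases x) (auto simp: epow_def)

lemma epow_eq_top_iff [simp]: "epow x p = top \<longleftrightarrow> x = top"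
  by (auto simp: epow_def)

text \<open>The conventions at 0 and \<open>top\<close> are what makes this free of side conditions,
  even for negative \<open>p\<close>: a product of 0 and \<open>top\<close> becomes 0 on both
  sides.\<close>

lemma epow_mult: "epow (x * y) p = epow x p * epow y p"
proof (cases "x = top \<or> y = top")
  case True
  then show ?thesis
    by (metis ennreal_mult_eq_top_iff epow_eq_0_iff epow_eq_top_iff mult_eq_0_iff)
next
  case False
  then obtain r s where "x = ennreal r" "y = ennreal s" "0 \<le> r" "0 \<le> s"
    by (metis ennreal_cases)
  then show ?thesis
    by (simp add: epow_ennreal flip: ennreal_mult) (simp add: epow_ennreal powr_mult ennreal_mult'')
qed

lemma epow_mono: "x \<le> y \<Longrightarrow> 0 \<le> p \<Longrightarrow> epow x p \<le> epow y p"
  by (auto simp: epow_def top_unique less_top enn2real_mono intro!: ennreal_leI powr_mono2)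

lemma epow_power: "epow x p ^ n = epow x (p * n)" if "n > 0"
proof (cases x)
  case (real r)
  then show ?thesis
    by (cases "r = 0") (use that in \<open>auto simp: epow_ennreal ennreal_power powr_powr powr_realpow[symmetric]\<close>)
qed (use that in simp)

lemma epow_epow: "epow (epow x p) q = epow x (p * q)"
  by (cases x) (auto simp: epow_ennreal powr_powr)

lemma epow_1 [simp]: "epow x 1 = x"
  by (cases x) (auto simp: epow_ennreal)

lemma measurable_epow [measurable]:
  assumes [measurable]: "f \<in> borel_measurable M"
  shows "(\<lambda>x. epow (f x) p) \<in> borel_measurable M"
  unfolding epow_def by measurable

text \<open>Jensen's inequality for the exponential at the points \<open>ln (a i)\<close>. A
  vanishing \<open>a i\<close> has no logarithm and is split off first; it makes the left-hand side
  0.\<close>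

lemma weighted_arith_geo_mean:
  fixes a p :: "'i \<Rightarrow> real"
  assumes S: "finite S" and a: "\<And>i. i \<in> S \<Longrightarrow> 0 \<le> a i"
    and p: "\<And>i. i \<in> S \<Longrightarrow> 0 < p i" "sum p S = 1"
  shows "(\<Prod>i\<in>S. a i powr p i) \<le> (\<Sum>i\<in>S. p i * a i)"
proof (cases "\<exists>i\<in>S. a i = 0")
  case True
  then have "(\<Prod>i\<in>S. a i powr p i) = 0"
    using S by (auto intro!: prod_zero)
  then show ?thesis
    using a p by (auto intro!: sum_nonneg mult_nonneg_nonneg simp: less_imp_le)
next
  case False
  then have pos: "a i > 0" if "i \<in> S" for i
    using a that by (force simp: less_le)
  have "(\<Prod>i\<in>S. a i powr p i) = exp (\<Sum>i\<in>S. p i *\<^sub>R ln (a i))"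
    using pos by (simp add: exp_sum S powr_def less_le cong: prod.cong)
  also have "\<dots> \<le> (\<Sum>i\<in>S. p i * exp (ln (a i)))"
  proof (rule convex_on_sum[OF S _ exp_convex])
    show "S \<noteq> {}" using p by auto
  qed (use p in \<open>auto simp: less_imp_le\<close>)
  also have "\<dots> = (\<Sum>i\<in>S. p i * a i)"
    using pos by (intro sum.cong) auto
  finally show ?thesis .
qed

lemma epow_weighted_arith_geo_mean:
  assumes S: "finite S" and p: "\<And>i. i \<in> S \<Longrightarrow> 0 < p i" "sum p S = 1"
  shows "(\<Prod>i\<in>S. epow (a i) (p i)) \<le> (\<Sum>i\<in>S. ennreal (p i) * a i)"
proof (cases "\<exists>i\<in>S. a i = top")
  case True
  then have "(\<Sum>i\<in>S. ennreal (p i) * a i) = top"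
    using S p by (force simp: ennreal_mult_eq_top_iff)
  then show ?thesis by simp
next
  case False
  define r where "r i = enn2real (a i)" for i
  have r: "a i = ennreal (r i)" "0 \<le> r i" if "i \<in> S" for i
    using False that by (auto simp: r_def less_top)
  have "(\<Prod>i\<in>S. epow (a i) (p i)) = ennreal (\<Prod>i\<in>S. r i powr p i)"
    using r by (simp add: epow_ennreal prod_ennreal cong: prod.cong)
  also have "\<dots> \<le> ennreal (\<Sum>i\<in>S. p i * r i)"
    using r p S by (intro ennreal_leI weighted_arith_geo_mean) auto
  also have "\<dots> = (\<Sum>i\<in>S. ennreal (p i) * a i)"
    using r p by (subst sum_ennreal[symmetric]) (auto intro!: sum.cong simp: ennreal_mult less_imp_le)
  finally show ?thesis .
qed

text \<open>Each \<open>f i\<close> is divided by its integral \<open>c i\<close> and the mean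
  inequality is applied pointwise; the weighted sum then integrates to the sum of the
  \<open>p i\<close>, which is 1. This needs all \<open>c i\<close> positive and finite. If some
  \<open>c i\<close> is 0, the product vanishes a.e.; if none is 0 and one is infinite, so is the
  right-hand side.\<close>

lemma nn_integral_Holder:
  assumes S: "finite S" and p: "\<And>i. i \<in> S \<Longrightarrow> 0 < p i" "sum p S = 1"
    and f [measurable]: "\<And>i. i \<in> S \<Longrightarrow> f i \<in> borel_measurable M"
  shows "(\<integral>\<^sup>+x. (\<Prod>i\<in>S. epow (f i x) (p i)) \<partial>M) \<le> (\<Prod>i\<in>S. epow (\<integral>\<^sup>+x. f i x \<partial>M) (p i))"
proof -
  define c where "c i = (\<integral>\<^sup>+x. f i x \<partial>M)" for i
  consider (zero) i where "i \<in> S" "c i = 0" | (top) i where "i \<in> S" "c i = top" "\<forall>i\<in>S. c i \<noteq> 0"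
    | (fin) "\<forall>i\<in>S. c i \<noteq> 0 \<and> c i \<noteq> top"
    by blast
  then show ?thesis
  proof cases
    case zero
    then have "AE x in M. f i x = 0"
      unfolding c_def by (subst (asm) nn_integral_0_iff_AE) auto
    then have "AE x in M. (\<Prod>i\<in>S. epow (f i x) (p i)) = 0"
      by (rule eventually_mono) (use S zero(1) in \<open>auto intro!: prod_zero bexI[of _ i]\<close>)
    then have "(\<integral>\<^sup>+x. (\<Prod>i\<in>S. epow (f i x) (p i)) \<partial>M) = 0"
      by (subst nn_integral_0_iff_AE) (auto)
    then show ?thesis by simp
  next
    case top
    then have "(\<Prod>i\<in>S. epow (c i) (p i)) = top"
      using S by (auto simp: ennreal_prod_eq_top)
    then show ?thesis by (simp add: c_def)
  next
    case fin
    have "(\<Prod>i\<in>S. epow (f i x) (p i)) = (\<Prod>i\<in>S. epow (c i) (p i)) * (\<Prod>i\<in>S. epow (f i x / c i) (p i))" for x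
    proof -
      have "f i x = c i * (f i x / c i)" if "i \<in> S" for i
        using fin that by (simp add: ennreal_times_divide mult.commute[of "c i"] mult_divide_eq_ennreal)
      then have "epow (f i x) (p i) = epow (c i) (p i) * epow (f i x / c i) (p i)" if "i \<in> S" for i
        using that by (metis epow_mult)
      then show ?thesis
        by (simp add: prod.distrib)
    qed
    then have "(\<integral>\<^sup>+x. (\<Prod>i\<in>S. epow (f i x) (p i)) \<partial>M)
        \<le> (\<integral>\<^sup>+x. (\<Prod>i\<in>S. epow (c i) (p i)) * (\<Sum>i\<in>S. ennreal (p i) * (f i x / c i)) \<partial>M)"
      using epow_weighted_arith_geo_mean[OF S p]
      by (auto intro!: nn_integral_mono mult_left_mono)
    also have "\<dots> = (\<Prod>i\<in>S. epow (c i) (p i)) * (\<Sum>i\<in>S. ennreal (p i) * (c i / c i))"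
      by (simp add: nn_integral_cmult nn_integral_sum nn_integral_divide c_def)
    also have "(\<Sum>i\<in>S. ennreal (p i) * (c i / c i)) = (\<Sum>i\<in>S. ennreal (p i))"
      using fin by (intro sum.cong) (auto simp: less_top ennreal_divide_self)
    also have "\<dots> = 1"
      using p by (subst sum_ennreal) (auto simp: less_imp_le)
    finally show ?thesis by (simp add: c_def)
  qed
qed

section \<open>Integration along coordinate lines and the Loomis-Whitney inequality\<close>

definition line_integral :: "'a::euclidean_space \<Rightarrow> ('a \<Rightarrow> ennreal) \<Rightarrow> 'a \<Rightarrow> ennreal" where
  "line_integral b F x = (\<integral>\<^sup>+t. F (x + t *\<^sub>R b) \<partial>lborel)"

lemma measurable_line_integral [measurable]:
  assumes [measurable]: "F \<in> borel_measurable borel"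
  shows "line_integral b F \<in> borel_measurable borel"
  unfolding line_integral_def by measurable

lemma measurable_iterated_line_integral [measurable]:
  "F \<in> borel_measurable borel \<Longrightarrow> foldr line_integral bs F \<in> borel_measurable borel"
  by (induction bs) auto



lemma line_integral_shift:
  assumes [measurable]: "F \<in> borel_measurable borel"
  shows "line_integral b F (x + s *\<^sub>R b) = line_integral b F x"
proof -
  have "line_integral b F x = (\<integral>\<^sup>+t. F (x + (s + 1 * t) *\<^sub>R b) \<partial>lborel)"
    unfolding line_integral_def by (subst nn_integral_real_affine[where c = 1 and t = s]) auto
  then show ?thesis
    by (simp add: line_integral_def algebra_simps)
qed

text \<open>A partial integral is kept as a function on the whole space, so independence of a
  coordinate is expressed as invariance under shifts in that direction. Integrating in other
  directions preserves it.\<close>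

lemma iterated_line_integral_shift:
  assumes "\<And>x t. F (x + t *\<^sub>R b) = F x"
  shows "foldr line_integral bs F (x + t *\<^sub>R b) = foldr line_integral bs F x"
proof (induction bs arbitrary: x)
  case (Cons c bs)
  have "foldr line_integral bs F (x + t *\<^sub>R b + s *\<^sub>R c) = foldr line_integral bs F (x + s *\<^sub>R c)" for s
    using Cons[of "x + s *\<^sub>R c"] by (simp add: algebra_simps)
  then show ?case by (simp add: line_integral_def[of c])
qed (use assms in simp)

lemma iterated_line_integral_eq:
  fixes F :: "'a::euclidean_space \<Rightarrow> ennreal"
  assumes [measurable]: "F \<in> borel_measurable borel" and "distinct bs"
  shows "foldr line_integral bs F x =
    (\<integral>\<^sup>+y. F (x + (\<Sum>b\<in>set bs. y b *\<^sub>R b)) \<partial>(\<Pi>\<^sub>M b\<in>set bs. lborel))"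
  using assms(2)
proof (induction bs arbitrary: x)
  case Nil
  then show ?case
    by (simp add: PiM_empty nn_integral_count_space_finite)
next
  case (Cons c bs)
  interpret product_sigma_finite "\<lambda>_::'a. lborel :: real measure"
    by standard
  have [measurable]: "(\<lambda>y. F (x + (\<Sum>b\<in>set (c # bs). y b *\<^sub>R b)))
      \<in> borel_measurable (\<Pi>\<^sub>M b\<in>insert c (set bs). lborel)"
    by measurable
  have "(\<integral>\<^sup>+y. F (x + (\<Sum>b\<in>set (c # bs). y b *\<^sub>R b)) \<partial>(\<Pi>\<^sub>M b\<in>set (c # bs). lborel)) =
      (\<integral>\<^sup>+t. \<integral>\<^sup>+y. F (x + (\<Sum>b\<in>set (c # bs). (y(c := t)) b *\<^sub>R b)) \<partial>(\<Pi>\<^sub>M b\<in>set bs. lborel) \<partial>lborel)"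
    using Cons.prems by (simp only: list.set, subst product_nn_integral_insert_rev) auto
  also have "\<dots> = (\<integral>\<^sup>+t. foldr line_integral bs F (x + t *\<^sub>R c) \<partial>lborel)"
  proof (rule nn_integral_cong)
    fix t :: real
    have "(\<Sum>b\<in>set bs. (y(c := t)) b *\<^sub>R b) = (\<Sum>b\<in>set bs. y b *\<^sub>R b)" for y
      using Cons.prems by (intro sum.cong) auto
    then show "(\<integral>\<^sup>+y. F (x + (\<Sum>b\<in>set (c # bs). (y(c := t)) b *\<^sub>R b)) \<partial>(\<Pi>\<^sub>M b\<in>set bs. lborel)) =
        foldr line_integral bs F (x + t *\<^sub>R c)"
      using Cons by (simp add: add.assoc)
  qed
  finally show ?case by (simp add: line_integral_def[of c])
qed

lemma iterated_line_integral_Basis: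
  fixes F :: "'a::euclidean_space \<Rightarrow> ennreal"
  assumes [measurable]: "F \<in> borel_measurable borel" and "distinct bs" "set bs = Basis"
  shows "foldr line_integral bs F 0 = (\<integral>\<^sup>+x. F x \<partial>lborel)"
  using assms(2,3)
  by (subst lborel_eq) (simp add: iterated_line_integral_eq nn_integral_distr)

text \<open>One direction \<open>c\<close> is integrated at a time. The factor with index
  \<open>c\<close> does not depend on that coordinate and comes out of the integral; the other
  \<open>m\<close> factors are separated by the Hoelder inequality with all exponents equal to 1/m.
  Thus \<open>g b\<close> is integrated over every direction of the list except
  \<open>b\<close>.\<close>

lemma Loomis_Whitney_iterated:
  fixes B :: "'a::euclidean_space set"
  assumes B: "finite B" "card B = Suc m" "m > 0" "set bs \<subseteq> B" "distinct bs"
    and g [measurable]: "\<And>b. b \<in> B \<Longrightarrow> g b \<in> borel_measurable borel"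
    and shift: "\<And>b x t. b \<in> B \<Longrightarrow> g b (x + t *\<^sub>R b) = g b x"
  shows "foldr line_integral bs (\<lambda>x. \<Prod>b\<in>B. epow (g b x) (1 / m)) x
    \<le> (\<Prod>b\<in>B. epow (foldr line_integral (removeAll b bs) (g b) x) (1 / m))"
  using B(4,5)
proof (induction bs arbitrary: x)
  case (Cons c bs)
  let ?h = "\<lambda>b x. foldr line_integral (removeAll b bs) (g b) x"
  have c: "c \<in> B" "removeAll c bs = bs" "removeAll c (c # bs) = bs"
    using Cons.prems by auto
  have [measurable]: "?h b \<in> borel_measurable borel" if "b \<in> B" for b
    using that by measurable
  have card: "card (B - {c}) = m"
    using B c by simp
  have "foldr line_integral (c # bs) (\<lambda>x. \<Prod>b\<in>B. epow (g b x) (1 / m)) x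
      \<le> (\<integral>\<^sup>+t. (\<Prod>b\<in>B. epow (?h b (x + t *\<^sub>R c)) (1 / m)) \<partial>lborel)"
    using Cons by (auto simp: line_integral_def[of c] intro!: nn_integral_mono)
  also have "\<dots> = (\<integral>\<^sup>+t. epow (?h c x) (1 / m) * (\<Prod>b\<in>B-{c}. epow (?h b (x + t *\<^sub>R c)) (1 / m)) \<partial>lborel)"
    using c shift by (subst prod.remove[OF B(1) c(1)]) (simp add: iterated_line_integral_shift)
  also have "\<dots> = epow (?h c x) (1 / m) * (\<integral>\<^sup>+t. (\<Prod>b\<in>B-{c}. epow (?h b (x + t *\<^sub>R c)) (1 / m)) \<partial>lborel)"
    by (rule nn_integral_cmult) measurable
  also have "\<dots> \<le> epow (?h c x) (1 / m) * (\<Prod>b\<in>B-{c}. epow (\<integral>\<^sup>+t. ?h b (x + t *\<^sub>R c) \<partial>lborel) (1 / m))"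
    using B card by (intro mult_left_mono nn_integral_Holder) auto
  also have "\<dots> = (\<Prod>b\<in>B. epow (foldr line_integral (removeAll b (c # bs)) (g b) x) (1 / m))"
    using c by (subst prod.remove[OF B(1) c(1)]) (auto simp: line_integral_def[of c] intro!: arg_cong2[where f = "(*)"] prod.cong)
  finally show ?case .
qed simp

text \<open>With n the dimension, \<open>F\<close> to the power n/(n-1) is at most the product of
  its n line bounds, each to the power 1/(n-1). The bound with index \<open>b\<close> is constant in
  direction \<open>b\<close>, so the Loomis-Whitney inequality applies, and integrating it over the
  remaining directions yields the full integral of \<open>g\<close>.\<close>

lemma Gagliardo:
  fixes F g :: "'a::euclidean_space \<Rightarrow> ennreal"
  assumes [measurable]: "F \<in> borel_measurable borel" "g \<in> borel_measurable borel"
    and n: "DIM('a) \<ge> 2"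
    and le: "\<And>b x. b \<in> Basis \<Longrightarrow> F x \<le> line_integral b g x"
  shows "(\<integral>\<^sup>+x. epow (F x) (DIM('a) / (DIM('a) - 1)) \<partial>lborel)
    \<le> epow (\<integral>\<^sup>+x. g x \<partial>lborel) (DIM('a) / (DIM('a) - 1))"
proof -
  define m where "m = DIM('a) - 1"
  have m: "DIM('a) = Suc m" "m > 0"
    using n by (auto simp: m_def)
  obtain bs :: "'a list" where bs: "set bs = Basis" "distinct bs"
    using finite_distinct_list[OF finite_Basis] by auto
  have const: "(\<Prod>b\<in>(Basis :: 'a set). epow X (1 / m)) = epow X (DIM('a) / m)" for X
    by (simp only: prod_constant, subst epow_power) (auto simp: m)
  let ?G = "\<lambda>x. \<Prod>b\<in>(Basis :: 'a set). epow (line_integral b g x) (1 / m)"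
  have "(\<integral>\<^sup>+x. epow (F x) (DIM('a) / m) \<partial>lborel) \<le> (\<integral>\<^sup>+x. ?G x \<partial>lborel)"
    unfolding const[symmetric] by (intro nn_integral_mono prod_mono_ennreal epow_mono le) auto
  also have "\<dots> = foldr line_integral bs ?G 0"
    using bs by (subst iterated_line_integral_Basis) auto
  also have "\<dots> \<le> (\<Prod>b\<in>Basis. epow (foldr line_integral (removeAll b bs) (line_integral b g) 0) (1 / m))"
    using bs m by (intro Loomis_Whitney_iterated) (auto simp: line_integral_shift)
  also have "\<dots> = (\<Prod>b\<in>(Basis :: 'a set). epow (\<integral>\<^sup>+x. g x \<partial>lborel) (1 / m))"
  proof (rule prod.cong[OF refl])
    fix b :: 'a assume b: "b \<in> Basis"
    have "foldr line_integral (removeAll b bs) (line_integral b g) 0 =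
        foldr line_integral (removeAll b bs @ [b]) g 0"
      by simp
    also have "\<dots> = (\<integral>\<^sup>+x. g x \<partial>lborel)"
      using bs b by (intro iterated_line_integral_Basis) (auto simp: distinct_removeAll)
    finally show "epow (foldr line_integral (removeAll b bs) (line_integral b g) 0) (1 / m) =
        epow (\<integral>\<^sup>+x. g x \<partial>lborel) (1 / m)" by simp
  qed
  finally show ?thesis
    unfolding const unfolding m_def .
qed

section \<open>Smooth functions\<close>

lemma frechet_derivative_eqI:
  "(f has_derivative f') (at x) \<Longrightarrow> frechet_derivative f (at x) = f'"
  by (metis frechet_derivative_at)

lemma has_derivative_frechet:
  "f differentiable_on UNIV \<Longrightarrow> (f has_derivative frechet_derivative f (at x)) (at x)"
  by (simp add: differentiable_on_def frechet_derivative_works)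

text \<open>Trades the chosen \<open>frechet_derivative\<close> for any derivative given explicitly;
  the closure properties below and the smoothness of \<open>flat\<close> rest on it.\<close>

lemma C_k_on_UNIV_SucI:
  assumes "\<And>x. (g has_derivative g' x) (at x)" "\<And>b. b \<in> Basis \<Longrightarrow> C_k_on k UNIV (\<lambda>x. g' x b)"
  shows "C_k_on (Suc k) UNIV g"
proof -
  have "g differentiable (at x)" for x
    using assms(1) differentiable_def by blast
  moreover have "(\<lambda>x. frechet_derivative g (at x) b) = (\<lambda>x. g' x b)" for b
    using frechet_derivative_eqI[OF assms(1)] by simp
  ultimately show ?thesis
    using assms(2) by (simp add: differentiable_on_def)
qed

lemma C_k_on_Suc_imp: "C_k_on (Suc k) UNIV f \<Longrightarrow> C_k_on k UNIV f"
proof (induction k arbitrary: f)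
  case 0
  then show ?case by (simp add: differentiable_imp_continuous_on)
next
  case (Suc k)
  have "C_k_on k UNIV (\<lambda>x. frechet_derivative f (at x) b)" if "b \<in> Basis" for b
    using Suc.prems that by (subst (asm) C_k_on.simps(2)) (blast intro: Suc.IH)
  then show ?case
    using Suc.prems by simp
qed

lemma C_k_on_const: "C_k_on k UNIV (\<lambda>_. c)"
proof (induction k arbitrary: c)
  case (Suc k)
  then show ?case
    by (intro C_k_on_UNIV_SucI[where g' = "\<lambda>_ _. 0"]) auto
qed simp

lemma C_k_on_add: "C_k_on k UNIV f \<Longrightarrow> C_k_on k UNIV g \<Longrightarrow> C_k_on k UNIV (\<lambda>x. f x + g x)"
proof (induction k arbitrary: f g)
  case (Suc k)
  show ?case
  proof (rule C_k_on_UNIV_SucI)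
    show "((\<lambda>x. f x + g x) has_derivative
        (\<lambda>h. frechet_derivative f (at x) h + frechet_derivative g (at x) h)) (at x)" for x
      using Suc.prems by (intro has_derivative_add has_derivative_frechet) auto
  qed (use Suc in auto)
qed (simp add: continuous_intros)

lemma C_k_on_mult: "C_k_on k UNIV f \<Longrightarrow> C_k_on k UNIV g \<Longrightarrow> C_k_on k UNIV (\<lambda>x. f x * g x)"
proof (induction k arbitrary: f g)
  case (Suc k)
  \<comment> \<open>The product rule also contains the undifferentiated factors, so these are needed
    at the lower order \<open>k\<close> as well.\<close>
  note C = Suc.prems[THEN C_k_on_Suc_imp]
  show ?case
  proof (rule C_k_on_UNIV_SucI)
    show "((\<lambda>x. f x * g x) has_derivative
        (\<lambda>h. f x * frechet_derivative g (at x) h + frechet_derivative f (at x) h * g x)) (at x)" for x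
      using Suc.prems by (intro has_derivative_mult has_derivative_frechet) auto
  qed (use Suc C in \<open>auto intro!: C_k_on_add\<close>)
qed (simp add: continuous_intros)

lemma C_k_on_cmult: "C_k_on k UNIV f \<Longrightarrow> C_k_on k UNIV (\<lambda>x. c * f x)"
  by (intro C_k_on_mult C_k_on_const)

lemma C_k_on_prod:
  "(\<And>i. i \<in> I \<Longrightarrow> C_k_on k UNIV (f i)) \<Longrightarrow> C_k_on k UNIV (\<lambda>x. \<Prod>i\<in>I. f i x)"
  by (induction I rule: infinite_finite_induct) (auto intro!: C_k_on_const C_k_on_mult)

section \<open>Smooth bump functions on boxes\<close>

definition flat :: "nat \<Rightarrow> real \<Rightarrow> real" where
  "flat m s = (if s \<le> 0 then 0 else exp (- 1 / s) / s ^ m)"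

text \<open>The exponential series at 1/s is bounded below by its single term of index
  \<open>m + 2\<close>. The two powers of \<open>s\<close> left over after dividing by
  \<open>s ^ m\<close> give the derivative 0 at the origin.\<close>

lemma flat_bound: "\<bar>flat m s\<bar> \<le> fact (m + 2) * s\<^sup>2"
proof (cases "s \<le> 0")
  case False
  have "(1 / s) ^ (m + 2) / fact (m + 2) \<le> exp (1 / s)"
  proof -
    have "(\<Sum>k\<in>{m + 2}. (1 / s) ^ k /\<^sub>R fact k) \<le> exp (1 / s)"
      unfolding exp_def using False summable_exp_generic[of "1 / s"]
      by (intro sum_le_suminf) auto
    then show ?thesis by (simp add: field_simps)
  qed
  then have "1 \<le> exp (1 / s) * (fact (m + 2) * s ^ (m + 2))"
    using False by (simp add: field_simps power_divide del: fact_Suc)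
  then have "exp (- 1 / s) \<le> fact (m + 2) * s ^ (m + 2)"
    by (simp add: exp_minus field_simps del: fact_Suc)
  then show ?thesis
    using False by (simp add: flat_def field_simps power_add power2_eq_square del: fact_Suc)
qed (simp add: flat_def)

text \<open>The reason for the parameter \<open>m\<close>: dividing exp(-1/s) by powers of
  \<open>s\<close> gives a family closed under differentiation up to linear combinations, so
  smoothness follows by an induction over the order with \<open>m\<close> arbitrary. At 0 the
  difference quotient is O(|h|) by the quadratic bound.\<close>

lemma flat_DERIV: "(flat m has_real_derivative (flat (m + 2) s - m * flat (m + 1) s)) (at s)"
proof -
  consider "s < 0" | "s > 0" | "s = 0" by linarith
  then show ?thesis
  proof cases
    case 1
    have "((\<lambda>_. 0) has_real_derivative 0) (at s)" by simp
    then have "(flat m has_real_derivative 0) (at s)"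
      by (rule has_field_derivative_transform_within_open[where S = "{..<0}"]) (use 1 in \<open>auto simp: flat_def\<close>)
    then show ?thesis using 1 by (simp add: flat_def)
  next
    case 2
    have "((\<lambda>s. exp (- 1 / s) / s ^ m) has_real_derivative
        ((exp (- 1 / s) * (1 / s\<^sup>2)) * s ^ m - exp (- 1 / s) * (m * s ^ (m - 1))) / (s ^ m * s ^ m)) (at s)"
      using 2 by (auto intro!: derivative_eq_intros simp: power2_eq_square)
    also have "((exp (- 1 / s) * (1 / s\<^sup>2)) * s ^ m - exp (- 1 / s) * (m * s ^ (m - 1))) / (s ^ m * s ^ m)
        = exp (- 1 / s) / s ^ (m + 2) - m * (exp (- 1 / s) / s ^ (m + 1))"
      using 2 by (cases m) (simp_all add: field_simps power2_eq_square power_add)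
    finally have "((\<lambda>s. exp (- 1 / s) / s ^ m) has_real_derivative
        exp (- 1 / s) / s ^ (m + 2) - m * (exp (- 1 / s) / s ^ (m + 1))) (at s)" .
    then have "(flat m has_real_derivative
        exp (- 1 / s) / s ^ (m + 2) - m * (exp (- 1 / s) / s ^ (m + 1))) (at s)"
      by (rule has_field_derivative_transform_within_open[where S = "{0<..}"]) (use 2 in \<open>auto simp: flat_def\<close>)
    then show ?thesis using 2 by (simp add: flat_def)
  next
    case 3
    have "((\<lambda>h. (flat m h - flat m 0) / (h - 0)) \<longlongrightarrow> 0) (at 0)"
    proof (rule Lim_null_comparison)
      show "\<forall>\<^sub>F h in at 0. norm ((flat m h - flat m 0) / (h - 0)) \<le> fact (m + 2) * \<bar>h\<bar>"
      proof (rule always_eventually, rule allI)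
        fix h :: real
        show "norm ((flat m h - flat m 0) / (h - 0)) \<le> fact (m + 2) * \<bar>h\<bar>"
          using flat_bound[of m h]
          by (cases "h = 0") (auto simp: flat_def[of m 0] divide_le_eq abs_mult power2_eq_square algebra_simps
              simp del: fact_Suc)
      qed
      have "((\<lambda>h::real. fact (m + 2) * \<bar>h\<bar>) \<longlongrightarrow> fact (m + 2) * \<bar>0\<bar>) (at 0)"
        by (intro tendsto_intros)
      then show "((\<lambda>h::real. fact (m + 2) * \<bar>h\<bar>) \<longlongrightarrow> 0) (at 0)"
        by simp
    qed
    then show ?thesis
      using 3 by (simp add: has_field_derivative_iff flat_def[of _ 0])
  qed
qed

lemma C_k_on_flat: "C_k_on k UNIV (\<lambda>x::'a::euclidean_space. flat m (x \<bullet> v - a))"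
proof (induction k arbitrary: m)
  case 0
  have "isCont (flat m) s" for s
    using flat_DERIV DERIV_isCont by blast
  then have "continuous_on UNIV (flat m)"
    by (simp add: continuous_at_imp_continuous_on)
  then show ?case
    by (auto intro!: continuous_on_compose2[of UNIV "flat m"] continuous_intros)
next
  case (Suc k)
  show ?case
  proof (rule C_k_on_UNIV_SucI)
    show "((\<lambda>x. flat m (x \<bullet> v - a)) has_derivative
       (\<lambda>h. (flat (m + 2) (x \<bullet> v - a) + (- m) * flat (m + 1) (x \<bullet> v - a)) * (h \<bullet> v))) (at x)" for x
      by (rule has_derivative_eq_rhs, rule DERIV_compose_FDERIV[OF flat_DERIV])
         (auto intro!: derivative_eq_intros)
  qed (intro C_k_on_mult C_k_on_add C_k_on_const Suc)
qed

text \<open>The arguments are written as \<open>x \<bullet> v - a\<close> so that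
  \<open>C_k_on_flat\<close> applies literally; \<open>box_bump_eq\<close> is the readable form. The
  factor \<open>Suc k\<close> steepens the profile: inside the open box every factor tends to 1,
  while outside it the product stays 0.\<close>

definition box_bump :: "'a::euclidean_space \<Rightarrow> 'a \<Rightarrow> nat \<Rightarrow> 'a \<Rightarrow> real" where
  "box_bump p q k x = (\<Prod>b\<in>Basis. flat 0 (x \<bullet> (real (Suc k) *\<^sub>R b) - real (Suc k) * (p \<bullet> b)) *
     flat 0 (x \<bullet> (- real (Suc k) *\<^sub>R b) - real (Suc k) * - (q \<bullet> b)))"

lemma flat_0_bounds: "0 \<le> flat 0 s" "flat 0 s \<le> 1"
  by (auto simp: flat_def)

lemma box_bump_bounds: "0 \<le> box_bump p q k x" "box_bump p q k x \<le> 1"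
  by (auto simp: box_bump_def intro!: prod_nonneg prod_le_1 mult_nonneg_nonneg mult_le_one flat_0_bounds)

lemma box_bump_eq:
  "box_bump p q k x = (\<Prod>b\<in>Basis. flat 0 (real (Suc k) * (x \<bullet> b - p \<bullet> b)) *
     flat 0 (real (Suc k) * (q \<bullet> b - x \<bullet> b)))"
  unfolding box_bump_def by (intro prod.cong) (auto simp: algebra_simps)

lemma flat_0_tendsto:
  assumes "s > 0"
  shows "(\<lambda>k. flat 0 (real (Suc k) * s)) \<longlonglongrightarrow> 1"
proof -
  have "(\<lambda>k. exp (- (1 / s) * inverse (real (Suc k)))) \<longlonglongrightarrow> exp (- (1 / s) * 0)"
    by (intro tendsto_intros LIMSEQ_inverse_real_of_nat)
  also have "(\<lambda>k. exp (- (1 / s) * inverse (real (Suc k)))) = (\<lambda>k. flat 0 (real (Suc k) * s))"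
    using assms by (auto simp: flat_def fun_eq_iff divide_simps mult_le_0_iff)
  finally show ?thesis by simp
qed

lemma box_bump_eq_0: "x \<notin> box p q \<Longrightarrow> box_bump p q k x = 0"
  unfolding box_bump_eq
  by (auto simp: box_def flat_def not_less mult_le_0_iff intro!: prod_zero)

lemma box_bump_tendsto: "(\<lambda>k. box_bump p q k x) \<longlonglongrightarrow> indicator (box p q) x"
proof (cases "x \<in> box p q")
  case True
  then have "(\<lambda>k. box_bump p q k x) \<longlonglongrightarrow> (\<Prod>b\<in>(Basis::'a set). 1 * 1)"
    unfolding box_bump_eq
    by (intro tendsto_prod tendsto_mult flat_0_tendsto) (auto simp: box_def)
  then show ?thesis using True by simp
qed (simp add: box_bump_eq_0)

lemma box_bump_test_function:
  assumes "cbox p q \<subseteq> D"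
  shows "box_bump p q k \<in> test_functions D"
proof -
  have sub: "closure {x. box_bump p q k x \<noteq> 0} \<subseteq> cbox p q"
    by (intro closure_minimal closed_cbox) (use box_bump_eq_0 box_subset_cbox in blast)
  moreover have "compact (closure {x. box_bump p q k x \<noteq> 0})"
    using bounded_subset[OF bounded_cbox sub] by (simp add: compact_eq_bounded_closed)
  moreover have "C_k_on j UNIV (box_bump p q k)" for j
    unfolding box_bump_def by (intro C_k_on_prod C_k_on_mult C_k_on_flat)
  ultimately show ?thesis
    using assms by (auto simp: test_functions_def)
qed

lemma test_functions_lincomb:
  assumes "\<phi> \<in> test_functions D" "\<psi> \<in> test_functions D"
  shows "(\<lambda>x. \<phi> x + c * \<psi> x) \<in> test_functions D"
proof -
  let ?S = "\<lambda>\<phi>::'a \<Rightarrow> real. closure {x. \<phi> x \<noteq> 0}"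
  have sub: "?S (\<lambda>x. \<phi> x + c * \<psi> x) \<subseteq> ?S \<phi> \<union> ?S \<psi>"
    unfolding closure_Un[symmetric] by (intro closure_mono) auto
  have "compact (?S \<phi> \<union> ?S \<psi>)"
    using assms by (auto simp: test_functions_def)
  then have "compact (?S (\<lambda>x. \<phi> x + c * \<psi> x))"
    using sub by (meson bounded_subset compact_eq_bounded_closed closed_closure)
  then show ?thesis
    using sub assms by (auto simp: test_functions_def intro!: C_k_on_add C_k_on_cmult)
qed

definition grad :: "('a::euclidean_space \<Rightarrow> real) \<Rightarrow> 'a \<Rightarrow> 'a" where
  "grad \<phi> x = (\<Sum>b\<in>Basis. frechet_derivative \<phi> (at x) b *\<^sub>R b)"

lemma grad_inner_Basis: "b \<in> Basis \<Longrightarrow> grad \<phi> x \<bullet> b = frechet_derivative \<phi> (at x) b"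
  by (simp add: grad_def inner_sum_left inner_Basis if_distrib cong: if_cong)

lemma test_function_C1:
  assumes "\<phi> \<in> test_functions D"
  shows "\<phi> differentiable_on UNIV" "continuous_on UNIV (grad \<phi>)" "continuous_on UNIV \<phi>"
proof -
  have "C_k_on (Suc 0) UNIV \<phi>" "C_k_on 0 UNIV \<phi>"
    using assms unfolding test_functions_def by blast+
  then show "\<phi> differentiable_on UNIV" "continuous_on UNIV (grad \<phi>)" "continuous_on UNIV \<phi>"
    unfolding grad_def by (auto intro!: continuous_intros)
qed

lemma has_derivative_grad:
  assumes "\<phi> differentiable_on UNIV"
  shows "(\<phi> has_derivative (\<lambda>h. grad \<phi> x \<bullet> h)) (at x)"
proof -
  let ?D = "frechet_derivative \<phi> (at x)"
  have D: "(\<phi> has_derivative ?D) (at x)"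
    using has_derivative_frechet[OF assms] .
  then interpret linear ?D
    by (rule has_derivative_linear)
  have "?D h = grad \<phi> x \<bullet> h" for h
  proof -
    have "?D h = ?D (\<Sum>b\<in>Basis. (h \<bullet> b) *\<^sub>R b)"
      by (simp add: euclidean_representation)
    also have "\<dots> = (\<Sum>b\<in>Basis. (h \<bullet> b) * ?D b)"
      by (simp add: sum scale)
    also have "\<dots> = grad \<phi> x \<bullet> h"
      by (simp add: grad_def inner_sum_left inner_commute[of h] mult.commute)
    finally show ?thesis .
  qed
  then have "?D = (\<lambda>h. grad \<phi> x \<bullet> h)" by auto
  then show ?thesis using D by simp
qed

lemma grad_eqI:
  assumes "(\<phi> has_derivative (\<lambda>h. v \<bullet> h)) (at x)"
  shows "grad \<phi> x = v"
  unfolding grad_def frechet_derivative_eqI[OF assms] by (simp add: euclidean_representation)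

lemma grad_eq_0_outside_support:
  assumes "x \<notin> closure {x. \<phi> x \<noteq> 0}"
  shows "grad \<phi> x = 0"
proof (rule grad_eqI)
  have "((\<lambda>_. 0) has_derivative (\<lambda>h. 0)) (at x)" by simp
  then show "(\<phi> has_derivative (\<lambda>h. 0 \<bullet> h)) (at x)"
    by (simp, rule has_derivative_transform_within_open[where s = "- closure {x. \<phi> x \<noteq> 0}"])
       (use assms closure_subset[of "{x. \<phi> x \<noteq> 0}"] in auto)
qed

lemma test_function_support:
  assumes "\<phi> \<in> test_functions D"
  obtains K where "compact K" "K \<subseteq> D" "\<And>x. x \<notin> K \<Longrightarrow> \<phi> x = 0" "\<And>x. x \<notin> K \<Longrightarrow> grad \<phi> x = 0"
proof
  let ?K = "closure {x. \<phi> x \<noteq> 0}"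
  show "compact ?K" "?K \<subseteq> D"
    using assms by (auto simp: test_functions_def)
  show "x \<notin> ?K \<Longrightarrow> \<phi> x = 0" for x
    using closure_subset[of "{x. \<phi> x \<noteq> 0}"] by blast
qed (rule grad_eq_0_outside_support)

lemma continuous_compact_support_bounded:
  fixes f :: "'a::euclidean_space \<Rightarrow> 'b::real_normed_vector"
  assumes "continuous_on UNIV f" "compact K" "\<And>x. x \<notin> K \<Longrightarrow> f x = 0"
  obtains B where "B > 0" "\<And>x. norm (f x) \<le> B"
proof -
  have "bounded (f ` K)"
    using assms by (meson compact_continuous_image compact_imp_bounded continuous_on_subset subset_UNIV)
  then obtain B where "B > 0" "\<forall>y\<in>f ` K. norm y \<le> B"
    using bounded_pos by blast
  then show ?thesis
    using assms(3) by (intro that[of B]) (metis imageI less_imp_le norm_zero)+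
qed

lemma test_function_bounded:
  assumes "\<phi> \<in> test_functions D"
  obtains B where "B > 0" "\<And>x. \<bar>\<phi> x\<bar> \<le> B" "\<And>x. norm (grad \<phi> x) \<le> B"
proof -
  obtain K where K: "compact K" "\<And>x. x \<notin> K \<Longrightarrow> \<phi> x = 0" "\<And>x. x \<notin> K \<Longrightarrow> grad \<phi> x = 0"
    using assms test_function_support by metis
  obtain B where "B > 0" "\<And>x. norm (\<phi> x) \<le> B"
    using continuous_compact_support_bounded test_function_C1(3)[OF assms] K by metis
  moreover obtain B' where "B' > 0" "\<And>x. norm (grad \<phi> x) \<le> B'"
    using continuous_compact_support_bounded test_function_C1(2)[OF assms] K by metis
  ultimately show ?thesis
    by (intro that[of "max B B'"]) (auto simp: le_max_iff_disj)
qed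

section \<open>Weak gradients\<close>

lemma integrable_continuous_compact_support:
  fixes f :: "'a::euclidean_space \<Rightarrow> 'b::{banach, second_countable_topology}"
  assumes "continuous_on UNIV f" "compact K" "\<And>x. x \<notin> K \<Longrightarrow> f x = 0"
  shows "integrable lborel f"
proof -
  have "integrable lborel (\<lambda>x. indicator K x *\<^sub>R f x)"
    using assms by (intro borel_integrable_compact) (auto intro: continuous_on_subset)
  also have "(\<lambda>x. indicator K x *\<^sub>R f x) = f"
    using assms(3) by (auto simp: indicator_def fun_eq_iff)
  finally show ?thesis .
qed

lemma integral_translate:
  fixes f :: "'a::euclidean_space \<Rightarrow> 'b::{banach, second_countable_topology}"
  assumes [measurable]: "f \<in> borel_measurable borel"
  shows "(LINT x|lborel. f (x + c)) = (LINT x|lborel. f x)"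
proof -
  have "(LINT x|lborel. f x) = (LINT x|distr lborel borel ((+) c). f x)"
    by (simp add: lborel_distr_plus)
  also have "\<dots> = (LINT x|lborel. f (c + x))"
    by (rule integral_distr) measurable
  finally show ?thesis by (simp add: add.commute)
qed

text \<open>The difference quotients have integral 0 by translation invariance.\<close>

lemma integral_grad_compact_support:
  fixes F :: "'a::euclidean_space \<Rightarrow> real"
  assumes F: "F differentiable_on UNIV" "continuous_on UNIV (grad F)"
    and K: "compact K" "\<And>x. x \<notin> K \<Longrightarrow> F x = 0" "\<And>x. x \<notin> K \<Longrightarrow> grad F x = 0"
  shows "(LINT x|lborel. grad F x \<bullet> b) = 0"
proof -
  have cF: "continuous_on UNIV F"
    using F(1) by (rule differentiable_imp_continuous_on)
  then have [measurable]: "F \<in> borel_measurable borel"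
    by (rule borel_measurable_continuous_onI)
  have iF: "integrable lborel F" "integrable lborel (\<lambda>x. F (x + c))" for c
  proof -
    show "integrable lborel F"
      using integrable_continuous_compact_support[OF cF K(1,2)] by blast
    then have "integrable (distr lborel borel ((+) c)) F"
      by (simp add: lborel_distr_plus)
    then show "integrable lborel (\<lambda>x. F (x + c))"
      by (subst (asm) integrable_distr_eq) (auto simp: add.commute)
  qed
  obtain B where B: "B > 0" "\<And>x. norm (grad F x) \<le> B"
    using continuous_compact_support_bounded[OF F(2) K(1,3)] by blast
  obtain R where R: "\<And>x. x \<in> K \<Longrightarrow> norm x \<le> R"
    using compact_imp_bounded[OF K(1)] by (meson bounded_iff)
  define h where "h k = inverse (real (Suc k))" for k
  have h: "0 < h k" "h k \<le> 1" for k
    by (auto simp: h_def field_simps)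
  define q where "q k x = (F (x + h k *\<^sub>R b) - F x) / h k" for k x
  have lip: "norm (F x - F y) \<le> B * norm (x - y)" for x y
  proof (rule differentiable_bound[OF convex_UNIV])
    fix x
    show "(F has_derivative (\<lambda>h. grad F x \<bullet> h)) (at x within UNIV)"
      using has_derivative_grad[OF F(1)] by simp
    show "onorm (\<lambda>h. grad F x \<bullet> h) \<le> B"
      by (rule order_trans[OF onorm_inner_right[OF bounded_linear_ident]])
         (use B in \<open>simp add: onorm_id\<close>)
  qed auto
  have "(\<lambda>k. LINT x|lborel. q k x) \<longlonglongrightarrow> (LINT x|lborel. grad F x \<bullet> b)"
  proof (rule integral_dominated_convergence)
    show "(\<lambda>x. grad F x \<bullet> b) \<in> borel_measurable lborel"
      using F(2) by (simp add: borel_measurable_continuous_onI continuous_intros)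
    show "q k \<in> borel_measurable lborel" for k
      unfolding q_def by measurable
    \<comment> \<open>All difference quotients vanish outside one ball because the step sizes
      \<open>h k\<close> are at most 1; on that ball the Lipschitz constant \<open>B\<close> gives
      the bound.\<close>
    show "integrable lborel (\<lambda>x. indicator (cball 0 (R + norm b)) x *\<^sub>R (B * norm b))"
      by (rule borel_integrable_compact) auto
    show "AE x in lborel. (\<lambda>k. q k x) \<longlonglongrightarrow> grad F x \<bullet> b"
    proof (rule AE_I2)
      fix x
      have "((\<lambda>t. x + t *\<^sub>R b) has_derivative (\<lambda>t. t *\<^sub>R b)) (at 0)"
        by (auto intro!: derivative_eq_intros)
      then have "((\<lambda>t. F (x + t *\<^sub>R b)) has_derivative (\<lambda>t. grad F x \<bullet> (t *\<^sub>R b))) (at 0)"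
        using has_derivative_compose[of "\<lambda>t. x + t *\<^sub>R b" "\<lambda>t. t *\<^sub>R b" 0 UNIV F "\<lambda>h. grad F x \<bullet> h"]
          has_derivative_grad[OF F(1), of x]
        by simp
      then have "((\<lambda>t. F (x + t *\<^sub>R b)) has_real_derivative (grad F x \<bullet> b)) (at 0)"
        by (simp add: has_field_derivative_def mult_commute_abs)
      then have "((\<lambda>t. (F (x + t *\<^sub>R b) - F x) / t) \<longlongrightarrow> grad F x \<bullet> b) (at 0)"
        by (simp add: has_field_derivative_iff)
      moreover have "filterlim h (at 0) sequentially"
        unfolding filterlim_at h_def using LIMSEQ_inverse_real_of_nat by simp
      ultimately show "(\<lambda>k. q k x) \<longlonglongrightarrow> grad F x \<bullet> b"
        unfolding q_def by (rule filterlim_compose)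
    qed
    show "AE x in lborel. norm (q k x) \<le> indicator (cball 0 (R + norm b)) x *\<^sub>R (B * norm b)" for k
    proof (rule AE_I2)
      fix x
      show "norm (q k x) \<le> indicator (cball 0 (R + norm b)) x *\<^sub>R (B * norm b)"
      proof (cases "norm x \<le> R + norm b")
        case True
        then show ?thesis
          using lip[of "x + h k *\<^sub>R b" x] h[of k] by (simp add: q_def field_simps)
      next
        case False
        have "norm x \<le> norm (x + h k *\<^sub>R b) + norm b"
          using norm_triangle_ineq4[of "x + h k *\<^sub>R b" "h k *\<^sub>R b"] h[of k]
            mult_right_mono[of "h k" 1 "norm b"] by simp
        then have "x \<notin> K" "x + h k *\<^sub>R b \<notin> K"
          using False R[of x] R[of "x + h k *\<^sub>R b"] norm_ge_zero[of b] by linarith+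
        then show ?thesis using K(2) B(1) by (simp add: q_def)
      qed
    qed
  qed
  moreover have "(LINT x|lborel. q k x) = 0" for k
    unfolding q_def using iF h[of k] by (simp add: integral_translate)
  ultimately show ?thesis
    by (simp add: LIMSEQ_const_iff)
qed

lemma grad_mult:
  assumes "\<phi> differentiable_on UNIV" "\<psi> differentiable_on UNIV"
  shows "grad (\<lambda>x. \<phi> x * \<psi> x) x = \<phi> x *\<^sub>R grad \<psi> x + \<psi> x *\<^sub>R grad \<phi> x"
  by (rule grad_eqI, rule has_derivative_eq_rhs,
      rule has_derivative_mult[OF has_derivative_grad[OF assms(1)] has_derivative_grad[OF assms(2)]])
     (simp add: inner_add_left mult.commute)

lemma locally_summable_continuous:
  assumes "continuous_on D u"
  shows "locally_summable D u"
  unfolding locally_summable_def set_integrable_def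
proof safe
  fix K assume K: "compact K" "K \<subseteq> D"
  have "integrable lborel (\<lambda>x. indicator K x *\<^sub>R u x)"
    using K assms by (intro borel_integrable_compact) (auto intro: continuous_on_subset)
  then show "integrable lebesgue (\<lambda>x. indicator K x *\<^sub>R u x)"
    by (subst integrable_completion) auto
qed

text \<open>Integration by parts: the product with the second test function \<psi> is of class C^1
  and vanishes wherever \<psi> does, so its gradient has integral 0.\<close>

lemma has_weak_gradient_test_function:
  assumes \<phi>: "\<phi> \<in> test_functions D"
  shows "has_weak_gradient D \<phi> (grad \<phi>)"
  unfolding has_weak_gradient_def
proof (intro conjI ballI)
  note C = test_function_C1
  show "locally_summable D \<phi>" "locally_summable D (grad \<phi>)"
    using C[OF \<phi>] by (auto intro!: locally_summable_continuous intro: continuous_on_subset)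
  fix \<psi> :: "'a \<Rightarrow> real" and b :: 'a assume \<psi>: "\<psi> \<in> test_functions D" and b: "b \<in> Basis"
  obtain K where K: "compact K" "K \<subseteq> D" "\<And>x. x \<notin> K \<Longrightarrow> \<psi> x = 0" "\<And>x. x \<notin> K \<Longrightarrow> grad \<psi> x = 0"
    using test_function_support[OF \<psi>] by metis
  have cont: "continuous_on UNIV (\<lambda>x. \<phi> x * (grad \<psi> x \<bullet> b))" "continuous_on UNIV (\<lambda>x. (grad \<phi> x \<bullet> b) * \<psi> x)"
    using C[OF \<phi>] C[OF \<psi>] by (auto intro!: continuous_intros)
  then have [measurable]: "(\<lambda>x. \<phi> x * (grad \<psi> x \<bullet> b)) \<in> borel_measurable borel"
      "(\<lambda>x. (grad \<phi> x \<bullet> b) * \<psi> x) \<in> borel_measurable borel"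
    by (auto intro: borel_measurable_continuous_onI)
  have int: "integrable lborel (\<lambda>x. \<phi> x * (grad \<psi> x \<bullet> b))" "integrable lborel (\<lambda>x. (grad \<phi> x \<bullet> b) * \<psi> x)"
    using K by (auto intro!: integrable_continuous_compact_support[OF cont(1) K(1)]
        integrable_continuous_compact_support[OF cont(2) K(1)])
  have gm: "grad (\<lambda>x. \<phi> x * \<psi> x) x = \<phi> x *\<^sub>R grad \<psi> x + \<psi> x *\<^sub>R grad \<phi> x" for x
    using C[OF \<phi>] C[OF \<psi>] by (intro grad_mult) auto
  have "0 = (LINT x|lborel. grad (\<lambda>x. \<phi> x * \<psi> x) x \<bullet> b)"
    using C[OF \<phi>] C[OF \<psi>] K(3,4)
    by (intro integral_grad_compact_support[OF _ _ K(1), symmetric])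
       (auto simp: gm[abs_def] intro!: continuous_intros derivative_intros)
  also have "(\<lambda>x. grad (\<lambda>x. \<phi> x * \<psi> x) x \<bullet> b) = (\<lambda>x. \<phi> x * (grad \<psi> x \<bullet> b) + (grad \<phi> x \<bullet> b) * \<psi> x)"
    unfolding gm by (simp add: inner_add_left mult.commute)
  finally have "(LINT x|lborel. \<phi> x * (grad \<psi> x \<bullet> b)) = - (LINT x|lborel. (grad \<phi> x \<bullet> b) * \<psi> x)"
    using int by simp
  moreover have "(\<lambda>x. indicator D x *\<^sub>R (\<phi> x * (grad \<psi> x \<bullet> b))) = (\<lambda>x. \<phi> x * (grad \<psi> x \<bullet> b))"
      "(\<lambda>x. indicator D x *\<^sub>R ((grad \<phi> x \<bullet> b) * \<psi> x)) = (\<lambda>x. (grad \<phi> x \<bullet> b) * \<psi> x)"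
    using K(2-4) by (auto simp: indicator_def subset_iff fun_eq_iff) (metis inner_zero_left subsetD)
  ultimately show "(LINT x:D|lebesgue. \<phi> x * frechet_derivative \<psi> (at x) b) =
      - (LINT x:D|lebesgue. (grad \<phi> x \<bullet> b) * \<psi> x)"
    unfolding set_lebesgue_integral_def grad_inner_Basis[OF b, symmetric]
    by (simp only: integral_completion) (simp add: integral_completion)
qed

text \<open>Dynkin's argument: boxes are stable under intersection and generate the Borel sets, and
  the sets over which the integral vanishes are closed under complements and countable disjoint
  unions. The total integral enters through the complements.\<close>

lemma integral_eq_0_on_borel_if_on_boxes:
  fixes f :: "'a::euclidean_space \<Rightarrow> real"
  assumes f: "integrable lborel f"
    and box: "\<And>p q. (LINT x:box p q|lborel. f x) = 0" and UN: "(LINT x|lborel. f x) = 0"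
    and A: "A \<in> sets borel"
  shows "(LINT x:A|lborel. f x) = 0"
proof -
  have si: "set_integrable lborel A f" if "A \<in> sets borel" for A
    using f that unfolding set_integrable_def by (intro integrable_mult_indicator) auto
  have sets: "sets borel = sigma_sets UNIV (range (\<lambda>(a, b). box a b :: 'a set))"
    by (subst borel_eq_box) simp
  have "Int_stable (range (\<lambda>(a, b). box a b :: 'a set))"
    by (auto simp: Int_stable_def box_Int_box)
  moreover have "range (\<lambda>(a, b). box a b :: 'a set) \<subseteq> Pow UNIV" by simp
  moreover have "A \<in> sigma_sets UNIV (range (\<lambda>(a, b). box a b :: 'a set))"
    using A sets by simp
  ultimately show ?thesis
  proof (induction rule: sigma_sets_induct_disjoint)
    case (basic A)
    then show ?case using box by auto
  next
    case empty
    then show ?case by (simp add: set_lebesgue_integral_def)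
  next
    case (compl A)
    then have A: "A \<in> sets borel" using sets by simp
    have "(LINT x:A \<union> - A|lborel. f x) = (LINT x:A|lborel. f x) + (LINT x:-A|lborel. f x)"
      using A by (intro set_integral_Un si) auto
    then show ?case
      using UN compl by (simp add: set_lebesgue_integral_def Compl_eq_Diff_UNIV)
  next
    case (union A)
    then have "A i \<in> sets borel" for i using sets by auto
    then have "(LINT x:(\<Union>i. A i)|lborel. f x) = (\<Sum>i. (LINT x:A i|lborel. f x))"
      using union(1) by (intro lebesgue_integral_countable_add si) (auto simp: disjoint_family_on_def)
    then show ?case using union by simp
  qed
qed

lemma AE_eq_0_if_integral_boxes:
  fixes f :: "'a::euclidean_space \<Rightarrow> real"
  assumes f: "integrable lebesgue f"
    and box: "\<And>p q. (LINT x:box p q|lebesgue. f x) = 0" and UN: "(LINT x|lebesgue. f x) = 0"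
  shows "AE x in lebesgue. f x = 0"
proof -
  \<comment> \<open>A Borel version is required because the boxes generate only the Borel
    sets.\<close>
  obtain g where [measurable]: "g \<in> borel_measurable lborel" and fg: "AE x in lborel. f x = g x"
    using completion_ex_borel_measurable_real[of f lborel] f by auto
  have fg': "AE x in lebesgue. f x = g x"
    using fg by (rule AE_completion)
  have [measurable]: "f \<in> borel_measurable lebesgue"
    using f by auto
  have [measurable]: "g \<in> borel_measurable lebesgue"
    by (rule measurable_completion) simp
  have "integrable lebesgue g"
    using f fg' by (subst (asm) integrable_cong_AE) auto
  then have g: "integrable lborel g"
    by (subst (asm) integrable_completion) auto
  have eq: "(LINT x:A|lborel. g x) = (LINT x:A|lebesgue. f x)" if "A \<in> sets borel" for A
  proof -
    have [measurable]: "A \<in> sets lebesgue" using that by auto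
    have "(LINT x:A|lebesgue. f x) = (LINT x:A|lebesgue. g x)"
      unfolding set_lebesgue_integral_def using fg' by (intro integral_cong_AE) auto
    also have "\<dots> = (LINT x:A|lborel. g x)"
      unfolding set_lebesgue_integral_def using that by (intro integral_completion) simp
    finally show ?thesis by simp
  qed
  have "AE x in lborel. g x = 0"
  proof (rule density_unique_real[OF g])
    fix A :: "'a set" assume "A \<in> sets lborel"
    then show "(LINT x:A|lborel. g x) = (LINT x:A|lborel. 0)"
      using g box UN eq eq[of UNIV] by (subst integral_eq_0_on_borel_if_on_boxes) (auto simp: set_lebesgue_integral_def)
  qed simp
  then have "AE x in lborel. f x = 0"
    using fg by eventually_elim auto
  then show ?thesis by (rule AE_completion)
qed

lemma set_integrable_mult_bounded_support:
  fixes u \<phi> :: "'a::euclidean_space \<Rightarrow> real"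
  assumes u: "locally_summable D u" and K: "compact K" "K \<subseteq> D" "\<And>x. x \<notin> K \<Longrightarrow> \<phi> x = 0"
    and \<phi>: "continuous_on UNIV \<phi>"
  shows "set_integrable lebesgue D (\<lambda>x. u x * \<phi> x)"
proof -
  obtain B where B: "\<And>x. norm (\<phi> x) \<le> B"
    using continuous_compact_support_bounded[OF \<phi> K(1,3)] by blast
  have "\<phi> \<in> borel_measurable borel"
    using \<phi> by (rule borel_measurable_continuous_onI)
  then have [measurable]: "\<phi> \<in> borel_measurable lebesgue"
    by (intro measurable_completion) simp
  have int: "integrable lebesgue (\<lambda>x. indicator K x * u x)"
    using u K by (auto simp: locally_summable_def set_integrable_def)
  have "integrable lebesgue (\<lambda>x. \<phi> x * (indicator K x * u x))"
  proof (rule Bochner_Integration.integrable_bound)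
    show "integrable lebesgue (\<lambda>x. B * (indicator K x * u x))"
      using int by simp
    show "(\<lambda>x. \<phi> x * (indicator K x * u x)) \<in> borel_measurable lebesgue"
      using int by measurable
    show "AE x in lebesgue. norm (\<phi> x * (indicator K x * u x)) \<le> norm (B * (indicator K x * u x))"
      using B by (intro AE_I2) (auto simp: abs_mult intro!: mult_right_mono intro: order_trans[OF _ abs_ge_self])
  qed
  also have "(\<lambda>x. \<phi> x * (indicator K x * u x)) = (\<lambda>x. indicator D x *\<^sub>R (u x * \<phi> x))"
    using K by (auto simp: indicator_def fun_eq_iff)
  finally show ?thesis by (simp add: set_integrable_def)
qed

text \<open>Box bumps are admissible test functions and converge boundedly to the indicator of the
  box, so \<open>g\<close> has integral 0 over every open box whose closed box lies in
  \<open>D\<close>. Cutting \<open>g\<close> off to such a box makes it integrable on the whole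
  space and reduces the claim to the previous lemma; countably many closed boxes cover
  \<open>D\<close>.\<close>

lemma fundamental_lemma_calculus_of_variations:
  fixes g :: "'a::euclidean_space \<Rightarrow> real"
  assumes D: "open D" and g: "locally_summable D g"
    and eq: "\<And>\<phi>. \<phi> \<in> test_functions D \<Longrightarrow> (LINT x:D|lebesgue. g x * \<phi> x) = 0"
  shows "AE x in lebesgue. x \<in> D \<longrightarrow> g x = 0"
proof -
  have box0: "(LINT x:box p q|lebesgue. g x) = 0" if pq: "cbox p q \<subseteq> D" for p q
  proof -
    have int: "integrable lebesgue (\<lambda>x. indicator (cbox p q) x * g x)"
      using g pq by (auto simp: locally_summable_def set_integrable_def)
    have meas: "box_bump p q k \<in> borel_measurable lebesgue" for k
    proof (rule measurable_completion)
      show "box_bump p q k \<in> borel_measurable lborel"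
        using test_function_C1(3)[OF box_bump_test_function[OF pq]] by (simp add: borel_measurable_continuous_onI)
    qed
    have "(\<lambda>k. LINT x|lebesgue. box_bump p q k x * (indicator (cbox p q) x * g x)) \<longlonglongrightarrow>
        (LINT x|lebesgue. indicator (box p q) x * (indicator (cbox p q) x * g x))"
    proof (rule integral_dominated_convergence)
      show "integrable lebesgue (\<lambda>x. norm (indicator (cbox p q) x * g x))"
        using int by (rule integrable_norm)
      show "(\<lambda>x. box_bump p q k x * (indicator (cbox p q) x * g x)) \<in> borel_measurable lebesgue" for k
        by (intro borel_measurable_times meas borel_measurable_integrable[OF int])
      show "(\<lambda>x. indicator (box p q) x * (indicator (cbox p q) x * g x)) \<in> borel_measurable lebesgue"
        by (intro borel_measurable_times borel_measurable_indicator borel_measurable_integrable[OF int]) auto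
      show "AE x in lebesgue. (\<lambda>k. box_bump p q k x * (indicator (cbox p q) x * g x)) \<longlonglongrightarrow>
          indicator (box p q) x * (indicator (cbox p q) x * g x)"
        by (intro AE_I2 tendsto_intros box_bump_tendsto)
      show "AE x in lebesgue. norm (box_bump p q k x * (indicator (cbox p q) x * g x))
          \<le> norm (indicator (cbox p q) x * g x)" for k
        using box_bump_bounds[of p q k] by (intro AE_I2) (auto simp: abs_mult intro!: mult_left_le_one_le)
    qed
    moreover have "(\<lambda>x. box_bump p q k x * (indicator (cbox p q) x * g x)) =
        (\<lambda>x. indicator D x *\<^sub>R (g x * box_bump p q k x))" for k
    proof
      show "box_bump p q k x * (indicator (cbox p q) x * g x) = indicator D x *\<^sub>R (g x * box_bump p q k x)" for x
        using pq box_subset_cbox[of p q] box_bump_eq_0[of x p q k] by (cases "x \<in> box p q") (auto simp: indicator_def)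
    qed
    then have "(LINT x|lebesgue. box_bump p q k x * (indicator (cbox p q) x * g x)) = 0" for k
      using eq[OF box_bump_test_function[OF pq]] by (simp only: set_lebesgue_integral_def)
    moreover have "(\<lambda>x. indicator (box p q) x * (indicator (cbox p q) x * g x)) = (\<lambda>x. indicator (box p q) x *\<^sub>R g x)"
      using box_subset_cbox[of p q] by (auto simp: indicator_def fun_eq_iff)
    ultimately show ?thesis
      by (simp add: set_lebesgue_integral_def LIMSEQ_const_iff)
  qed
  have AE_box: "AE x in lebesgue. x \<in> cbox c d \<longrightarrow> g x = 0" if cd: "cbox c d \<subseteq> D" for c d
  proof -
    let ?f = "\<lambda>x. indicator (box c d) x * g x"
    \<comment> \<open>Nonemptiness matters: an empty open box may have a nonempty degenerate closed
      box, which need not lie in \<open>D\<close>.\<close>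
    have sub: "cbox p q \<subseteq> D" if "box p q \<subseteq> box c d" "box p q \<noteq> {}" for p q
    proof -
      have "cbox p q = closure (box p q)"
        using that(2) by (simp add: closure_box)
      also have "\<dots> \<subseteq> cbox c d"
        using that(1) box_subset_cbox[of c d] by (intro closure_minimal closed_cbox) blast
      finally show ?thesis using cd by blast
    qed
    have "AE x in lebesgue. ?f x = 0"
    proof (rule AE_eq_0_if_integral_boxes)
      have "integrable lebesgue (\<lambda>x. indicator (box c d) x *\<^sub>R (indicator (cbox c d) x *\<^sub>R g x))"
      proof (rule integrable_mult_indicator)
        show "integrable lebesgue (\<lambda>x. indicator (cbox c d) x *\<^sub>R g x)"
          using g cd by (simp add: locally_summable_def set_integrable_def)
      qed simp
      also have "(\<lambda>x. indicator (box c d) x *\<^sub>R (indicator (cbox c d) x *\<^sub>R g x)) = ?f"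
        using box_subset_cbox[of c d] by (auto simp: indicator_def fun_eq_iff)
      finally show "integrable lebesgue ?f" .
      show "(LINT x|lebesgue. ?f x) = 0"
        using box0[OF cd] by (simp add: set_lebesgue_integral_def)
      fix p q :: 'a
      obtain r s where rs: "box p q \<inter> box c d = box r s"
        using box_Int_box by blast
      have "(LINT x:box p q|lebesgue. ?f x) = (LINT x:box r s|lebesgue. g x)"
        unfolding set_lebesgue_integral_def rs[symmetric] by (simp add: indicator_inter_arith mult.assoc)
      also have "\<dots> = 0"
      proof (cases "box r s = {}")
        case False
        have "box r s \<subseteq> box c d"
          using rs by blast
        then show ?thesis
          using sub[OF _ False] by (intro box0)
      qed (simp add: set_lebesgue_integral_def)
      finally show "(LINT x:box p q|lebesgue. ?f x) = 0" .
    qed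
    moreover have "AE x in lebesgue. x \<notin> cbox c d - box c d"
      using negligible_frontier_interval[of c d] by (intro AE_not_in) (simp add: negligible_iff_null_sets)
    ultimately show ?thesis
      by eventually_elim (auto simp: indicator_def)
  qed
  obtain \<D> where \<D>: "countable \<D>" "\<D> \<subseteq> Pow D" "\<And>X. X \<in> \<D> \<Longrightarrow> \<exists>a b. X = cbox a b" "\<Union>\<D> = D"
    using open_countable_Union_open_cbox[OF D] by metis
  have "AE x in lebesgue. \<forall>X\<in>\<D>. x \<in> X \<longrightarrow> g x = 0"
  proof (rule AE_ball_countable'[OF _ \<D>(1)])
    fix X assume X: "X \<in> \<D>"
    obtain a b where "X = cbox a b" using \<D>(3)[OF X] by blast
    then show "AE x in lebesgue. x \<in> X \<longrightarrow> g x = 0"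
      using AE_box[of a b] \<D>(2) X by blast
  qed
  then show ?thesis
  proof eventually_elim
    case (elim x)
    then show ?case using \<D>(4) by blast
  qed
qed

lemma locally_summable_add:
  assumes "locally_summable D u" "locally_summable D v"
  shows "locally_summable D (\<lambda>x. u x + c *\<^sub>R v x)"
  unfolding locally_summable_def
proof safe
  fix K assume "compact K" "K \<subseteq> D"
  then have "set_integrable lebesgue K u" "set_integrable lebesgue K (\<lambda>x. c *\<^sub>R v x)"
    using assms by (simp_all add: locally_summable_def)
  then show "set_integrable lebesgue K (\<lambda>x. u x + c *\<^sub>R v x)"
    by (rule set_integral_add)
qed

lemma locally_summable_inner:
  fixes G :: "'a::euclidean_space \<Rightarrow> 'a"
  assumes "locally_summable D G"
  shows "locally_summable D (\<lambda>x. G x \<bullet> b)"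
  unfolding locally_summable_def set_integrable_def
proof safe
  fix K assume "compact K" "K \<subseteq> D"
  then have "integrable lebesgue (\<lambda>x. (indicator K x *\<^sub>R G x) \<bullet> b)"
    using assms by (intro integrable_inner_left) (auto simp: locally_summable_def set_integrable_def)
  then show "integrable lebesgue (\<lambda>x. indicator K x *\<^sub>R (G x \<bullet> b))"
    by simp
qed

lemma set_integrable_weak_gradient_test:
  assumes "has_weak_gradient D u G" "\<phi> \<in> test_functions D" "b \<in> Basis"
  shows "set_integrable lebesgue D (\<lambda>x. u x * frechet_derivative \<phi> (at x) b)"
    "set_integrable lebesgue D (\<lambda>x. (G x \<bullet> b) * \<phi> x)"
proof -
  obtain K where K: "compact K" "K \<subseteq> D" "\<And>x. x \<notin> K \<Longrightarrow> \<phi> x = 0" "\<And>x. x \<notin> K \<Longrightarrow> grad \<phi> x = 0"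
    using test_function_support[OF assms(2)] by metis
  show "set_integrable lebesgue D (\<lambda>x. u x * frechet_derivative \<phi> (at x) b)"
    unfolding grad_inner_Basis[OF assms(3), symmetric]
    using K test_function_C1(2)[OF assms(2)] assms(1)
    by (intro set_integrable_mult_bounded_support[of D u K]) (auto simp: has_weak_gradient_def intro!: continuous_intros)
  show "set_integrable lebesgue D (\<lambda>x. (G x \<bullet> b) * \<phi> x)"
    using K test_function_C1(3)[OF assms(2)] assms(1)
    by (intro set_integrable_mult_bounded_support[of D _ K])
       (auto simp: has_weak_gradient_def intro!: locally_summable_inner)
qed

lemma has_weak_gradient_lincomb:
  assumes u: "has_weak_gradient D u G" and v: "has_weak_gradient D v H"
  shows "has_weak_gradient D (\<lambda>x. u x + c * v x) (\<lambda>x. G x + c *\<^sub>R H x)"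
  unfolding has_weak_gradient_def
proof (intro conjI ballI)
  show "locally_summable D (\<lambda>x. u x + c * v x)"
    using locally_summable_add[of D u v c] u v by (auto simp: has_weak_gradient_def)
  show "locally_summable D (\<lambda>x. G x + c *\<^sub>R H x)"
    using u v by (auto simp: has_weak_gradient_def intro!: locally_summable_add)
  fix \<phi> :: "'a \<Rightarrow> real" and b :: 'a assume \<phi>: "\<phi> \<in> test_functions D" and b: "b \<in> Basis"
  note si = set_integrable_weak_gradient_test[OF u \<phi> b] set_integrable_weak_gradient_test[OF v \<phi> b]
  have "(LINT x:D|lebesgue. (u x + c * v x) * frechet_derivative \<phi> (at x) b) =
      (LINT x:D|lebesgue. u x * frechet_derivative \<phi> (at x) b) +
      c * (LINT x:D|lebesgue. v x * frechet_derivative \<phi> (at x) b)"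
    using si by (simp add: distrib_right mult.assoc set_integral_add)
  moreover have "(LINT x:D|lebesgue. ((G x + c *\<^sub>R H x) \<bullet> b) * \<phi> x) =
      (LINT x:D|lebesgue. (G x \<bullet> b) * \<phi> x) + c * (LINT x:D|lebesgue. (H x \<bullet> b) * \<phi> x)"
    using si by (simp add: distrib_right inner_add_left mult.assoc set_integral_add)
  ultimately show "(LINT x:D|lebesgue. (u x + c * v x) * frechet_derivative \<phi> (at x) b) =
      - (LINT x:D|lebesgue. ((G x + c *\<^sub>R H x) \<bullet> b) * \<phi> x)"
    using u v \<phi> b by (simp add: has_weak_gradient_def algebra_simps)
qed

text \<open>Each component of \<open>G - H\<close> is orthogonal to all test functions.\<close>

lemma has_weak_gradient_unique:
  fixes D :: "'a::euclidean_space set"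
  assumes D: "open D" and G: "has_weak_gradient D u G" and H: "has_weak_gradient D u H"
  shows "AE x in lebesgue. x \<in> D \<longrightarrow> G x = H x"
proof -
  have "AE x in lebesgue. x \<in> D \<longrightarrow> G x \<bullet> b - H x \<bullet> b = 0" if b: "b \<in> Basis" for b
  proof (rule fundamental_lemma_calculus_of_variations[OF D])
    show "locally_summable D (\<lambda>x. G x \<bullet> b - H x \<bullet> b)"
      using locally_summable_inner[OF locally_summable_add[of D G H "-1"]] G H
      by (simp add: has_weak_gradient_def inner_diff_left)
    fix \<phi> :: "'a \<Rightarrow> real" assume \<phi>: "\<phi> \<in> test_functions D"
    show "(LINT x:D|lebesgue. (G x \<bullet> b - H x \<bullet> b) * \<phi> x) = 0"
      using set_integrable_weak_gradient_test[OF G \<phi> b] set_integrable_weak_gradient_test[OF H \<phi> b] G H \<phi> b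
      by (simp add: left_diff_distrib set_integral_diff has_weak_gradient_def)
  qed
  then have "AE x in lebesgue. \<forall>b\<in>Basis. x \<in> D \<longrightarrow> G x \<bullet> b - H x \<bullet> b = 0"
    by (intro AE_finite_allI) auto
  then show ?thesis
    by eventually_elim (auto intro: euclidean_eqI)
qed

lemma has_weak_gradient_weak_gradient:
  "has_weak_gradient D u G \<Longrightarrow> has_weak_gradient D u (weak_gradient D u)"
  unfolding weak_gradient_def by (rule someI[of "has_weak_gradient D u"])

lemma weak_gradient_AE:
  "open D \<Longrightarrow> has_weak_gradient D u G \<Longrightarrow> AE x in lebesgue. x \<in> D \<longrightarrow> weak_gradient D u x = G x"
  by (rule has_weak_gradient_unique[OF _ has_weak_gradient_weak_gradient])

section \<open>The weighted Sobolev inequality\<close>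

text \<open>Let \<open>a\<close> be the last zero of \<open>s\<close> before 0, so that
  \<open>s\<close> is positive on the rest of the way. Since \<open>powr\<close> need not be
  differentiable where its base vanishes, the fundamental theorem of calculus is applied on
  \<open>{d..0}\<close> with \<open>d > a\<close>, and then \<open>d\<close> tends to
  \<open>a\<close>.\<close>

lemma powr_abs_le_nn_integral_derivative_pos:
  fixes s s' :: "real \<Rightarrow> real"
  assumes s: "\<And>t. (s has_real_derivative s' t) (at t)" and s': "continuous_on UNIV s'"
    and \<gamma>: "\<gamma> \<ge> 1" and zero: "c < 0" "s c = 0" and pos: "s 0 > 0"
  shows "ennreal (s 0 powr \<gamma>) \<le> (\<integral>\<^sup>+t. ennreal (\<gamma> * \<bar>s t\<bar> powr (\<gamma> - 1) * \<bar>s' t\<bar>) \<partial>lborel)"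
    (is "_ \<le> ?R")
proof (cases ?R)
  case (real r)
  have cont: "continuous_on A s" for A
    using s by (meson DERIV_isCont continuous_at_imp_continuous_on)
  have "compact {t \<in> {c..0}. s t = 0}"
  proof -
    have "closed ({c..0} \<inter> s -` {0})"
      by (intro continuous_closed_preimage cont) auto
    moreover have "{t \<in> {c..0}. s t = 0} = {c..0} \<inter> s -` {0}" by auto
    ultimately have "{t \<in> {c..0}. s t = 0} = {c..0} \<inter> {t \<in> {c..0}. s t = 0}" "closed {t \<in> {c..0}. s t = 0}"
      by auto
    then show ?thesis
      by (metis compact_Icc compact_Int_closed)
  qed
  then obtain a where a: "c \<le> a" "a \<le> 0" "s a = 0" and max: "\<And>t. c \<le> t \<Longrightarrow> t \<le> 0 \<Longrightarrow> s t = 0 \<Longrightarrow> t \<le> a"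
    using compact_attains_sup[of "{t \<in> {c..0}. s t = 0}"] zero by force
  have "a < 0"
    using a pos by (cases "a = 0") auto
  have pos': "s t > 0" if "a < t" "t \<le> 0" for t
  proof (rule ccontr)
    assume "\<not> s t > 0"
    then have "\<exists>t'\<ge>t. t' \<le> 0 \<and> s t' = 0"
      using pos that by (intro IVT' cont) auto
    then obtain t' where "t \<le> t'" "t' \<le> 0" "s t' = 0"
      by blast
    then show False
      using max[of t'] a that by auto
  qed
  have le: "s 0 powr \<gamma> - s d powr \<gamma> \<le> r" if d: "a < d" "d < 0" for d
  proof -
    let ?f = "\<lambda>t. \<gamma> * s t powr (\<gamma> - 1) * s' t"
    have contf: "continuous_on {d..0} ?f"
    proof (intro continuous_intros cont continuous_on_subset[OF s'])
      show "\<forall>t\<in>{d..0}. s t \<noteq> 0"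
        using pos' d by (metis atLeastAtMost_iff less_irrefl order_less_le_trans)
    qed auto
    have "s 0 powr \<gamma> - s d powr \<gamma> = (LINT t|lborel. indicator {d..0} t *\<^sub>R ?f t)"
    proof (rule integral_FTC_atLeastAtMost[symmetric])
      show "((\<lambda>t. s t powr \<gamma>) has_vector_derivative ?f t) (at t within {d..0})" if "d \<le> t" "t \<le> 0" for t
        using pos'[of t] d that has_field_derivative_at_within[OF s[of t], of "{d..0}"]
        by (auto intro!: derivative_eq_intros simp: has_real_derivative_iff_has_vector_derivative[symmetric] powr_diff field_simps)
    qed (use d contf in auto)
    also have "ennreal (norm \<dots>) \<le> (\<integral>\<^sup>+t. norm (indicator {d..0} t *\<^sub>R ?f t) \<partial>lborel)"
      by (intro integral_norm_bound_ennreal borel_integrable_compact contf) auto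
    also have "\<dots> \<le> ?R"
    proof (intro nn_integral_mono ennreal_leI)
      show "norm (indicator {d..0} t *\<^sub>R ?f t) \<le> \<gamma> * \<bar>s t\<bar> powr (\<gamma> - 1) * \<bar>s' t\<bar>" for t
        using pos'[of t] d \<gamma> by (cases "t \<in> {d..0}") (auto simp: abs_mult)
    qed
    finally show ?thesis
      using real by (simp add: real_norm_def)
  qed
  have "((\<lambda>d. s 0 powr \<gamma> - s d powr \<gamma>) \<longlongrightarrow> s 0 powr \<gamma> - 0) (at_right a)"
  proof (intro tendsto_diff tendsto_const tendsto_zero_powrI)
    show "(s \<longlongrightarrow> 0) (at_right a)"
      using DERIV_isCont[OF s, of a] a by (simp add: isCont_def filterlim_at_split)
    show "\<forall>\<^sub>F d in at_right a. 0 \<le> s d"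
      using eventually_at_right_less[of a] eventually_at_right_real[OF \<open>a < 0\<close>]
      by eventually_elim (use pos' less_imp_le in auto)
  qed (use \<gamma> in auto)
  then have "s 0 powr \<gamma> \<le> r"
    using eventually_at_right_real[OF \<open>a < 0\<close>] le
    by (intro tendsto_upperbound[of _ "s 0 powr \<gamma>"]) (auto elim!: eventually_mono)
  then show ?thesis
    unfolding real(2) by (rule ennreal_leI)
qed simp

lemma powr_abs_le_nn_integral_derivative:
  fixes s s' :: "real \<Rightarrow> real"
  assumes s: "\<And>t. (s has_real_derivative s' t) (at t)" and s': "continuous_on UNIV s'"
    and \<gamma>: "\<gamma> \<ge> 1" and zero: "c < 0" "s c = 0"
  shows "ennreal (\<bar>s 0\<bar> powr \<gamma>) \<le> (\<integral>\<^sup>+t. ennreal (\<gamma> * \<bar>s t\<bar> powr (\<gamma> - 1) * \<bar>s' t\<bar>) \<partial>lborel)"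
proof -
  consider "s 0 = 0" | "s 0 > 0" | "s 0 < 0" by linarith
  then show ?thesis
  proof cases
    case 2
    then show ?thesis
      using powr_abs_le_nn_integral_derivative_pos[OF assms] by simp
  next
    case 3
    have "ennreal ((- s 0) powr \<gamma>) \<le> (\<integral>\<^sup>+t. ennreal (\<gamma> * \<bar>- s t\<bar> powr (\<gamma> - 1) * \<bar>- s' t\<bar>) \<partial>lborel)"
      using 3 assms by (intro powr_abs_le_nn_integral_derivative_pos[where c = c]) (auto intro!: DERIV_minus continuous_intros)
    then show ?thesis
      using 3 by simp
  qed simp
qed

lemma has_real_derivative_along_line:
  assumes "u differentiable_on UNIV"
  shows "((\<lambda>t. u (x + t *\<^sub>R z)) has_real_derivative (grad u (x + t *\<^sub>R z) \<bullet> z)) (at t)"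
proof -
  have "((\<lambda>t. x + t *\<^sub>R z) has_derivative (\<lambda>t. t *\<^sub>R z)) (at t)"
    by (auto intro!: derivative_eq_intros)
  then have "((\<lambda>t. u (x + t *\<^sub>R z)) has_derivative (\<lambda>h. grad u (x + t *\<^sub>R z) \<bullet> (h *\<^sub>R z))) (at t)"
    using has_derivative_compose[of "\<lambda>t. x + t *\<^sub>R z" "\<lambda>h. h *\<^sub>R z" t UNIV u "\<lambda>h. grad u (x + t *\<^sub>R z) \<bullet> h"]
      has_derivative_grad[OF assms, of "x + t *\<^sub>R z"] by simp
  then show ?thesis
    by (simp add: has_field_derivative_def mult_commute_abs)
qed

lemma powr_abs_le_line_integral:
  fixes u :: "'a::euclidean_space \<Rightarrow> real"
  assumes u: "u differentiable_on UNIV" "continuous_on UNIV (grad u)"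
    and K: "compact K" "\<And>x. x \<notin> K \<Longrightarrow> u x = 0" and b: "b \<in> Basis" and \<gamma>: "\<gamma> \<ge> 1"
  shows "ennreal (\<bar>u x\<bar> powr \<gamma>) \<le>
    line_integral b (\<lambda>x. ennreal (\<gamma> * \<bar>u x\<bar> powr (\<gamma> - 1) * norm (grad u x))) x"
proof -
  obtain R where R: "\<And>x. x \<in> K \<Longrightarrow> norm x < R"
    using compact_imp_bounded[OF K(1)] by (meson bounded_pos_less)
  \<comment> \<open>Far enough back on the line to have left the support: the norm of
    \<open>x + c *\<^sub>R b\<close> is at least \<open>\<bar>R\<bar> + 1\<close>.\<close>
  define c where "c = - (\<bar>R\<bar> + norm x + 1)"
  have "c < 0"
    using norm_ge_zero[of x] unfolding c_def by linarith
  have "\<bar>c\<bar> = norm (c *\<^sub>R b)"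
    using b by simp
  also have "\<dots> \<le> norm (x + c *\<^sub>R b) + norm x"
    using norm_triangle_ineq4[of "x + c *\<^sub>R b" x] by simp
  finally have "x + c *\<^sub>R b \<notin> K"
    using R[of "x + c *\<^sub>R b"] norm_ge_zero[of x] by (auto simp: c_def)
  then have "u (x + c *\<^sub>R b) = 0"
    by (rule K(2))
  moreover have "continuous_on UNIV (\<lambda>t. grad u (x + t *\<^sub>R b) \<bullet> b)"
    by (intro continuous_intros continuous_on_compose2[OF u(2)]) auto
  ultimately have "ennreal (\<bar>u (x + 0 *\<^sub>R b)\<bar> powr \<gamma>) \<le>
      (\<integral>\<^sup>+t. ennreal (\<gamma> * \<bar>u (x + t *\<^sub>R b)\<bar> powr (\<gamma> - 1) * \<bar>grad u (x + t *\<^sub>R b) \<bullet> b\<bar>) \<partial>lborel)"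
    using \<open>c < 0\<close> \<gamma>
    by (intro powr_abs_le_nn_integral_derivative[where c = c] has_real_derivative_along_line u) auto
  also have "\<dots> \<le> line_integral b (\<lambda>x. ennreal (\<gamma> * \<bar>u x\<bar> powr (\<gamma> - 1) * norm (grad u x))) x"
    unfolding line_integral_def using b \<gamma>
    by (intro nn_integral_mono ennreal_leI mult_left_mono Basis_le_norm) auto
  finally show ?thesis by simp
qed

text \<open>In dimension 2 the exponent of u^2 in the Sobolev argument is 0, which the general
  inequality excludes. Then \<open>epow y 0\<close> is at most 1 for finite \<open>y\<close>, and it
  equals 1 only if in addition \<open>y\<close> is not 0; hence the assumptions on the values and on
  the integral of \<open>f\<close>.\<close>

lemma nn_integral_Holder3:
  assumes p: "p \<ge> 0" "q > 0" "r > 0" "p + q + r = 1"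
    and [measurable]: "f \<in> borel_measurable M" "g \<in> borel_measurable M" "h \<in> borel_measurable M"
    and fin: "\<And>x. f x \<noteq> top" and X: "(\<integral>\<^sup>+x. f x \<partial>M) \<noteq> 0" "(\<integral>\<^sup>+x. f x \<partial>M) \<noteq> top"
  shows "(\<integral>\<^sup>+x. epow (f x) p * epow (g x) q * epow (h x) r \<partial>M) \<le>
    epow (\<integral>\<^sup>+x. f x \<partial>M) p * epow (\<integral>\<^sup>+x. g x \<partial>M) q * epow (\<integral>\<^sup>+x. h x \<partial>M) r"
proof (cases "p = 0")
  case False
  have "(\<integral>\<^sup>+x. (\<Prod>i\<in>{0::nat,1,2}. epow (([f, g, h] ! i) x) ([p, q, r] ! i)) \<partial>M) \<le>
     (\<Prod>i\<in>{0::nat,1,2}. epow (\<integral>\<^sup>+x. ([f, g, h] ! i) x \<partial>M) ([p, q, r] ! i))"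
    using p False by (intro nn_integral_Holder) auto
  then show ?thesis by (simp add: mult.assoc)
next
  case True
  have ge: "epow y 0 \<le> 1" if "y \<noteq> top" for y :: ennreal
    using that by (cases y) (auto simp: epow_ennreal)
  have eq: "epow y 0 = 1" if "y \<noteq> top" "y \<noteq> 0" for y :: ennreal
    using that by (cases y) (auto simp: epow_ennreal)
  have "(\<integral>\<^sup>+x. epow (f x) p * epow (g x) q * epow (h x) r \<partial>M) \<le> (\<integral>\<^sup>+x. epow (g x) q * epow (h x) r \<partial>M)"
    unfolding True using mult_right_mono[OF ge[OF fin]] by (intro nn_integral_mono) (simp add: mult.assoc)
  also have "\<dots> = (\<integral>\<^sup>+x. (\<Prod>i\<in>{0::nat,1}. epow (([g, h] ! i) x) ([q, r] ! i)) \<partial>M)"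
    by simp
  also have "\<dots> \<le> (\<Prod>i\<in>{0::nat,1}. epow (\<integral>\<^sup>+x. ([g, h] ! i) x \<partial>M) ([q, r] ! i))"
    using p True by (intro nn_integral_Holder) auto
  finally show ?thesis
    using X by (simp add: True eq)
qed

text \<open>With the abbreviations of the proof, the two inequalities give \<open>X\<close> to the
  power (n-1)/n at most \<gamma> times the product of the powers (n-2)/(2n) of \<open>X\<close>, 1/2
  of \<open>E\<close> and 1/n of \<open>S\<close>. Because (n-1)/n - (n-2)/(2n) = 1/2, dividing by
  the power of \<open>X\<close> and squaring yields the claim with the constant \<gamma> squared.
  The division uses that \<open>X\<close> is positive and finite.\<close>

lemma weighted_Sobolev_inequality:
  fixes u w :: "'a::euclidean_space \<Rightarrow> real"
  assumes n: "DIM('a) \<ge> 2"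
    and u: "u differentiable_on UNIV" "continuous_on UNIV (grad u)"
    and K: "compact K" "K \<subseteq> D" "\<And>x. x \<notin> K \<Longrightarrow> u x = 0" "\<And>x. x \<notin> K \<Longrightarrow> grad u x = 0"
    and D: "D \<in> sets lebesgue"
    and w [measurable]: "w \<in> borel_measurable lebesgue" and pos: "AE x in lebesgue. x \<in> D \<longrightarrow> w x > 0"
  shows "(\<integral>\<^sup>+x. ennreal ((u x)\<^sup>2) \<partial>lebesgue) \<le>
    ennreal ((2 * (real DIM('a) - 1) / real DIM('a))\<^sup>2) *
    epow (\<integral>\<^sup>+x\<in>D. inverse (ennreal (w x powr (real DIM('a) / 2))) \<partial>lebesgue) (2 / real DIM('a)) *
    (\<integral>\<^sup>+x. ennreal ((norm (grad u x))\<^sup>2 * w x) \<partial>lebesgue)"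
proof -
  define n where "n = real DIM('a)"
  have n2: "n \<ge> 2" using n by (simp add: n_def)
  \<comment> \<open>Chosen such that \<gamma> times the Gagliardo exponent n/(n-1) is 2;
    \<open>\<gamma> \<ge> 1\<close> is where n \<ge> 2 enters.\<close>
  define \<gamma> where "\<gamma> = 2 * (n - 1) / n"
  have \<gamma>: "\<gamma> \<ge> 1" "\<gamma> - 1 = (n - 2) / n" "\<gamma> * (n / (n - 1)) = 2"
    using n2 by (auto simp: \<gamma>_def field_simps)
  define g where "g x = ennreal (\<gamma> * \<bar>u x\<bar> powr (\<gamma> - 1) * norm (grad u x))" for x
  define X where "X = (\<integral>\<^sup>+x. ennreal ((u x)\<^sup>2) \<partial>lebesgue)"
  define E where "E = (\<integral>\<^sup>+x. ennreal ((norm (grad u x))\<^sup>2 * w x) \<partial>lebesgue)"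
  define S where "S = (\<integral>\<^sup>+x\<in>D. inverse (ennreal (w x powr (n / 2))) \<partial>lebesgue)"
  have cu: "continuous_on UNIV u"
    using u(1) by (rule differentiable_imp_continuous_on)
  note [measurable] = borel_measurable_continuous_onI[OF cu] borel_measurable_continuous_onI[OF u(2)]
  have [measurable]: "u \<in> borel_measurable lebesgue" "grad u \<in> borel_measurable lebesgue"
    by (auto intro!: measurable_completion)
  have [measurable]: "g \<in> borel_measurable borel"
    unfolding g_def by measurable
  have "X = (\<integral>\<^sup>+x. epow (ennreal (\<bar>u x\<bar> powr \<gamma>)) (n / (n - 1)) \<partial>lborel)"
    unfolding X_def nn_integral_completion using \<gamma>(3)
    by (simp add: epow_ennreal powr_powr powr_numeral)
  also have "\<dots> \<le> epow (\<integral>\<^sup>+x. g x \<partial>lborel) (n / (n - 1))"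
    using Gagliardo[of "\<lambda>x. ennreal (\<bar>u x\<bar> powr \<gamma>)" g] n powr_abs_le_line_integral[OF u K(1,3) _ \<gamma>(1)]
    by (simp add: n_def g_def[abs_def] of_nat_diff)
  finally have "epow X ((n - 1) / n) \<le> epow (epow (\<integral>\<^sup>+x. g x \<partial>lborel) (n / (n - 1))) ((n - 1) / n)"
    using n2 by (intro epow_mono) auto
  also have "\<dots> = (\<integral>\<^sup>+x. g x \<partial>lborel)"
    using n2 by (simp add: epow_epow)
  also have "\<dots> = (\<integral>\<^sup>+x. g x \<partial>lebesgue)"
    by (simp add: nn_integral_completion)
  finally have Gag: "epow X ((n - 1) / n) \<le> (\<integral>\<^sup>+x. g x \<partial>lebesgue)" .
  have "integrable lborel (\<lambda>x. (u x)\<^sup>2)"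
    using K by (intro integrable_continuous_compact_support[OF _ K(1)] continuous_intros cu) auto
  then have Xfin: "X \<noteq> top"
    unfolding X_def nn_integral_completion by (simp add: nn_integral_eq_integral)
  show ?thesis
  proof (cases "X = 0")
    case False
    let ?h = "\<lambda>x. inverse (ennreal (w x powr (n / 2))) * indicator D x"
    have hm [measurable]: "?h \<in> borel_measurable lebesgue"
      using D by measurable
    \<comment> \<open>The weight cancels: w^(1/2) from the energy density meets the power 1/n of
      w^(-n/2), that is w^(-1/2). This needs \<open>w x > 0\<close>, so the identity holds only
      a.e.\<close>
    have eq: "AE x in lebesgue. g x = ennreal \<gamma> *
        (epow (ennreal ((u x)\<^sup>2)) ((n - 2) / (2 * n)) * epow (ennreal ((norm (grad u x))\<^sup>2 * w x)) (1 / 2) * epow (?h x) (1 / n))"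
      using pos
    proof eventually_elim
      case (elim x)
      show ?case
      proof (cases "x \<in> D \<and> u x \<noteq> 0")
        case True
        then have x: "x \<in> D" "w x > 0" "\<bar>u x\<bar> > 0" using elim by auto
        have 1: "epow (ennreal ((u x)\<^sup>2)) ((n - 2) / (2 * n)) = ennreal (\<bar>u x\<bar> powr (\<gamma> - 1))"
        proof -
          have "(u x)\<^sup>2 powr ((n - 2) / (2 * n)) = (\<bar>u x\<bar> powr 2) powr ((n - 2) / (2 * n))"
            using x by (simp add: powr_numeral)
          moreover have "2 * ((n - 2) / (2 * n)) = (n - 2) / n"
            using n2 by (simp add: divide_simps)
          ultimately show ?thesis
            unfolding \<gamma>(2) powr_powr by (simp only: epow_ennreal zero_le_power2)
        qed
        have 2: "epow (ennreal ((norm (grad u x))\<^sup>2 * w x)) (1 / 2) = ennreal (norm (grad u x) * w x powr (1 / 2))"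
          using x by (simp add: epow_ennreal powr_mult powr_half_sqrt real_sqrt_mult)
        have 3: "epow (?h x) (1 / n) = ennreal (inverse (w x powr (1 / 2)))"
          using x n2 by (simp add: inverse_ennreal epow_ennreal powr_minus[symmetric] powr_powr)
        have "ennreal \<gamma> * (ennreal (\<bar>u x\<bar> powr (\<gamma> - 1)) * ennreal (norm (grad u x) * w x powr (1 / 2)) * ennreal (inverse (w x powr (1 / 2))))
          = ennreal (\<gamma> * (\<bar>u x\<bar> powr (\<gamma> - 1) * (norm (grad u x) * w x powr (1 / 2)) * inverse (w x powr (1 / 2))))"
          using x \<gamma>(1) by (simp add: ennreal_mult)
        also have "\<dots> = g x"
          using x by (simp add: g_def field_simps)
        finally show ?thesis
          unfolding 1 2 3 by simp
      next
        case False
        then have "u x = 0"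
          using K by blast
        \<comment> \<open>Both sides are 0 here, in dimension 2 as well, thanks to the default
          values \<open>0 powr 0 = 0\<close> and \<open>epow 0 0 = 0\<close>.\<close>
        then show ?thesis by (simp add: g_def)
      qed
    qed
    have "(\<integral>\<^sup>+x. g x \<partial>lebesgue) = (\<integral>\<^sup>+x. ennreal \<gamma> *
        (epow (ennreal ((u x)\<^sup>2)) ((n - 2) / (2 * n)) * epow (ennreal ((norm (grad u x))\<^sup>2 * w x)) (1 / 2) * epow (?h x) (1 / n)) \<partial>lebesgue)"
      using eq by (rule nn_integral_cong_AE)
    also have "\<dots> = ennreal \<gamma> * (\<integral>\<^sup>+x. 
        epow (ennreal ((u x)\<^sup>2)) ((n - 2) / (2 * n)) * epow (ennreal ((norm (grad u x))\<^sup>2 * w x)) (1 / 2) * epow (?h x) (1 / n) \<partial>lebesgue)"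
      by (intro nn_integral_cmult borel_measurable_times measurable_epow hm) measurable
    also have "\<dots> \<le> ennreal \<gamma> * (epow X ((n - 2) / (2 * n)) * epow E (1 / 2) * epow S (1 / n))"
      unfolding X_def E_def S_def
    proof (intro mult_left_mono nn_integral_Holder3 hm)
      show "(n - 2) / (2 * n) + 1 / 2 + 1 / n = 1"
        using n2 by (simp add: field_simps)
    qed (use n2 Xfin False in \<open>auto simp: X_def\<close>)
    finally have le: "epow X ((n - 1) / n) \<le> ennreal \<gamma> * (epow X ((n - 2) / (2 * n)) * epow E (1 / 2) * epow S (1 / n))"
      using Gag by simp
    have "X \<le> ennreal (\<gamma>\<^sup>2) * epow S (2 / n) * E"
    proof (cases "S = top \<or> E = top")
      case True
      \<comment> \<open>An infinite factor makes the claimed bound infinite unless the other factor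
        is 0, the product of 0 and \<open>top\<close> being 0. That case is excluded because the
        right-hand side of \<open>le\<close> dominates a positive number.\<close>
      have "ennreal \<gamma> * (epow X ((n - 2) / (2 * n)) * epow E (1 / 2) * epow S (1 / n)) \<noteq> 0"
        using le False by (auto simp: le_zero_eq)
      then have "S \<noteq> 0" "E \<noteq> 0" by auto
      then show ?thesis
        using True \<gamma>(1) by (auto simp: ennreal_mult_eq_top_iff ennreal_top_mult ennreal_mult_top)
    next
      case fin: False
      obtain x e s where r: "X = ennreal x" "E = ennreal e" "S = ennreal s" "x > 0" "e \<ge> 0" "s \<ge> 0"
        using False Xfin fin by (cases X; cases E; cases S) (auto simp: less_le)
      have "ennreal (x powr ((n - 1) / n)) \<le> ennreal (\<gamma> * (x powr ((n - 2) / (2 * n)) * e powr (1 / 2) * s powr (1 / n)))"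
        using le r \<gamma>(1) by (simp add: epow_ennreal ennreal_mult)
      then have "x powr ((n - 1) / n) \<le> \<gamma> * (x powr ((n - 2) / (2 * n)) * e powr (1 / 2) * s powr (1 / n))"
        using r \<gamma>(1) by (subst (asm) ennreal_le_iff) auto
      moreover have "x powr ((n - 1) / n) = x powr (1 / 2) * x powr ((n - 2) / (2 * n))"
      proof -
        have "(n - 1) / n = 1 / 2 + (n - 2) / (2 * n)"
          using n2 by (simp add: divide_simps)
        then show ?thesis by (simp only: powr_add)
      qed
      ultimately have "x powr (1 / 2) * x powr ((n - 2) / (2 * n)) \<le>
          (\<gamma> * e powr (1 / 2) * s powr (1 / n)) * x powr ((n - 2) / (2 * n))"
        by (simp add: mult_ac)
      then have "x powr (1 / 2) \<le> \<gamma> * e powr (1 / 2) * s powr (1 / n)"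
        using r by (subst (asm) mult_le_cancel_right) auto
      then have "(x powr (1 / 2))\<^sup>2 \<le> (\<gamma> * e powr (1 / 2) * s powr (1 / n))\<^sup>2"
        by (intro power_mono) auto
      moreover have "(s powr (1 / n))\<^sup>2 = s powr (2 / n)"
        using r by (cases "s = 0") (auto simp: power2_eq_square powr_add[symmetric])
      ultimately have "x \<le> \<gamma>\<^sup>2 * s powr (2 / n) * e"
        using r by (simp add: power_mult_distrib powr_half_sqrt mult_ac)
      then show ?thesis
        using r by (simp add: epow_ennreal ennreal_mult[symmetric])
    qed
    then show ?thesis
      unfolding X_def E_def S_def \<gamma>_def n_def by simp
  qed (simp add: X_def)
qed

section \<open>The weighted Poincare inequality\<close>

lemma nn_integral_lborel_affine:
  fixes F :: "'a::euclidean_space \<Rightarrow> ennreal"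
  assumes [measurable]: "F \<in> borel_measurable borel" and t: "t \<noteq> 0"
  shows "(\<integral>\<^sup>+x. F x \<partial>lborel) = ennreal (\<bar>t\<bar> ^ DIM('a)) * (\<integral>\<^sup>+z. F (y + t *\<^sub>R z) \<partial>lborel)"
  by (subst lborel_affine[OF t, of y])
     (simp add: nn_integral_density nn_integral_distr nn_integral_cmult)

lemma nn_integral_lborel_translate:
  fixes F :: "'a::euclidean_space \<Rightarrow> ennreal"
  assumes [measurable]: "F \<in> borel_measurable borel"
  shows "(\<integral>\<^sup>+x. F (x + y) \<partial>lborel) = (\<integral>\<^sup>+x. F x \<partial>lborel)"
  using nn_integral_lborel_affine[OF assms, of 1 y] by (simp add: add.commute)

lemma nn_integral_lborel_reflect:
  fixes F :: "'a::euclidean_space \<Rightarrow> ennreal"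
  assumes [measurable]: "F \<in> borel_measurable borel"
  shows "(\<integral>\<^sup>+x. F (- x) \<partial>lborel) = (\<integral>\<^sup>+x. F x \<partial>lborel)"
  using nn_integral_lborel_affine[OF assms, of "-1" 0] by simp

lemma nn_integral_ball_scale:
  fixes F :: "'a::euclidean_space \<Rightarrow> ennreal"
  assumes [measurable]: "F \<in> borel_measurable borel" and t: "t > 0"
  shows "(\<integral>\<^sup>+x\<in>ball y (t * r). F x \<partial>lborel) =
    ennreal (t ^ DIM('a)) * (\<integral>\<^sup>+z\<in>ball 0 r. F (y + t *\<^sub>R z) \<partial>lborel)"
proof -
  have "indicator (ball y (t * r)) (y + t *\<^sub>R z) = (indicator (ball 0 r) z :: ennreal)" for z
    using t by (auto simp: indicator_def dist_norm)
  moreover have [measurable]: "ball y (t * r) \<in> sets borel" by simp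
  have "(\<lambda>x. F x * indicator (ball y (t * r)) x) \<in> borel_measurable borel" by measurable
  ultimately show ?thesis
    using t by (subst nn_integral_lborel_affine[of _ t y]) auto
qed

lemma emeasure_ball_scale:
  fixes y :: "'a::euclidean_space"
  assumes "t > 0"
  shows "emeasure lborel (ball y (t * r)) = ennreal (t ^ DIM('a)) * emeasure lborel (ball (0::'a) r)"
  using nn_integral_ball_scale[of "\<lambda>_. 1" t y r] assms by simp

text \<open>Cauchy-Schwarz and Tonelli suffice, because the scale \<open>t\<close> is fixed; no maximal function is
  needed.\<close>

lemma averages_bounded_A2:
  fixes g W S :: "'a::euclidean_space \<Rightarrow> ennreal"
  assumes [measurable]: "g \<in> borel_measurable borel" "W \<in> borel_measurable borel" "S \<in> borel_measurable borel"
    and WS: "\<And>x. g x \<noteq> 0 \<Longrightarrow> W x * S x = 1"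
    and A2: "\<And>y r. r > 0 \<Longrightarrow> (\<integral>\<^sup>+x\<in>ball y r. W x \<partial>lborel) / emeasure lborel (ball y r) *
      ((\<integral>\<^sup>+x\<in>ball y r. S x \<partial>lborel) / emeasure lborel (ball y r)) \<le> k"
    and t: "t > 0"
  shows "(\<integral>\<^sup>+x. W x * (\<integral>\<^sup>+z\<in>ball 0 1. g (x + t *\<^sub>R z) \<partial>lborel)\<^sup>2 \<partial>lborel) \<le>
    k * (emeasure lborel (ball (0::'a) 2))\<^sup>2 * (\<integral>\<^sup>+x. (g x)\<^sup>2 * W x \<partial>lborel)"
proof -
  have [measurable]: "ball (0::'a) r \<in> sets borel" for r by simp
  define q where "q x = (g x)\<^sup>2 * W x" for x
  define I where "I x = (\<integral>\<^sup>+z\<in>ball 0 1. S (x + t *\<^sub>R z) \<partial>lborel)" for x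
  define J where "J H x = (\<integral>\<^sup>+z\<in>ball 0 2. H (x + t *\<^sub>R z) \<partial>lborel)" for H :: "'a \<Rightarrow> ennreal" and x
  have [measurable]: "q \<in> borel_measurable borel" "I \<in> borel_measurable borel"
    unfolding q_def I_def by measurable
  have CS: "(\<integral>\<^sup>+z\<in>ball 0 1. g (x + t *\<^sub>R z) \<partial>lborel)\<^sup>2 \<le> (\<integral>\<^sup>+z\<in>ball 0 1. q (x + t *\<^sub>R z) \<partial>lborel) * I x" for x
  proof -
    \<comment> \<open>Where \<open>g\<close> is nonzero, \<open>S\<close> is the reciprocal of
      \<open>W\<close>, so their square roots cancel; elsewhere both sides are 0.\<close>
    have g: "g y = (g y * epow (W y) (1 / 2)) * epow (S y) (1 / 2)" for y
      using WS[of y] epow_mult[of "W y" "S y" "1 / 2"] epow_ennreal[of 1 "1 / 2"]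
      by (cases "g y = 0") (auto simp: mult.assoc)
    have sq: "(epow a (1 / 2))\<^sup>2 = a" for a
      by (simp add: epow_power)
    have "(\<integral>\<^sup>+z\<in>ball 0 1. g (x + t *\<^sub>R z) \<partial>lborel)\<^sup>2 =
      (\<integral>\<^sup>+z. (g (x + t *\<^sub>R z) * epow (W (x + t *\<^sub>R z)) (1 / 2) * indicator (ball 0 1) z) *
         (epow (S (x + t *\<^sub>R z)) (1 / 2) * indicator (ball 0 1) z) \<partial>lborel)\<^sup>2"
    proof (intro arg_cong[where f = "\<lambda>x. x ^ 2"] nn_integral_cong)
      show "g (x + t *\<^sub>R z) * indicator (ball 0 1) z = (g (x + t *\<^sub>R z) * epow (W (x + t *\<^sub>R z)) (1 / 2) * indicator (ball 0 1) z) *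
         (epow (S (x + t *\<^sub>R z)) (1 / 2) * indicator (ball 0 1) z)" for z
        using g[of "x + t *\<^sub>R z"] by (cases "z \<in> ball 0 1") auto
    qed
    also have "\<dots> \<le> (\<integral>\<^sup>+z. (g (x + t *\<^sub>R z) * epow (W (x + t *\<^sub>R z)) (1 / 2) * indicator (ball 0 1) z)\<^sup>2 \<partial>lborel) *
         (\<integral>\<^sup>+z. (epow (S (x + t *\<^sub>R z)) (1 / 2) * indicator (ball 0 1) z)\<^sup>2 \<partial>lborel)"
      by (intro Cauchy_Schwarz_nn_integral) measurable
    also have "\<dots> = (\<integral>\<^sup>+z\<in>ball 0 1. q (x + t *\<^sub>R z) \<partial>lborel) * I x"
      unfolding q_def I_def
      by (intro arg_cong2[where f = "(*)"] nn_integral_cong) (auto simp: power_mult_distrib sq indicator_def)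
    finally show ?thesis .
  qed
  \<comment> \<open>After the substitution y = x + tz the averages are centred at
    \<open>y - t *\<^sub>R z\<close>. Doubling the radius recentres them at \<open>y\<close>, so
    that \<open>S\<close> and \<open>W\<close> are integrated over one and the same ball.\<close>
  have I_le: "I (y - t *\<^sub>R z) \<le> J S y" if z: "z \<in> ball 0 1" for y z
  proof -
    have "I (y - t *\<^sub>R z) = (\<integral>\<^sup>+z'. S (y + t *\<^sub>R z') * indicator (ball 0 1) (z' + z) \<partial>lborel)"
      unfolding I_def
      by (subst nn_integral_lborel_translate[where y = z, symmetric]) (auto simp: algebra_simps)
    also have "\<dots> \<le> J S y"
      unfolding J_def
    proof (intro nn_integral_mono mult_left_mono)
      fix z'
      show "indicator (ball 0 1) (z' + z) \<le> (indicator (ball 0 2) z' :: ennreal)"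
        using z norm_triangle_ineq4[of "z' + z" z] by (auto simp: indicator_def)
    qed simp
    finally show ?thesis .
  qed
  have W_le: "(\<integral>\<^sup>+z\<in>ball 0 1. W (y - t *\<^sub>R z) \<partial>lborel) \<le> J W y" for y
  proof -
    have "(\<integral>\<^sup>+z\<in>ball 0 1. W (y - t *\<^sub>R z) \<partial>lborel) = (\<integral>\<^sup>+z. W (y + t *\<^sub>R z) * indicator (ball 0 1) (- z) \<partial>lborel)"
      by (subst nn_integral_lborel_reflect[symmetric]) auto
    also have "\<dots> \<le> J W y"
      unfolding J_def by (intro nn_integral_mono mult_left_mono) (auto simp: indicator_def)
    finally show ?thesis .
  qed
  \<comment> \<open>The \<open>A_2\<close> bound on the ball of radius 2t about \<open>y\<close>.
    The factor t^n by which the measures are scaled cancels in the averages, so the constant does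
    not depend on \<open>t\<close>.\<close>
  have JJ: "J W y * J S y \<le> k * (emeasure lborel (ball (0::'a) 2))\<^sup>2" for y
  proof -
    let ?c = "ennreal (t ^ DIM('a))" and ?m = "emeasure lborel (ball (0::'a) 2)"
    have c: "?c \<noteq> 0" "?c \<noteq> top" using t by auto
    have m: "?m \<noteq> 0" "?m \<noteq> top"
      using content_ball_pos[of 2 "0::'a"] emeasure_lborel_ball_finite[of "0::'a" 2]
      by (auto simp: measure_def)
    have div: "?c * A / (?c * ?m) = A / ?m" for A
    proof -
      have tp: "t ^ DIM('a) > 0" using t by simp
      obtain r where r: "?m = ennreal r" "r > 0"
        using m by (cases ?m) auto
      show ?thesis
        using r tp t
        by (cases A) (auto simp: divide_ennreal ennreal_mult[symmetric] ennreal_mult_top ennreal_top_divide)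
    qed
    have "J W y / ?m * (J S y / ?m) \<le> k"
      using A2[of "t * 2" y] t unfolding emeasure_ball_scale[OF t]
      by (simp add: nn_integral_ball_scale div J_def)
    then have "J W y / ?m * (J S y / ?m) * (?m * ?m) \<le> k * (?m * ?m)"
      by (rule mult_right_mono) simp
    moreover have "A / ?m * ?m = A" for A
      using m by (simp add: ennreal_divide_times ennreal_divide_self less_top)
    then have "J W y / ?m * (J S y / ?m) * (?m * ?m) = J W y * J S y"
      by (metis mult.assoc mult.commute)
    ultimately show ?thesis by (simp add: power2_eq_square)
  qed
  have "(\<integral>\<^sup>+x. W x * (\<integral>\<^sup>+z\<in>ball 0 1. g (x + t *\<^sub>R z) \<partial>lborel)\<^sup>2 \<partial>lborel)
      \<le> (\<integral>\<^sup>+x. W x * ((\<integral>\<^sup>+z\<in>ball 0 1. q (x + t *\<^sub>R z) \<partial>lborel) * I x) \<partial>lborel)"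
    by (intro nn_integral_mono mult_left_mono CS) auto
  also have "\<dots> = (\<integral>\<^sup>+x. \<integral>\<^sup>+z. W x * I x * q (x + t *\<^sub>R z) * indicator (ball 0 1) z \<partial>lborel \<partial>lborel)"
    by (intro nn_integral_cong) (simp add: nn_integral_cmult[symmetric] mult_ac)
  also have "\<dots> = (\<integral>\<^sup>+z. \<integral>\<^sup>+x. W x * I x * q (x + t *\<^sub>R z) * indicator (ball 0 1) z \<partial>lborel \<partial>lborel)"
    by (rule lborel_pair.Fubini') measurable
  also have "\<dots> = (\<integral>\<^sup>+z. \<integral>\<^sup>+y. W (y - t *\<^sub>R z) * I (y - t *\<^sub>R z) * q y * indicator (ball 0 1) z \<partial>lborel \<partial>lborel)"
  proof (rule nn_integral_cong)
    fix z :: 'a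
    show "(\<integral>\<^sup>+x. W x * I x * q (x + t *\<^sub>R z) * indicator (ball 0 1) z \<partial>lborel) =
        (\<integral>\<^sup>+y. W (y - t *\<^sub>R z) * I (y - t *\<^sub>R z) * q y * indicator (ball 0 1) z \<partial>lborel)"
      by (subst nn_integral_lborel_translate[where y = "- t *\<^sub>R z", symmetric]) auto
  qed
  also have "\<dots> \<le> (\<integral>\<^sup>+z. \<integral>\<^sup>+y. W (y - t *\<^sub>R z) * J S y * q y * indicator (ball 0 1) z \<partial>lborel \<partial>lborel)"
    by (intro nn_integral_mono) (auto simp: indicator_def intro!: mult_left_mono mult_right_mono I_le)
  also have "\<dots> = (\<integral>\<^sup>+y. \<integral>\<^sup>+z. W (y - t *\<^sub>R z) * J S y * q y * indicator (ball 0 1) z \<partial>lborel \<partial>lborel)"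
    unfolding J_def by (rule lborel_pair.Fubini') measurable
  also have "\<dots> = (\<integral>\<^sup>+y. J S y * q y * (\<integral>\<^sup>+z\<in>ball 0 1. W (y - t *\<^sub>R z) \<partial>lborel) \<partial>lborel)"
    by (intro nn_integral_cong) (simp add: nn_integral_cmult[symmetric] mult_ac)
  also have "\<dots> \<le> (\<integral>\<^sup>+y. J S y * q y * J W y \<partial>lborel)"
    by (intro nn_integral_mono mult_left_mono W_le) auto
  also have "\<dots> \<le> (\<integral>\<^sup>+y. k * (emeasure lborel (ball (0::'a) 2))\<^sup>2 * q y \<partial>lborel)"
  proof (rule nn_integral_mono)
    fix y :: 'a
    have "J S y * q y * J W y = J W y * J S y * q y"
      by (simp add: mult_ac)
    then show "J S y * q y * J W y \<le> k * (emeasure lborel (ball (0::'a) 2))\<^sup>2 * q y"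
      using mult_right_mono[OF JJ[of y], of "q y"] by simp
  qed
  also have "\<dots> = k * (emeasure lborel (ball (0::'a) 2))\<^sup>2 * (\<integral>\<^sup>+x. q x \<partial>lborel)"
    by (rule nn_integral_cmult) measurable
  finally show ?thesis by (simp add: q_def)
qed

lemma abs_le_nn_integral_grad_segment:
  fixes u :: "'a::euclidean_space \<Rightarrow> real"
  assumes u: "u differentiable_on UNIV" "continuous_on UNIV (grad u)"
    and T: "T \<ge> 0" "u (x + T *\<^sub>R z) = 0" and z: "norm z \<le> 1"
  shows "ennreal \<bar>u x\<bar> \<le> (\<integral>\<^sup>+t\<in>{0..T}. ennreal (norm (grad u (x + t *\<^sub>R z))) \<partial>lborel)"
proof -
  let ?f = "\<lambda>t. grad u (x + t *\<^sub>R z) \<bullet> z"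
  have contf: "continuous_on {0..T} ?f"
    by (intro continuous_intros continuous_on_compose2[OF u(2)]) auto
  have "u (x + T *\<^sub>R z) - u (x + 0 *\<^sub>R z) = (LINT t|lborel. indicator {0..T} t *\<^sub>R ?f t)"
    using T contf by (intro integral_FTC_atLeastAtMost[symmetric])
      (auto intro!: has_field_derivative_at_within has_real_derivative_along_line[OF u(1)]
        simp: has_real_derivative_iff_has_vector_derivative[symmetric])
  then have "ennreal \<bar>u x\<bar> = ennreal (norm (LINT t|lborel. indicator {0..T} t *\<^sub>R ?f t))"
    using T(2) by (simp flip: abs_minus_cancel[of "u x"])
  also have "\<dots> \<le> (\<integral>\<^sup>+t. norm (indicator {0..T} t *\<^sub>R ?f t) \<partial>lborel)"
    by (intro integral_norm_bound_ennreal borel_integrable_compact contf) auto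
  also have "\<dots> \<le> (\<integral>\<^sup>+t\<in>{0..T}. ennreal (norm (grad u (x + t *\<^sub>R z))) \<partial>lborel)"
  proof (rule nn_integral_mono)
    fix t
    have "\<bar>?f t\<bar> \<le> norm (grad u (x + t *\<^sub>R z)) * norm z"
      by (rule Cauchy_Schwarz_ineq2)
    also have "\<dots> \<le> norm (grad u (x + t *\<^sub>R z))"
      using z by (simp add: mult_left_le)
    finally show "ennreal (norm (indicator {0..T} t *\<^sub>R ?f t)) \<le> ennreal (norm (grad u (x + t *\<^sub>R z))) * indicator {0..T} t"
      by (auto simp: indicator_def intro: ennreal_leI)
  qed
  finally show ?thesis .
qed

text \<open>The measure of the small ball of directions stays on the left-hand side, so no division
  in \<open>ennreal\<close> occurs. \<open>S\<close> is kept as a function of its own: outside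
  \<open>D\<close> it may be infinite and is tied to \<open>W\<close> only by the bound on
  averages.\<close>

lemma weighted_Poincare_inequality:
  fixes u :: "'a::euclidean_space \<Rightarrow> real" and W S :: "'a \<Rightarrow> ennreal"
  assumes u: "u differentiable_on UNIV" "continuous_on UNIV (grad u)"
    and D: "D \<subseteq> ball 0 R" and K: "\<And>x. x \<notin> D \<Longrightarrow> u x = 0" "\<And>x. x \<notin> D \<Longrightarrow> grad u x = 0"
    and [measurable]: "W \<in> borel_measurable borel" "S \<in> borel_measurable borel"
    and WS: "\<And>x. x \<in> D \<Longrightarrow> W x * S x = 1"
    and A2: "\<And>y r. r > 0 \<Longrightarrow> (\<integral>\<^sup>+x\<in>ball y r. W x \<partial>lborel) / emeasure lborel (ball y r) *
      ((\<integral>\<^sup>+x\<in>ball y r. S x \<partial>lborel) / emeasure lborel (ball y r)) \<le> k"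
    and R: "R > 0"
  shows "(\<integral>\<^sup>+x. (ennreal \<bar>u x\<bar>)\<^sup>2 * W x \<partial>lborel) * (emeasure lborel (ball (0::'a) (1 / 4)))\<^sup>2 \<le>
    (ennreal (4 * R))\<^sup>2 * (k * (emeasure lborel (ball (0::'a) 2))\<^sup>2) *
    (\<integral>\<^sup>+x. (ennreal (norm (grad u x)))\<^sup>2 * W x \<partial>lborel)"
proof -
  define T where "T = 4 * R"
  define g where "g x = ennreal (norm (grad u x))" for x
  have T: "T > 0" using R by (simp add: T_def)
  have [measurable]: "ball (0::'a) r \<in> sets borel" for r by simp
  note [measurable] = borel_measurable_continuous_onI[OF u(2)]
    borel_measurable_continuous_onI[OF differentiable_imp_continuous_on[OF u(1)]]
  have [measurable]: "g \<in> borel_measurable borel"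
    unfolding g_def by measurable
  define h where "h t x = (\<integral>\<^sup>+z\<in>ball 0 1. g (x + t *\<^sub>R z) \<partial>lborel)" for t x
  have [measurable]: "(\<lambda>(t, x). h t x) \<in> borel_measurable (borel \<Otimes>\<^sub>M borel)"
    unfolding h_def by measurable
  \<comment> \<open>Directions \<open>z\<close> with distance less than 1/4 from \<open>z0\<close>
    satisfy 1/2 < |z| < 1. They are long enough that \<open>T *\<^sub>R z\<close> has norm above 2R,
    which carries every point of \<open>D\<close> outside \<open>ball 0 R\<close>, and short enough
    to lie in the unit ball used by \<open>h\<close>.\<close>
  define z0 :: 'a where "z0 = (3 / 4) *\<^sub>R (SOME b. b \<in> Basis)"
  have z0: "norm z0 = 3 / 4"
    by (simp add: z0_def SOME_Basis)
  define m where "m = emeasure lborel (ball (0::'a) (1 / 4))"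
  have m: "m = emeasure lborel (ball z0 (1 / 4))"
    using emeasure_ball_scale[of 1 z0 "1/4"] by (simp add: m_def)
  have key: "ennreal \<bar>u x\<bar> * m \<le> (\<integral>\<^sup>+t\<in>{0..T}. h t x \<partial>lborel)" for x
  proof (cases "x \<in> D")
    case False
    then show ?thesis using K by simp
  next
    case True
    have "ennreal \<bar>u x\<bar> * m = (\<integral>\<^sup>+z\<in>ball z0 (1 / 4). ennreal \<bar>u x\<bar> \<partial>lborel)"
      by (simp add: m nn_integral_cmult_indicator)
    also have "\<dots> \<le> (\<integral>\<^sup>+z\<in>ball 0 1. (\<integral>\<^sup>+t\<in>{0..T}. g (x + t *\<^sub>R z) \<partial>lborel) \<partial>lborel)"
    proof (rule nn_integral_mono)
      fix z
      show "ennreal \<bar>u x\<bar> * indicator (ball z0 (1 / 4)) z \<le> (\<integral>\<^sup>+t\<in>{0..T}. g (x + t *\<^sub>R z) \<partial>lborel) * indicator (ball 0 1) z"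
      proof (cases "z \<in> ball z0 (1 / 4)")
        case z: True
        have nz: "norm z < 1" "norm z > 1 / 2"
          using z z0 norm_triangle_ineq2[of z z0] norm_triangle_ineq2[of z0 z] by (auto simp: dist_norm norm_minus_commute)
        have "R < norm (T *\<^sub>R z) - norm x"
        proof -
          have "norm x < R" using True D by auto
          moreover have "4 * R * (1 / 2) < 4 * R * norm z"
            using nz(2) R by (intro mult_strict_left_mono) auto
          moreover have "norm (T *\<^sub>R z) = 4 * R * norm z"
            using R by (simp add: T_def)
          ultimately show ?thesis by linarith
        qed
        also have "\<dots> \<le> norm (x + T *\<^sub>R z)"
          using norm_triangle_ineq4[of "x + T *\<^sub>R z" x] by simp
        finally have "x + T *\<^sub>R z \<notin> D"
          using D by auto
        then have "ennreal \<bar>u x\<bar> \<le> (\<integral>\<^sup>+t\<in>{0..T}. g (x + t *\<^sub>R z) \<partial>lborel)"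
          unfolding g_def using K nz T by (intro abs_le_nn_integral_grad_segment u) auto
        then show ?thesis
          using nz by (simp add: indicator_def)
      qed simp
    qed
    also have "\<dots> = (\<integral>\<^sup>+z. \<integral>\<^sup>+t. g (x + t *\<^sub>R z) * indicator {0..T} t * indicator (ball 0 1) z \<partial>lborel \<partial>lborel)"
      by (simp add: nn_integral_multc)
    also have "\<dots> = (\<integral>\<^sup>+t. \<integral>\<^sup>+z. g (x + t *\<^sub>R z) * indicator {0..T} t * indicator (ball 0 1) z \<partial>lborel \<partial>lborel)"
      by (rule lborel_pair.Fubini') measurable
    also have "\<dots> = (\<integral>\<^sup>+t\<in>{0..T}. h t x \<partial>lborel)"
      unfolding h_def by (intro nn_integral_cong, subst nn_integral_multc[symmetric]) (auto intro!: nn_integral_cong simp: mult_ac)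
    finally show ?thesis .
  qed
  \<comment> \<open>Cauchy-Schwarz in \<open>t\<close> moves the square under the integral at the
    price of one factor \<open>T\<close>; the integration over \<open>{0..T}\<close> below
    contributes the second.\<close>
  have sq: "(ennreal \<bar>u x\<bar>)\<^sup>2 * m\<^sup>2 \<le> ennreal T * (\<integral>\<^sup>+t\<in>{0..T}. (h t x)\<^sup>2 \<partial>lborel)" for x
  proof -
    have "(ennreal \<bar>u x\<bar> * m)\<^sup>2 \<le> (\<integral>\<^sup>+t\<in>{0..T}. h t x \<partial>lborel)\<^sup>2"
      by (intro power_mono key) simp
    also have "\<dots> = (\<integral>\<^sup>+t. indicator {0..T} t * (h t x * indicator {0..T} t) \<partial>lborel)\<^sup>2"
      by (intro arg_cong[where f = "\<lambda>x. x ^ 2"] nn_integral_cong) (auto simp: indicator_def)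
    also have "\<dots> \<le> (\<integral>\<^sup>+t. (indicator {0..T} t)\<^sup>2 \<partial>lborel) * (\<integral>\<^sup>+t. (h t x * indicator {0..T} t)\<^sup>2 \<partial>lborel)"
      by (intro Cauchy_Schwarz_nn_integral) measurable
    also have "(\<integral>\<^sup>+t. (indicator {0..T} t)\<^sup>2 \<partial>lborel) = (\<integral>\<^sup>+t. indicator {0..T} t \<partial>(lborel::real measure))"
      by (intro nn_integral_cong) (auto simp: indicator_def)
    also have "\<dots> = ennreal T"
      using T by simp
    also have "(\<integral>\<^sup>+t. (h t x * indicator {0..T} t)\<^sup>2 \<partial>lborel) = (\<integral>\<^sup>+t\<in>{0..T}. (h t x)\<^sup>2 \<partial>lborel)"
      by (intro nn_integral_cong) (auto simp: indicator_def)
    finally show ?thesis by (simp add: power_mult_distrib)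
  qed
  have "(\<integral>\<^sup>+x. (ennreal \<bar>u x\<bar>)\<^sup>2 * W x \<partial>lborel) * m\<^sup>2 = (\<integral>\<^sup>+x. W x * ((ennreal \<bar>u x\<bar>)\<^sup>2 * m\<^sup>2) \<partial>lborel)"
    by (subst nn_integral_multc[symmetric]) (auto intro!: nn_integral_cong simp: mult_ac)
  also have "\<dots> \<le> (\<integral>\<^sup>+x. W x * (ennreal T * (\<integral>\<^sup>+t\<in>{0..T}. (h t x)\<^sup>2 \<partial>lborel)) \<partial>lborel)"
    by (intro nn_integral_mono mult_left_mono sq) auto
  also have "\<dots> = (\<integral>\<^sup>+x. \<integral>\<^sup>+t. ennreal T * indicator {0..T} t * (W x * (h t x)\<^sup>2) \<partial>lborel \<partial>lborel)"
    by (intro nn_integral_cong) (simp add: nn_integral_cmult[symmetric] mult_ac)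
  also have "\<dots> = (\<integral>\<^sup>+t. \<integral>\<^sup>+x. ennreal T * indicator {0..T} t * (W x * (h t x)\<^sup>2) \<partial>lborel \<partial>lborel)"
    by (rule lborel_pair.Fubini') measurable
  also have "\<dots> = (\<integral>\<^sup>+t. ennreal T * indicator {0..T} t * (\<integral>\<^sup>+x. W x * (h t x)\<^sup>2 \<partial>lborel) \<partial>lborel)"
    by (intro nn_integral_cong nn_integral_cmult) measurable
  also have "\<dots> \<le> (\<integral>\<^sup>+t. ennreal T * indicator {0..T} t *
      (k * (emeasure lborel (ball (0::'a) 2))\<^sup>2 * (\<integral>\<^sup>+x. (g x)\<^sup>2 * W x \<partial>lborel)) \<partial>lborel)"
  proof (rule nn_integral_mono_AE)
    have *: "(\<integral>\<^sup>+x. W x * (h t x)\<^sup>2 \<partial>lborel) \<le> k * (emeasure lborel (ball (0::'a) 2))\<^sup>2 * (\<integral>\<^sup>+x. (g x)\<^sup>2 * W x \<partial>lborel)"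
      if "t > 0" for t
      unfolding h_def
      by (rule averages_bounded_A2[OF _ _ _ _ A2 that]) (use K WS in \<open>auto simp: g_def\<close>)
    show "AE t in lborel. ennreal T * indicator {0..T} t * (\<integral>\<^sup>+x. W x * (h t x)\<^sup>2 \<partial>lborel) \<le>
      ennreal T * indicator {0..T} t * (k * (emeasure lborel (ball (0::'a) 2))\<^sup>2 * (\<integral>\<^sup>+x. (g x)\<^sup>2 * W x \<partial>lborel))"
      \<comment> \<open>The bound for averages requires \<open>t > 0\<close>, so the endpoint 0 of
        the interval is discarded as a null set.\<close>
      using AE_lborel_singleton[of 0]
    proof eventually_elim
      case (elim t)
      then show ?case
        by (cases "t > 0") (auto simp: indicator_def intro!: mult_left_mono *)
    qed
  qed
  also have "\<dots> = (ennreal T)\<^sup>2 * (k * (emeasure lborel (ball (0::'a) 2))\<^sup>2 * (\<integral>\<^sup>+x. (g x)\<^sup>2 * W x \<partial>lborel))"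
    using T by (simp add: nn_integral_multc nn_integral_cmult power2_eq_square)
  finally show ?thesis
    by (simp add: m_def T_def g_def mult.assoc)
qed

section \<open>Square integrable functions\<close>

text \<open>Kept as a predicate on functions, in line with the Sobolev spaces here, so
  \<open>L2_norm\<close> is only a seminorm. It also takes the default value 0 if the integral
  diverges, which is why the norm lemmas carry this predicate as a hypothesis.\<close>

definition square_integrable :: "'x measure \<Rightarrow> ('x \<Rightarrow> 'b::euclidean_space) \<Rightarrow> bool" where
  "square_integrable M f \<longleftrightarrow> f \<in> borel_measurable M \<and> integrable M (\<lambda>x. (norm (f x))\<^sup>2)"

definition L2_norm :: "'x measure \<Rightarrow> ('x \<Rightarrow> 'b::euclidean_space) \<Rightarrow> real" where
  "L2_norm M f = sqrt (LINT x|M. (norm (f x))\<^sup>2)"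

definition L2_inner :: "'x measure \<Rightarrow> ('x \<Rightarrow> 'b::euclidean_space) \<Rightarrow> ('x \<Rightarrow> 'b) \<Rightarrow> real" where
  "L2_inner M f g = (LINT x|M. f x \<bullet> g x)"

lemma L2_norm_nonneg [simp]: "0 \<le> L2_norm M f"
  by (simp add: L2_norm_def)

lemma L2_norm_power2: "(L2_norm M f)\<^sup>2 = (LINT x|M. (norm (f x))\<^sup>2)"
  by (simp add: L2_norm_def)

lemma square_integrable_measurable: "square_integrable M f \<Longrightarrow> f \<in> borel_measurable M"
  by (simp add: square_integrable_def)

lemma square_integrable_inner:
  assumes "square_integrable M f" "square_integrable M g"
  shows "integrable M (\<lambda>x. f x \<bullet> g x)"
proof (rule Bochner_Integration.integrable_bound)
  note [measurable] = assms[THEN square_integrable_measurable]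
  show "integrable M (\<lambda>x. (norm (f x))\<^sup>2 + (norm (g x))\<^sup>2)"
    using assms by (simp add: square_integrable_def)
  show "(\<lambda>x. f x \<bullet> g x) \<in> borel_measurable M" by measurable
  show "AE x in M. norm (f x \<bullet> g x) \<le> norm ((norm (f x))\<^sup>2 + (norm (g x))\<^sup>2)"
  proof (rule AE_I2)
    fix x
    have "\<bar>f x \<bullet> g x\<bar> \<le> norm (f x) * norm (g x)"
      by (rule Cauchy_Schwarz_ineq2)
    also have "\<dots> \<le> (norm (f x))\<^sup>2 + (norm (g x))\<^sup>2"
      using sum_squares_bound[of "norm (f x)" "norm (g x)"] mult_nonneg_nonneg[of "norm (f x)" "norm (g x)"]
      unfolding mult.assoc using norm_ge_zero[of "f x"] norm_ge_zero[of "g x"] by linarith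
    finally show "norm (f x \<bullet> g x) \<le> norm ((norm (f x))\<^sup>2 + (norm (g x))\<^sup>2)"
      by simp
  qed
qed

lemma norm_lincomb_power2:
  "(norm (x + c *\<^sub>R y))\<^sup>2 = (norm x)\<^sup>2 + 2 * c * (x \<bullet> y) + c\<^sup>2 * (norm (y :: 'b::real_inner))\<^sup>2"
  unfolding power2_norm_eq_inner
  by (simp add: inner_add_left inner_add_right inner_commute power2_eq_square algebra_simps)

lemma square_integrable_lincomb:
  assumes "square_integrable M f" "square_integrable M g"
  shows "square_integrable M (\<lambda>x. f x + c *\<^sub>R g x)"
proof -
  have "integrable M (\<lambda>x. (norm (f x + c *\<^sub>R g x))\<^sup>2)"
    unfolding norm_lincomb_power2 using assms square_integrable_inner[OF assms]
    by (auto simp: square_integrable_def)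
  moreover have "(\<lambda>x. f x + c *\<^sub>R g x) \<in> borel_measurable M"
    using assms[THEN square_integrable_measurable] by measurable
  ultimately show ?thesis by (simp add: square_integrable_def)
qed

lemma square_integrable_diff:
  "square_integrable M f \<Longrightarrow> square_integrable M g \<Longrightarrow> square_integrable M (\<lambda>x. f x - g x)"
  using square_integrable_lincomb[of M f g "-1"] by simp

lemma L2_norm_lincomb:
  assumes "square_integrable M f" "square_integrable M g"
  shows "(L2_norm M (\<lambda>x. f x + c *\<^sub>R g x))\<^sup>2 =
    (L2_norm M f)\<^sup>2 + 2 * c * L2_inner M f g + c\<^sup>2 * (L2_norm M g)\<^sup>2"
  unfolding L2_norm_power2 L2_inner_def norm_lincomb_power2
  using assms square_integrable_inner[OF assms] by (simp add: square_integrable_def)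

text \<open>Serves twice: for squared norms it yields the Cauchy-Schwarz inequality, and with
  \<open>a = 0\<close> it shows that the first variation at the minimiser vanishes.\<close>

lemma nonneg_quadratic_discriminant:
  fixes a b c :: real
  assumes "\<And>t. 0 \<le> a\<^sup>2 + 2 * t * b + t\<^sup>2 * c\<^sup>2" "0 \<le> a" "0 \<le> c"
  shows "\<bar>b\<bar> \<le> a * c"
proof (cases "c = 0")
  case True
  have "b = 0"
  proof (rule ccontr)
    assume "b \<noteq> 0"
    \<comment> \<open>Without the quadratic term this choice of \<open>t\<close> gives the value
      -1.\<close>
    then show False
      using assms(1)[of "- (a\<^sup>2 + 1) / (2 * b)"] True by (simp add: field_simps)
  qed
  then show ?thesis using True by simp
next
  case False
  \<comment> \<open>The quadratic is evaluated at its minimum t = - b / c^2.\<close>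
  have "0 \<le> (a\<^sup>2 + 2 * (- b / c\<^sup>2) * b + (- b / c\<^sup>2)\<^sup>2 * c\<^sup>2) * c\<^sup>2"
    by (intro mult_nonneg_nonneg assms(1)) auto
  also have "\<dots> = (a * c)\<^sup>2 - b\<^sup>2"
    using False by (simp add: field_simps power2_eq_square)
  finally have "b\<^sup>2 \<le> (a * c)\<^sup>2" by simp
  then show ?thesis
    using assms by (metis abs_le_square_iff abs_of_nonneg mult_nonneg_nonneg)
qed

lemma L2_Cauchy_Schwarz:
  assumes "square_integrable M f" "square_integrable M g"
  shows "\<bar>L2_inner M f g\<bar> \<le> L2_norm M f * L2_norm M g"
proof (rule nonneg_quadratic_discriminant)
  show "0 \<le> (L2_norm M f)\<^sup>2 + 2 * t * L2_inner M f g + t\<^sup>2 * (L2_norm M g)\<^sup>2" for t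
    unfolding L2_norm_lincomb[OF assms, symmetric] by simp
qed auto

lemma L2_norm_triangle:
  assumes "square_integrable M f" "square_integrable M g"
  shows "L2_norm M (\<lambda>x. f x + c *\<^sub>R g x) \<le> L2_norm M f + \<bar>c\<bar> * L2_norm M g"
proof (rule power2_le_imp_le)
  have "c * L2_inner M f g \<le> \<bar>c\<bar> * \<bar>L2_inner M f g\<bar>"
    by (metis abs_ge_self abs_mult)
  also have "\<dots> \<le> \<bar>c\<bar> * (L2_norm M f * L2_norm M g)"
    by (intro mult_left_mono L2_Cauchy_Schwarz assms) auto
  finally show "(L2_norm M (\<lambda>x. f x + c *\<^sub>R g x))\<^sup>2 \<le> (L2_norm M f + \<bar>c\<bar> * L2_norm M g)\<^sup>2"
    unfolding L2_norm_lincomb[OF assms] by (simp add: power2_sum power_mult_distrib algebra_simps)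
qed simp

lemma L2_norm_triangle_diff:
  assumes "square_integrable M f" "square_integrable M g"
  shows "L2_norm M f \<le> L2_norm M g + L2_norm M (\<lambda>x. f x - g x)"
  using L2_norm_triangle[OF assms(2) square_integrable_diff[OF assms], of 1] by simp

lemma L2_norm_cong_AE:
  assumes "f \<in> borel_measurable M" "g \<in> borel_measurable M" "AE x in M. f x = g x"
  shows "L2_norm M f = L2_norm M g"
  unfolding L2_norm_def using assms by (intro arg_cong[where f = sqrt] integral_cong_AE) auto

lemma square_integrable_cong_AE:
  assumes "f \<in> borel_measurable M" "g \<in> borel_measurable M" "AE x in M. f x = g x"
  shows "square_integrable M f \<longleftrightarrow> square_integrable M g"
proof -
  have "integrable M (\<lambda>x. (norm (f x))\<^sup>2) \<longleftrightarrow> integrable M (\<lambda>x. (norm (g x))\<^sup>2)"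
    using assms by (intro integrable_cong_AE) auto
  then show ?thesis using assms by (simp add: square_integrable_def)
qed

lemma L2_norm_eq_0:
  assumes "square_integrable M f" "L2_norm M f = 0"
  shows "AE x in M. f x = 0"
proof -
  have "(LINT x|M. (norm (f x))\<^sup>2) = 0"
    using assms(2) by (simp add: L2_norm_def)
  then have "AE x in M. (norm (f x))\<^sup>2 = 0"
    using assms(1) by (subst (asm) integral_nonneg_eq_0_iff_AE) (auto simp: square_integrable_def)
  then show ?thesis by simp
qed

lemma square_integrableI_nn:
  assumes [measurable]: "f \<in> borel_measurable M"
    and le: "(\<integral>\<^sup>+x. ennreal ((norm (f x))\<^sup>2) \<partial>M) \<le> ennreal (c\<^sup>2)" and c: "c \<ge> 0"
  shows "square_integrable M f" "L2_norm M f \<le> c"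
proof -
  have int: "integrable M (\<lambda>x. (norm (f x))\<^sup>2)"
    using le by (intro integrableI_bounded) (auto simp: le_less_trans[OF le])
  then show "square_integrable M f"
    by (simp add: square_integrable_def)
  have "ennreal ((L2_norm M f)\<^sup>2) \<le> ennreal (c\<^sup>2)"
    using le int unfolding L2_norm_power2 by (simp add: nn_integral_eq_integral)
  then show "L2_norm M f \<le> c"
    using c by (simp add: abs_le_square_iff[symmetric])
qed

lemma L2_nn_integral:
  "square_integrable M f \<Longrightarrow> (\<integral>\<^sup>+x. ennreal ((norm (f x))\<^sup>2) \<partial>M) = ennreal ((L2_norm M f)\<^sup>2)"
  unfolding L2_norm_power2 by (simp add: square_integrable_def nn_integral_eq_integral)

text \<open>The bound is demanded only from index \<open>N\<close> on, because later applications
  feed in bounds that improve along the tail.\<close>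

lemma L2_Fatou:
  fixes f :: "nat \<Rightarrow> 'x \<Rightarrow> 'b::euclidean_space"
  assumes f: "\<And>k. square_integrable M (f k)" and g: "g \<in> borel_measurable M"
    and lim: "AE x in M. (\<lambda>k. f k x) \<longlonglongrightarrow> g x"
    and bound: "\<And>k. k \<ge> N \<Longrightarrow> L2_norm M (f k) \<le> c"
  shows "square_integrable M g" "L2_norm M g \<le> c"
proof -
  note [measurable] = f[THEN square_integrable_measurable] g
  have c: "0 \<le> c"
    using bound[of N] L2_norm_nonneg[of M "f N"] by linarith
  have "(\<integral>\<^sup>+x. ennreal ((norm (g x))\<^sup>2) \<partial>M) = (\<integral>\<^sup>+x. liminf (\<lambda>k. ennreal ((norm (f k x))\<^sup>2)) \<partial>M)"
  proof (rule nn_integral_cong_AE)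
    show "AE x in M. ennreal ((norm (g x))\<^sup>2) = liminf (\<lambda>k. ennreal ((norm (f k x))\<^sup>2))"
      using lim
    proof eventually_elim
      case (elim x)
      have "(\<lambda>k. ennreal ((norm (f k x))\<^sup>2)) \<longlonglongrightarrow> ennreal ((norm (g x))\<^sup>2)"
        by (intro tendsto_intros elim)
      then show ?case
        by (intro lim_imp_Liminf[symmetric]) auto
    qed
  qed
  also have "\<dots> \<le> liminf (\<lambda>k. \<integral>\<^sup>+x. ennreal ((norm (f k x))\<^sup>2) \<partial>M)"
    by (rule nn_integral_liminf) measurable
  also have "\<dots> \<le> ennreal (c\<^sup>2)"
  proof (rule Liminf_le)
    show "\<forall>\<^sub>F k in sequentially. (\<integral>\<^sup>+x. ennreal ((norm (f k x))\<^sup>2) \<partial>M) \<le> ennreal (c\<^sup>2)"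
      using eventually_ge_at_top[of N]
      by eventually_elim (auto simp: L2_nn_integral[OF f] intro!: ennreal_leI power_mono bound)
  qed simp
  finally show "square_integrable M g" "L2_norm M g \<le> c"
    using square_integrableI_nn[OF g _ c] by auto
qed

lemma L2_tendsto_AE_subseq:
  fixes f :: "nat \<Rightarrow> 'x \<Rightarrow> 'b::euclidean_space"
  assumes f: "\<And>k. square_integrable M (f k)" "square_integrable M g"
    and lim: "(\<lambda>k. L2_norm M (\<lambda>x. f k x - g x)) \<longlonglongrightarrow> 0"
  obtains r where "strict_mono r" "AE x in M. (\<lambda>k. f (r k) x) \<longlonglongrightarrow> g x"
proof -
  have "(\<lambda>k. (L2_norm M (\<lambda>x. f k x - g x))\<^sup>2) \<longlonglongrightarrow> 0\<^sup>2"
    by (intro tendsto_intros lim)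
  then have "(\<lambda>k. LINT x|M. norm ((norm (f k x - g x))\<^sup>2)) \<longlonglongrightarrow> 0"
    by (simp add: L2_norm_power2)
  moreover have "integrable M (\<lambda>x. (norm (f k x - g x))\<^sup>2)" for k
    using square_integrable_diff[OF f] by (simp add: square_integrable_def)
  ultimately obtain r where r: "strict_mono r" "AE x in M. (\<lambda>k. (norm (f (r k) x - g x))\<^sup>2) \<longlonglongrightarrow> 0"
    using tendsto_L1_AE_subseq[of M "\<lambda>k x. (norm (f k x - g x))\<^sup>2"] by blast
  have "AE x in M. (\<lambda>k. f (r k) x) \<longlonglongrightarrow> g x"
    using r(2)
  proof eventually_elim
    case (elim x)
    have "(\<lambda>k. norm (f (r k) x - g x)) \<longlonglongrightarrow> 0"
      using tendsto_real_sqrt[OF elim] by simp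
    then show ?case
      by (simp add: LIM_zero_iff tendsto_norm_zero_iff)
  qed
  then show ?thesis using r(1) that by blast
qed

text \<open>The Riesz-Fischer argument: a subsequence whose consecutive distances are at most 2^(-k)
  converges a.e., and Fatou's lemma turns the a.e. limit into a limit in norm of the whole
  sequence.\<close>

lemma L2_complete:
  fixes f :: "nat \<Rightarrow> 'x \<Rightarrow> 'b::euclidean_space"
  assumes f: "\<And>k. square_integrable M (f k)"
    and cauchy: "\<And>e. e > 0 \<Longrightarrow> \<exists>N. \<forall>m\<ge>N. \<forall>n\<ge>N. L2_norm M (\<lambda>x. f m x - f n x) \<le> e"
  obtains g where "square_integrable M g" "(\<lambda>k. L2_norm M (\<lambda>x. f k x - g x)) \<longlonglongrightarrow> 0"
proof -
  note fm [measurable] = f[THEN square_integrable_measurable]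
  have "\<exists>r. \<forall>k. (\<forall>m\<ge>r k. \<forall>n\<ge>r k. L2_norm M (\<lambda>x. f m x - f n x) \<le> (1 / 2) ^ k) \<and> r (Suc k) > r k"
  proof (rule dependent_nat_choice)
    show "\<exists>a. \<forall>m\<ge>a. \<forall>n\<ge>a. L2_norm M (\<lambda>x. f m x - f n x) \<le> (1 / 2) ^ 0"
      by (rule cauchy) simp
    fix a k
    obtain N where "\<forall>m\<ge>N. \<forall>n\<ge>N. L2_norm M (\<lambda>x. f m x - f n x) \<le> (1 / 2) ^ Suc k"
      using cauchy[of "(1 / 2) ^ Suc k"] by auto
    then show "\<exists>b. (\<forall>m\<ge>b. \<forall>n\<ge>b. L2_norm M (\<lambda>x. f m x - f n x) \<le> (1 / 2) ^ Suc k) \<and> b > a"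
      by (intro exI[of _ "max N (Suc a)"]) auto
  qed
  then obtain r where r: "\<And>k m n. m \<ge> r k \<Longrightarrow> n \<ge> r k \<Longrightarrow> L2_norm M (\<lambda>x. f m x - f n x) \<le> (1 / 2) ^ k"
      and mono: "strict_mono r"
    by (auto simp: strict_mono_Suc_iff)
  \<comment> \<open>The squares of the \<open>d k\<close> are summed with weights 2^k: their
    integrals are still bounded by 2^k 4^(-k) = 2^(-k), and d \<le> 2^(-k) + 2^k d^2 recovers
    absolute summability of the increments at almost every point.\<close>
  define d where "d k x = norm (f (r (Suc k)) x - f (r k) x)" for k x
  have "(\<integral>\<^sup>+x. (\<Sum>k. ennreal (2 ^ k * (d k x)\<^sup>2)) \<partial>M) = (\<Sum>k. \<integral>\<^sup>+x. ennreal (2 ^ k * (d k x)\<^sup>2) \<partial>M)"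
    unfolding d_def by (rule nn_integral_suminf) measurable
  also have "\<dots> \<le> (\<Sum>k. ennreal ((1 / 2) ^ k))"
  proof (rule suminf_le)
    fix k
    have "(\<integral>\<^sup>+x. ennreal (2 ^ k * (d k x)\<^sup>2) \<partial>M) = ennreal (2 ^ k) * (\<integral>\<^sup>+x. ennreal ((d k x)\<^sup>2) \<partial>M)"
      unfolding d_def by (simp add: ennreal_mult nn_integral_cmult)
    also have "\<dots> = ennreal (2 ^ k * (L2_norm M (\<lambda>x. f (r (Suc k)) x - f (r k) x))\<^sup>2)"
      unfolding d_def L2_nn_integral[OF square_integrable_diff[OF f f]] by (simp add: ennreal_mult)
    also have "\<dots> \<le> ennreal (2 ^ k * ((1 / 2) ^ k)\<^sup>2)"
      using strict_mono_leD[OF mono, of k "Suc k"]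
      by (intro ennreal_leI mult_left_mono power_mono r) auto
    also have "2 ^ k * ((1 / 2) ^ k)\<^sup>2 = ((1 / 2) ^ k :: real)"
      by (simp add: power2_eq_square field_simps)
    finally show "(\<integral>\<^sup>+x. ennreal (2 ^ k * (d k x)\<^sup>2) \<partial>M) \<le> ennreal ((1 / 2) ^ k)" .
  qed auto
  also have "\<dots> = ennreal (\<Sum>k. (1 / 2) ^ k)"
    by (intro suminf_ennreal2 summable_geometric) auto
  also have "\<dots> < \<infinity>" by simp
  finally have "AE x in M. (\<Sum>k. ennreal (2 ^ k * (d k x)\<^sup>2)) \<noteq> \<infinity>"
    unfolding d_def by (intro nn_integral_PInf_AE) auto
  then have conv: "AE x in M. convergent (\<lambda>k. f (r k) x)"
  proof eventually_elim
    case (elim x)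
    have "summable (\<lambda>k. 2 ^ k * (d k x)\<^sup>2)"
      using elim by (intro summable_suminf_not_top) auto
    then have "summable (\<lambda>k. (1 / 2) ^ k + 2 ^ k * (d k x)\<^sup>2)"
      by (intro summable_add summable_geometric) auto
    then have "summable (\<lambda>k. f (r (Suc k)) x - f (r k) x)"
    proof (rule summable_comparison_test'[where N = 0])
      fix k :: nat
      have "0 \<le> (1 - 2 ^ k * d k x)\<^sup>2 / 2 ^ k" by simp
      also have "\<dots> = (1 / 2) ^ k - 2 * d k x + 2 ^ k * (d k x)\<^sup>2"
        by (simp add: power2_eq_square field_simps)
      finally have "d k x \<le> (1 / 2) ^ k + 2 ^ k * (d k x)\<^sup>2"
        by (simp add: d_def) (smt (verit) norm_ge_zero)
      then show "norm (f (r (Suc k)) x - f (r k) x) \<le> (1 / 2) ^ k + 2 ^ k * (d k x)\<^sup>2"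
        by (simp add: d_def)
    qed
    then have "convergent (\<lambda>n. \<Sum>k<n. f (r (Suc k)) x - f (r k) x)"
      by (simp add: summable_iff_convergent)
    then have "convergent (\<lambda>n. (f (r n) x - f (r 0) x) + f (r 0) x)"
      unfolding sum_lessThan_telescope[of "\<lambda>k. f (r k) x"] by (intro convergent_add convergent_const)
    then show ?case by simp
  qed
  define g where "g x = lim (\<lambda>k. f (r k) x)" for x
  have gm [measurable]: "g \<in> borel_measurable M"
    unfolding g_def by measurable
  have lim: "AE x in M. (\<lambda>k. f (r k) x) \<longlonglongrightarrow> g x"
    using conv by eventually_elim (simp add: g_def convergent_LIMSEQ_iff)
  \<comment> \<open>The index \<open>m\<close> is fixed and the other one runs to infinity along the
    subsequence.\<close>
  have bound: "square_integrable M (\<lambda>x. f m x - g x) \<and> L2_norm M (\<lambda>x. f m x - g x) \<le> (1 / 2) ^ k" if m: "m \<ge> r k" for m k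
  proof -
    have lim': "AE x in M. (\<lambda>j. f m x - f (r j) x) \<longlonglongrightarrow> f m x - g x"
      using lim by eventually_elim (intro tendsto_intros)
    have "L2_norm M (\<lambda>x. f m x - f (r j) x) \<le> (1 / 2) ^ k" if "j \<ge> k" for j
      using that m strict_mono_leD[OF mono that] by (intro r) auto
    then show ?thesis
      using L2_Fatou[OF square_integrable_diff[OF f f] _ lim', where N = k and c = "(1 / 2) ^ k"] by auto
  qed
  have g: "square_integrable M g"
    using square_integrable_diff[OF f, of "\<lambda>x. f (r 0) x - g x" "r 0"] bound[of 0 "r 0"] by simp
  have "(\<lambda>m. L2_norm M (\<lambda>x. f m x - g x)) \<longlonglongrightarrow> 0"
  proof (rule LIMSEQ_I)
    fix e :: real assume "e > 0"
    then obtain k where "(1 / 2) ^ k < e"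
      using real_arch_pow_inv[of e "1 / 2"] by auto
    then have "L2_norm M (\<lambda>x. f m x - g x) < e" if "m \<ge> r k" for m
      using bound[OF that] by auto
    then show "\<exists>N. \<forall>n\<ge>N. norm (L2_norm M (\<lambda>x. f n x - g x) - 0) < e"
      by auto
  qed
  then show ?thesis using g that by blast
qed

section \<open>The weighted Sobolev space\<close>

text \<open>An exhaustion of \<open>D\<close> by compact sets makes \<open>u\<close> on
  \<open>D\<close> a pointwise limit of measurable functions.\<close>

lemma locally_summable_measurable:
  fixes u :: "'a::euclidean_space \<Rightarrow> 'b::{banach, second_countable_topology}"
  assumes D: "open D" and u: "locally_summable D u"
  shows "u \<in> borel_measurable (lebesgue_on D)"
proof -
  obtain K where K: "\<And>n. compact (K n)" "\<And>n. K n \<subseteq> D" "\<Union>(range K) = D"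
      "\<And>n. K n \<subseteq> interior (K (Suc n))"
    using open_Union_compact_subsets[OF D] by metis
  have "incseq K"
    using K(4) interior_subset by (intro incseq_SucI) blast
  have "(\<lambda>x. indicator D x *\<^sub>R u x) \<in> borel_measurable lebesgue"
  proof (rule borel_measurable_LIMSEQ_metric)
    show "(\<lambda>x. indicator (K n) x *\<^sub>R u x) \<in> borel_measurable lebesgue" for n
      using u K(1,2)[of n] by (auto simp: locally_summable_def set_integrable_def)
    show "(\<lambda>n. indicator (K n) x *\<^sub>R u x) \<longlonglongrightarrow> indicator D x *\<^sub>R u x" for x
      using LIMSEQ_indicator_incseq[OF \<open>incseq K\<close>, of x] K(3) by (intro tendsto_intros) auto
  qed
  then show ?thesis
    using D by (subst borel_measurable_restrict_space_iff) auto
qed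

text \<open>Collects what the variational argument uses about the weight; the
  \<open>A_2\<close>-condition and the exponent -n/2 enter only through these assumptions. The
  inequalities are stated as nonnegative integrals, and one constant \<open>C\<close> serves
  both.\<close>

locale weighted_domain =
  fixes D :: "'a::euclidean_space set" and w :: "'a \<Rightarrow> real" and C :: real
  assumes open_D: "open D"
    and w_measurable: "w \<in> borel_measurable lebesgue"
    and w_nonneg: "\<And>x. 0 \<le> w x"
    and w_pos: "AE x in lebesgue. x \<in> D \<longrightarrow> 0 < w x"
    and w_summable: "locally_summable D w"
    and inverse_w_integrable: "set_integrable lebesgue D (\<lambda>x. 1 / w x)"
    and C_nonneg: "0 \<le> C"
    and Poincare_test: "\<And>\<phi>. \<phi> \<in> test_functions D \<Longrightarrow>
      (\<integral>\<^sup>+x. ennreal ((\<phi> x)\<^sup>2 * w x) \<partial>lebesgue) \<le>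
      ennreal (C\<^sup>2) * (\<integral>\<^sup>+x. ennreal ((norm (grad \<phi> x))\<^sup>2 * w x) \<partial>lebesgue)"
    and Sobolev_test: "\<And>\<phi>. \<phi> \<in> test_functions D \<Longrightarrow>
      (\<integral>\<^sup>+x. ennreal ((\<phi> x)\<^sup>2) \<partial>lebesgue) \<le>
      ennreal (C\<^sup>2) * (\<integral>\<^sup>+x. ennreal ((norm (grad \<phi> x))\<^sup>2 * w x) \<partial>lebesgue)"
begin

text \<open>Turns the weighted norms of functions and gradients into plain L2 norms, so that the
  preceding section applies to them.\<close>

definition mu :: "'a measure" where
  "mu = density (lebesgue_on D) (\<lambda>x. ennreal (w x))"

lemma sets_D [measurable]: "D \<in> sets lebesgue"
  using open_D by auto

lemma w_measurable_on [measurable]: "w \<in> borel_measurable (lebesgue_on D)"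
  using w_measurable by (rule measurable_restrict_space1)

lemma measurable_mu [simp]: "borel_measurable mu = borel_measurable (lebesgue_on D)"
  by (intro measurable_cong_sets) (simp_all add: mu_def)

lemma AE_on_D: "(AE x in lebesgue_on D. P x) \<longleftrightarrow> (AE x in lebesgue. x \<in> D \<longrightarrow> P x)"
  by (subst AE_restrict_space_iff) auto

text \<open>Because the weight is positive a.e. on \<open>D\<close>, \<open>mu\<close> and Lebesgue
  measure on \<open>D\<close> have the same null sets. Versions of gradients and a.e. limits can
  thus be moved between the weighted and the unweighted space.\<close>

lemma AE_mu: "(AE x in mu. P x) \<longleftrightarrow> (AE x in lebesgue. x \<in> D \<longrightarrow> P x)"
proof -
  have "(AE x in mu. P x) \<longleftrightarrow> (AE x in lebesgue. x \<in> D \<longrightarrow> 0 < w x \<longrightarrow> P x)"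
    unfolding mu_def by (subst AE_density) (auto simp: AE_on_D)
  also have "\<dots> \<longleftrightarrow> (AE x in lebesgue. x \<in> D \<longrightarrow> P x)"
  proof
    assume "AE x in lebesgue. x \<in> D \<longrightarrow> 0 < w x \<longrightarrow> P x"
    then show "AE x in lebesgue. x \<in> D \<longrightarrow> P x"
      using w_pos by eventually_elim auto
  qed (auto elim: eventually_mono)
  finally show ?thesis .
qed

lemma AE_mu_iff_AE_on_D: "(AE x in mu. P x) \<longleftrightarrow> (AE x in lebesgue_on D. P x)"
  by (simp add: AE_mu AE_on_D)

lemma set_integrable_iff_on_D:
  "set_integrable lebesgue D f \<longleftrightarrow> integrable (lebesgue_on D) (f :: 'a \<Rightarrow> real)"
  unfolding set_integrable_def by (subst integrable_restrict_space) auto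

lemma set_integral_eq_on_D:
  "(LINT x:D|lebesgue. f x) = (LINT x|lebesgue_on D. (f x :: real))"
  unfolding set_lebesgue_integral_def by (subst integral_restrict_space) auto

lemma integrable_mu_iff:
  fixes g :: "'a \<Rightarrow> real"
  assumes "g \<in> borel_measurable (lebesgue_on D)"
  shows "integrable mu g \<longleftrightarrow> set_integrable lebesgue D (\<lambda>x. g x * w x)"
  unfolding mu_def set_integrable_iff_on_D using assms w_nonneg
  by (subst integrable_density) (auto simp: mult.commute)

lemma integral_mu_eq:
  fixes g :: "'a \<Rightarrow> real"
  assumes "g \<in> borel_measurable (lebesgue_on D)"
  shows "(LINT x|mu. g x) = (LINT x:D|lebesgue. g x * w x)"
  unfolding mu_def set_integral_eq_on_D using assms w_nonneg
  by (subst integral_density) (auto simp: mult.commute)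

lemma nn_integral_mu_eq:
  assumes "\<And>x. 0 \<le> g x" "g \<in> borel_measurable (lebesgue_on D)" "\<And>x. x \<notin> D \<Longrightarrow> g x = 0"
  shows "(\<integral>\<^sup>+x. ennreal (g x) \<partial>mu) = (\<integral>\<^sup>+x. ennreal (g x * w x) \<partial>lebesgue)"
proof -
  have "(\<integral>\<^sup>+x. ennreal (g x) \<partial>mu) = (\<integral>\<^sup>+x. ennreal (g x * w x) \<partial>lebesgue_on D)"
    unfolding mu_def using assms w_nonneg
    by (subst nn_integral_density) (auto simp: ennreal_mult mult.commute)
  also have "\<dots> = (\<integral>\<^sup>+x. ennreal (g x * w x) \<partial>lebesgue)"
    using assms(3) by (subst nn_integral_restrict_space) (auto intro!: nn_integral_cong simp: indicator_def)
  finally show ?thesis .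
qed

lemma nn_integral_on_D_eq:
  assumes "\<And>x. x \<notin> D \<Longrightarrow> g x = 0"
  shows "(\<integral>\<^sup>+x. ennreal (g x) \<partial>lebesgue_on D) = (\<integral>\<^sup>+x. ennreal (g x) \<partial>lebesgue)"
  using assms by (subst nn_integral_restrict_space) (auto intro!: nn_integral_cong simp: indicator_def)

lemma has_weak_gradient_measurable:
  assumes "has_weak_gradient D u G"
  shows "u \<in> borel_measurable (lebesgue_on D)" "G \<in> borel_measurable (lebesgue_on D)"
  using assms by (auto simp: has_weak_gradient_def intro: locally_summable_measurable[OF open_D])

lemma W12_iff:
  "u \<in> sobolev_W12 D w \<longleftrightarrow> (\<exists>G. has_weak_gradient D u G) \<and>
    square_integrable mu u \<and> square_integrable mu (weak_gradient D u)"
proof (cases "\<exists>G. has_weak_gradient D u G")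
  case True
  then have wg: "has_weak_gradient D u (weak_gradient D u)"
    using has_weak_gradient_weak_gradient by blast
  note [measurable] = has_weak_gradient_measurable[OF wg]
  have ls: "locally_summable D u"
    using wg by (simp add: has_weak_gradient_def)
  have "square_integrable mu u \<longleftrightarrow> set_integrable lebesgue D (\<lambda>x. \<bar>u x\<bar>\<^sup>2 * w x)"
    by (simp add: square_integrable_def integrable_mu_iff)
  moreover have "square_integrable mu (weak_gradient D u) \<longleftrightarrow>
      set_integrable lebesgue D (\<lambda>x. (norm (weak_gradient D u x))\<^sup>2 * w x)"
    by (simp add: square_integrable_def integrable_mu_iff)
  ultimately show ?thesis
    using ls True by (simp add: sobolev_W12_def)
qed (simp add: sobolev_W12_def)

lemma W12D:
  assumes "u \<in> sobolev_W12 D w"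
  shows "has_weak_gradient D u (weak_gradient D u)" "square_integrable mu u"
    "square_integrable mu (weak_gradient D u)"
  using assms has_weak_gradient_weak_gradient by (auto simp: W12_iff)

text \<open>Lets any known weak gradient replace the arbitrary version \<open>weak_gradient\<close>.
  Linearity, which that choice respects only a.e., and limits are handled through it.\<close>

lemma W12I:
  assumes "has_weak_gradient D u G" "square_integrable mu u" "square_integrable mu G"
  shows "u \<in> sobolev_W12 D w" "AE x in mu. weak_gradient D u x = G x"
proof -
  have wg: "has_weak_gradient D u (weak_gradient D u)"
    using has_weak_gradient_weak_gradient assms(1) by blast
  show AE: "AE x in mu. weak_gradient D u x = G x"
    unfolding AE_mu by (rule weak_gradient_AE[OF open_D assms(1)])
  have "square_integrable mu (weak_gradient D u)"
    using assms(3) square_integrable_cong_AE[OF _ _ AE]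
      has_weak_gradient_measurable[OF wg] has_weak_gradient_measurable[OF assms(1)] by simp
  then show "u \<in> sobolev_W12 D w"
    using assms by (auto simp: W12_iff)
qed

lemma sobolev_norm_eq:
  assumes "u \<in> sobolev_W12 D w"
  shows "sobolev_norm D w u = L2_norm mu u + L2_norm mu (weak_gradient D u)"
proof -
  note [measurable] = has_weak_gradient_measurable[OF W12D(1)[OF assms]]
  show ?thesis
    by (simp add: sobolev_norm_def L2_norm_def integral_mu_eq)
qed

lemma energy_inner_eq:
  assumes "u \<in> sobolev_W12 D w" "v \<in> sobolev_W12 D w"
  shows "energy_inner D w u v = L2_inner mu (weak_gradient D u) (weak_gradient D v)"
proof -
  note [measurable] = has_weak_gradient_measurable[OF W12D(1)[OF assms(1)]]
    has_weak_gradient_measurable[OF W12D(1)[OF assms(2)]]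
  show ?thesis
    by (simp add: energy_inner_def L2_inner_def integral_mu_eq)
qed

lemma W12_lincomb:
  assumes u: "u \<in> sobolev_W12 D w" and v: "v \<in> sobolev_W12 D w"
  shows "(\<lambda>x. u x + c * v x) \<in> sobolev_W12 D w"
    "AE x in mu. weak_gradient D (\<lambda>x. u x + c * v x) x = weak_gradient D u x + c *\<^sub>R weak_gradient D v x"
  using W12I[OF has_weak_gradient_lincomb[OF W12D(1)[OF u] W12D(1)[OF v], of c]]
    square_integrable_lincomb[OF W12D(2)[OF u] W12D(2)[OF v], of c]
    square_integrable_lincomb[OF W12D(3)[OF u] W12D(3)[OF v], of c]
  by simp_all

lemma L2_inner_weak_gradient_lincomb:
  assumes u: "u \<in> sobolev_W12 D w" and v: "v \<in> sobolev_W12 D w" and z: "z \<in> sobolev_W12 D w"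
  shows "L2_inner mu (weak_gradient D (\<lambda>x. u x + c * v x)) (weak_gradient D z) =
    L2_inner mu (weak_gradient D u) (weak_gradient D z) + c * L2_inner mu (weak_gradient D v) (weak_gradient D z)"
proof -
  note uv = W12_lincomb[OF u v, of c]
  note [measurable] = has_weak_gradient_measurable(2)[OF W12D(1)[OF u]]
    has_weak_gradient_measurable(2)[OF W12D(1)[OF v]]
    has_weak_gradient_measurable(2)[OF W12D(1)[OF z]]
    has_weak_gradient_measurable(2)[OF W12D(1)[OF uv(1)]]
  have "L2_inner mu (weak_gradient D (\<lambda>x. u x + c * v x)) (weak_gradient D z) =
      (LINT x|mu. weak_gradient D u x \<bullet> weak_gradient D z x + c * (weak_gradient D v x \<bullet> weak_gradient D z x))"
    unfolding L2_inner_def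
  proof (rule integral_cong_AE)
    show "AE x in mu. weak_gradient D (\<lambda>x. u x + c * v x) x \<bullet> weak_gradient D z x =
        weak_gradient D u x \<bullet> weak_gradient D z x + c * (weak_gradient D v x \<bullet> weak_gradient D z x)"
      using uv(2) by eventually_elim (simp add: inner_add_left)
  qed simp_all
  then show ?thesis
    using square_integrable_inner[OF W12D(3)[OF u] W12D(3)[OF z]]
      square_integrable_inner[OF W12D(3)[OF v] W12D(3)[OF z]]
    by (simp add: L2_inner_def)
qed

lemma L2_norm_weak_gradient_cong:
  assumes "has_weak_gradient D u G" "square_integrable mu u" "square_integrable mu G"
  shows "L2_norm mu (weak_gradient D u) = L2_norm mu G"
  using W12I[OF assms] assms(3) W12D(3)[OF W12I(1)[OF assms]]
  by (intro L2_norm_cong_AE) (auto dest: square_integrable_measurable)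

lemma L2_norm_weak_gradient_lincomb:
  assumes u: "u \<in> sobolev_W12 D w" and v: "v \<in> sobolev_W12 D w"
  shows "L2_norm mu (weak_gradient D (\<lambda>x. u x + c * v x)) =
    L2_norm mu (\<lambda>x. weak_gradient D u x + c *\<^sub>R weak_gradient D v x)"
  by (intro L2_norm_weak_gradient_cong has_weak_gradient_lincomb square_integrable_lincomb W12D u v W12_lincomb(1))

lemma sobolev_norm_triangle:
  assumes u: "u \<in> sobolev_W12 D w" and v: "v \<in> sobolev_W12 D w"
  shows "sobolev_norm D w (\<lambda>x. u x + c * v x) \<le> sobolev_norm D w u + \<bar>c\<bar> * sobolev_norm D w v"
  unfolding sobolev_norm_eq[OF u] sobolev_norm_eq[OF v] sobolev_norm_eq[OF W12_lincomb(1)[OF u v]]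
    L2_norm_weak_gradient_lincomb[OF u v]
  using L2_norm_triangle[OF W12D(2)[OF u] W12D(2)[OF v], of c] L2_norm_triangle[OF W12D(3)[OF u] W12D(3)[OF v], of c]
  by (simp add: algebra_simps)

lemma test_square_integrable:
  assumes \<phi>: "\<phi> \<in> test_functions D"
  shows "square_integrable mu \<phi>" "square_integrable mu (grad \<phi>)"
proof -
  obtain K where K: "compact K" "K \<subseteq> D" "\<And>x. x \<notin> K \<Longrightarrow> \<phi> x = 0" "\<And>x. x \<notin> K \<Longrightarrow> grad \<phi> x = 0"
    using test_function_support[OF \<phi>] by metis
  have *: "square_integrable mu g"
    if g: "continuous_on UNIV g" "\<And>x. x \<notin> K \<Longrightarrow> g x = 0" for g :: "'a \<Rightarrow> 'b::euclidean_space"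
  proof -
    have "g \<in> borel_measurable lebesgue"
      using borel_measurable_continuous_onI[OF g(1)] by (auto intro: measurable_completion)
    then have gm [measurable]: "g \<in> borel_measurable (lebesgue_on D)"
      by (rule measurable_restrict_space1)
    have "continuous_on UNIV (\<lambda>x. (norm (g x))\<^sup>2)" "\<And>x. x \<notin> K \<Longrightarrow> (norm (g x))\<^sup>2 = 0"
      using g by (auto intro!: continuous_intros)
    \<comment> \<open>Here the weight is the locally summable factor and the square of
      \<open>g\<close> is the continuous one with compact support.\<close>
    from set_integrable_mult_bounded_support[OF w_summable K(1,2) this(2,1)]
    have "set_integrable lebesgue D (\<lambda>x. (norm (g x))\<^sup>2 * w x)"
      by (simp add: mult.commute)
    then show ?thesis
      by (simp add: square_integrable_def integrable_mu_iff)
  qed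
  show "square_integrable mu \<phi>" "square_integrable mu (grad \<phi>)"
    using K test_function_C1[OF \<phi>] by (auto intro: *)
qed

lemma test_in_W12:
  assumes "\<phi> \<in> test_functions D"
  shows "\<phi> \<in> sobolev_W12 D w" "AE x in mu. weak_gradient D \<phi> x = grad \<phi> x"
  using W12I[OF has_weak_gradient_test_function[OF assms] test_square_integrable[OF assms]] by auto

lemma W12_0_approx:
  assumes "u \<in> sobolev_W12_0 D w" "\<epsilon> > 0"
  obtains \<phi> where "\<phi> \<in> test_functions D" "sobolev_norm D w (\<lambda>x. u x - \<phi> x) < \<epsilon>"
  using assms by (auto simp: sobolev_W12_0_def)

lemma W12_0_imp_W12: "u \<in> sobolev_W12_0 D w \<Longrightarrow> u \<in> sobolev_W12 D w"
  by (simp add: sobolev_W12_0_def)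

lemma W12_0_lincomb:
  assumes u: "u \<in> sobolev_W12_0 D w" and v: "v \<in> sobolev_W12_0 D w"
  shows "(\<lambda>x. u x + c * v x) \<in> sobolev_W12_0 D w"
  unfolding sobolev_W12_0_def
proof (intro CollectI conjI allI impI)
  note uv = W12_0_imp_W12[OF u] W12_0_imp_W12[OF v]
  show "(\<lambda>x. u x + c * v x) \<in> sobolev_W12 D w"
    by (rule W12_lincomb(1)[OF uv])
  fix \<epsilon> :: real assume "\<epsilon> > 0"
  \<comment> \<open>The summand 1 next to \<open>\<bar>c\<bar>\<close> keeps the second tolerance
    meaningful for \<open>c = 0\<close>.\<close>
  then have e: "\<epsilon> / 2 > 0" "\<epsilon> / (2 * (\<bar>c\<bar> + 1)) > 0"
    by (auto intro!: divide_pos_pos)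
  obtain \<phi> where \<phi>: "\<phi> \<in> test_functions D" "sobolev_norm D w (\<lambda>x. u x - \<phi> x) < \<epsilon> / 2"
    using W12_0_approx[OF u e(1)] .
  obtain \<psi> where \<psi>: "\<psi> \<in> test_functions D" "sobolev_norm D w (\<lambda>x. v x - \<psi> x) < \<epsilon> / (2 * (\<bar>c\<bar> + 1))"
    using W12_0_approx[OF v e(2)] .
  have W: "(\<lambda>x. u x - \<phi> x) \<in> sobolev_W12 D w" "(\<lambda>x. v x - \<psi> x) \<in> sobolev_W12 D w"
    using W12_lincomb(1)[OF uv(1) test_in_W12(1)[OF \<phi>(1)], of "-1"]
      W12_lincomb(1)[OF uv(2) test_in_W12(1)[OF \<psi>(1)], of "-1"] by simp_all
  have "(\<lambda>x. u x + c * v x - (\<phi> x + c * \<psi> x)) = (\<lambda>x. (u x - \<phi> x) + c * (v x - \<psi> x))"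
    by (auto simp: algebra_simps)
  then have "sobolev_norm D w (\<lambda>x. u x + c * v x - (\<phi> x + c * \<psi> x)) \<le>
      sobolev_norm D w (\<lambda>x. u x - \<phi> x) + \<bar>c\<bar> * sobolev_norm D w (\<lambda>x. v x - \<psi> x)"
    using sobolev_norm_triangle[OF W, of c] by simp
  also have "\<bar>c\<bar> * sobolev_norm D w (\<lambda>x. v x - \<psi> x) \<le> (\<bar>c\<bar> + 1) * (\<epsilon> / (2 * (\<bar>c\<bar> + 1)))"
    using \<psi>(2) by (intro mult_mono) (auto simp: sobolev_norm_eq[OF W(2)])
  also have "\<dots> = \<epsilon> / 2"
    by (simp add: field_simps)
  finally have "sobolev_norm D w (\<lambda>x. u x + c * v x - (\<phi> x + c * \<psi> x)) < \<epsilon>"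
    using \<phi>(2) by simp
  then show "\<exists>\<phi>\<in>test_functions D. sobolev_norm D w (\<lambda>x. u x + c * v x - \<phi> x) < \<epsilon>"
    using test_functions_lincomb[OF \<phi>(1) \<psi>(1), of c]
    by (intro bexI[of _ "\<lambda>x. \<phi> x + c * \<psi> x"])
qed

text \<open>A test function approximates itself, but the norm of the difference has to be computed:
  the chosen weak gradient of the zero function is only known to vanish a.e.\<close>

lemma test_in_W12_0:
  assumes \<phi>: "\<phi> \<in> test_functions D"
  shows "\<phi> \<in> sobolev_W12_0 D w"
proof -
  have "(\<lambda>x. \<phi> x + (-1) * \<phi> x) = (\<lambda>_. 0)" "(\<lambda>x. grad \<phi> x + (-1) *\<^sub>R grad \<phi> x) = (\<lambda>_. 0)"
    by auto
  then have z: "has_weak_gradient D (\<lambda>_. 0) (\<lambda>_. 0)"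
    using has_weak_gradient_lincomb[OF has_weak_gradient_test_function[OF \<phi>] has_weak_gradient_test_function[OF \<phi>], of "-1"]
    by simp
  have sq: "square_integrable mu (\<lambda>_. 0 :: real)" "square_integrable mu (\<lambda>_. 0 :: 'a)"
    by (auto simp: square_integrable_def)
  have "sobolev_norm D w (\<lambda>_. 0) = 0"
    unfolding sobolev_norm_eq[OF W12I(1)[OF z sq]] L2_norm_weak_gradient_cong[OF z sq]
    by (simp add: L2_norm_def)
  then have "sobolev_norm D w (\<lambda>x. \<phi> x - \<phi> x) < \<epsilon>" if "\<epsilon> > 0" for \<epsilon>
    using that by simp
  then show ?thesis
    using test_in_W12(1)[OF \<phi>] \<phi> unfolding sobolev_W12_0_def by blast
qed

lemma
  assumes \<phi>: "\<phi> \<in> test_functions D"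
  shows Poincare_test_L2: "L2_norm mu \<phi> \<le> C * L2_norm mu (weak_gradient D \<phi>)"
    and Sobolev_test_square: "square_integrable (lebesgue_on D) \<phi>"
    and Sobolev_test_L2: "L2_norm (lebesgue_on D) \<phi> \<le> C * L2_norm mu (weak_gradient D \<phi>)"
proof -
  obtain K where K: "compact K" "K \<subseteq> D" "\<And>x. x \<notin> K \<Longrightarrow> \<phi> x = 0" "\<And>x. x \<notin> K \<Longrightarrow> grad \<phi> x = 0"
    using test_function_support[OF \<phi>] by metis
  note sq = test_square_integrable[OF \<phi>]
  have m: "\<phi> \<in> borel_measurable (lebesgue_on D)" "grad \<phi> \<in> borel_measurable (lebesgue_on D)"
    using sq[THEN square_integrable_measurable] by simp_all
  have E: "L2_norm mu (weak_gradient D \<phi>) = L2_norm mu (grad \<phi>)"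
    by (rule L2_norm_weak_gradient_cong[OF has_weak_gradient_test_function[OF \<phi>] sq])
  have "ennreal (C\<^sup>2) * (\<integral>\<^sup>+x. ennreal ((norm (grad \<phi> x))\<^sup>2 * w x) \<partial>lebesgue) =
      ennreal (C\<^sup>2) * (\<integral>\<^sup>+x. ennreal ((norm (grad \<phi> x))\<^sup>2) \<partial>mu)"
    using K m by (subst nn_integral_mu_eq) auto
  also have "\<dots> = ennreal ((C * L2_norm mu (grad \<phi>))\<^sup>2)"
    by (simp add: L2_nn_integral[OF sq(2)] power_mult_distrib ennreal_mult)
  finally have R: "ennreal (C\<^sup>2) * (\<integral>\<^sup>+x. ennreal ((norm (grad \<phi> x))\<^sup>2 * w x) \<partial>lebesgue) =
      ennreal ((C * L2_norm mu (grad \<phi>))\<^sup>2)" .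
  have c: "0 \<le> C * L2_norm mu (grad \<phi>)"
    using C_nonneg by simp
  have "(\<integral>\<^sup>+x. ennreal ((norm (\<phi> x))\<^sup>2) \<partial>mu) \<le> ennreal ((C * L2_norm mu (grad \<phi>))\<^sup>2)"
    using Poincare_test[OF \<phi>] K m unfolding R by (subst nn_integral_mu_eq) auto
  from square_integrableI_nn(2)[OF _ this c] show "L2_norm mu \<phi> \<le> C * L2_norm mu (weak_gradient D \<phi>)"
    using m E by simp
  have "(\<integral>\<^sup>+x. ennreal ((norm (\<phi> x))\<^sup>2) \<partial>lebesgue_on D) \<le> ennreal ((C * L2_norm mu (grad \<phi>))\<^sup>2)"
    using Sobolev_test[OF \<phi>] K m unfolding R by (subst nn_integral_on_D_eq) auto
  from square_integrableI_nn[OF _ this c] show "square_integrable (lebesgue_on D) \<phi>"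
      "L2_norm (lebesgue_on D) \<phi> \<le> C * L2_norm mu (weak_gradient D \<phi>)"
    using m E by simp_all
qed

lemma W12_0_sequence:
  assumes u: "u \<in> sobolev_W12_0 D w"
  shows "\<exists>\<phi>. \<forall>k. \<phi> k \<in> test_functions D \<and>
    L2_norm mu (\<lambda>x. \<phi> k x - u x) \<le> 1 / real (Suc k) \<and>
    L2_norm mu (weak_gradient D (\<phi> k)) \<le> L2_norm mu (weak_gradient D u) + 1 / real (Suc k)"
proof -
  note uW = W12_0_imp_W12[OF u]
  have "\<exists>\<phi>. \<forall>k. \<phi> k \<in> test_functions D \<and> sobolev_norm D w (\<lambda>x. u x - \<phi> k x) < 1 / real (Suc k)"
    using W12_0_approx[OF u] by (intro choice allI) (metis of_nat_0_less_iff zero_less_Suc zero_less_divide_1_iff)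
  then obtain \<phi> where \<phi>: "\<And>k. \<phi> k \<in> test_functions D" "\<And>k. sobolev_norm D w (\<lambda>x. u x - \<phi> k x) < 1 / real (Suc k)"
    by blast
  note \<phi>W = test_in_W12(1)[OF \<phi>(1)]
  have W: "(\<lambda>x. u x - \<phi> k x) \<in> sobolev_W12 D w" for k
    using W12_lincomb(1)[OF uW \<phi>W[of k], of "-1"] by simp
  have *: "L2_norm mu (\<lambda>x. u x - \<phi> k x) + L2_norm mu (weak_gradient D (\<lambda>x. u x - \<phi> k x)) < 1 / real (Suc k)" for k
    using \<phi>(2)[of k] unfolding sobolev_norm_eq[OF W] .
  have eq: "L2_norm mu (weak_gradient D (\<lambda>x. u x - \<phi> k x)) = L2_norm mu (\<lambda>x. weak_gradient D u x - weak_gradient D (\<phi> k) x)" for k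
    using L2_norm_weak_gradient_lincomb[OF uW \<phi>W[of k], of "-1"] by simp
  show ?thesis
  proof (intro exI[of _ \<phi>] allI conjI)
    fix k
    show "\<phi> k \<in> test_functions D" by (rule \<phi>)
    have "L2_norm mu (\<lambda>x. \<phi> k x - u x) = L2_norm mu (\<lambda>x. u x - \<phi> k x)"
      by (simp add: L2_norm_def power2_commute)
    then show "L2_norm mu (\<lambda>x. \<phi> k x - u x) \<le> 1 / real (Suc k)"
      using *[of k] L2_norm_nonneg[of mu "weak_gradient D (\<lambda>x. u x - \<phi> k x)"] by linarith
    have le: "L2_norm mu (\<lambda>x. weak_gradient D u x - weak_gradient D (\<phi> k) x) \<le> 1 / real (Suc k)"
      using *[of k] L2_norm_nonneg[of mu "\<lambda>x. u x - \<phi> k x"] unfolding eq by linarith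
    have "L2_norm mu (weak_gradient D (\<phi> k)) \<le> L2_norm mu (weak_gradient D u) +
        L2_norm mu (\<lambda>x. weak_gradient D (\<phi> k) x - weak_gradient D u x)"
      by (rule L2_norm_triangle_diff[OF W12D(3)[OF \<phi>W] W12D(3)[OF uW]])
    also have "L2_norm mu (\<lambda>x. weak_gradient D (\<phi> k) x - weak_gradient D u x) \<le> 1 / real (Suc k)"
      using le by (simp add: L2_norm_def norm_minus_commute)
    finally show "L2_norm mu (weak_gradient D (\<phi> k)) \<le> L2_norm mu (weak_gradient D u) + 1 / real (Suc k)"
      by simp
  qed
qed

text \<open>Approximating test functions converge to \<open>u\<close> in the weighted L2 space,
  hence a.e. along a subsequence, and Fatou's lemma without weight carries the Sobolev inequality
  over. Using only the tail from \<open>N\<close> on leaves an error 1/(N+1), which disappears as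
  \<open>N\<close> grows.\<close>

lemma
  assumes u: "u \<in> sobolev_W12_0 D w"
  shows Sobolev_square: "square_integrable (lebesgue_on D) u"
    and Sobolev_L2: "L2_norm (lebesgue_on D) u \<le> C * L2_norm mu (weak_gradient D u)"
proof -
  note uW = W12_0_imp_W12[OF u]
  let ?E = "L2_norm mu (weak_gradient D u)"
  obtain \<phi> where all: "\<forall>k. \<phi> k \<in> test_functions D \<and> L2_norm mu (\<lambda>x. \<phi> k x - u x) \<le> 1 / real (Suc k) \<and>
      L2_norm mu (weak_gradient D (\<phi> k)) \<le> ?E + 1 / real (Suc k)"
    using W12_0_sequence[OF u] by (elim exE)
  have \<phi>: "\<phi> k \<in> test_functions D" "L2_norm mu (\<lambda>x. \<phi> k x - u x) \<le> 1 / real (Suc k)"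
    "L2_norm mu (weak_gradient D (\<phi> k)) \<le> ?E + 1 / real (Suc k)" for k
    by (rule conjunct1[OF spec[OF all]], rule conjunct1[OF conjunct2[OF spec[OF all]]],
        rule conjunct2[OF conjunct2[OF spec[OF all]]])
  have lim: "(\<lambda>k. L2_norm mu (\<lambda>x. \<phi> k x - u x)) \<longlonglongrightarrow> 0"
  proof (rule tendsto_sandwich[OF _ _ tendsto_const LIMSEQ_Suc[OF lim_1_over_n]])
    show "\<forall>\<^sub>F k in sequentially. L2_norm mu (\<lambda>x. \<phi> k x - u x) \<le> 1 / real (Suc k)"
      by (intro always_eventually allI \<phi>(2))
  qed simp
  obtain r where r: "strict_mono r" "AE x in mu. (\<lambda>k. \<phi> (r k) x) \<longlonglongrightarrow> u x"
    using L2_tendsto_AE_subseq[OF test_square_integrable(1)[OF \<phi>(1)] W12D(2)[OF uW] lim] .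
  have AE: "AE x in lebesgue_on D. (\<lambda>k. \<phi> (r k) x) \<longlonglongrightarrow> u x"
    using r(2) by (simp add: AE_mu_iff_AE_on_D)
  have um: "u \<in> borel_measurable (lebesgue_on D)"
    using square_integrable_measurable[OF W12D(2)[OF uW]] by simp
  have bound: "L2_norm (lebesgue_on D) (\<phi> (r k)) \<le> C * (?E + 1 / real (Suc N))" if "k \<ge> N" for k N
  proof -
    have "L2_norm (lebesgue_on D) (\<phi> (r k)) \<le> C * L2_norm mu (weak_gradient D (\<phi> (r k)))"
      by (rule Sobolev_test_L2[OF \<phi>(1)])
    also have "\<dots> \<le> C * (?E + 1 / real (Suc N))"
    proof (intro mult_left_mono C_nonneg)
      have "1 / real (Suc (r k)) \<le> 1 / real (Suc N)"
        using that seq_suble[OF r(1), of k] by (intro divide_left_mono) auto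
      then show "L2_norm mu (weak_gradient D (\<phi> (r k))) \<le> ?E + 1 / real (Suc N)"
        using \<phi>(3)[of "r k"] by linarith
    qed
    finally show ?thesis .
  qed
  show "square_integrable (lebesgue_on D) u"
    by (rule L2_Fatou(1)[OF Sobolev_test_square[OF \<phi>(1)] um AE bound[of 0]])
  have "L2_norm (lebesgue_on D) u \<le> C * (?E + 1 / real (Suc N))" for N
    by (rule L2_Fatou(2)[OF Sobolev_test_square[OF \<phi>(1)] um AE bound[of N]])
  moreover have "(\<lambda>N. C * (?E + 1 / real (Suc N))) \<longlonglongrightarrow> C * (?E + 0)"
    by (intro tendsto_intros LIMSEQ_Suc[OF lim_1_over_n])
  ultimately show "L2_norm (lebesgue_on D) u \<le> C * ?E"
    by (intro LIMSEQ_le_const[of "\<lambda>N. C * (?E + 1 / real (Suc N))" "C * ?E"]) auto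
qed

text \<open>The square root of the integral of 1/w over \<open>D\<close>, since one of the two
  factors 1/w cancels against the density of \<open>mu\<close>.\<close>

definition inverse_weight_norm :: real where
  "inverse_weight_norm = L2_norm mu (\<lambda>x. 1 / w x)"

text \<open>Cauchy-Schwarz in \<open>mu\<close> for the factors 1/w and |h|, whose product against
  the density w is |h| a.e. This makes elements of the weighted space locally summable and lets
  unweighted integrals against bounded functions pass to the limit.\<close>

lemma L1_embedding:
  fixes h :: "'a \<Rightarrow> 'b::euclidean_space"
  assumes h: "square_integrable mu h"
  shows "integrable (lebesgue_on D) h"
    "(LINT x|lebesgue_on D. norm (h x)) \<le> inverse_weight_norm * L2_norm mu h"
proof -
  have hm [measurable]: "h \<in> borel_measurable (lebesgue_on D)"
    using square_integrable_measurable[OF h] by simp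
  have inv: "square_integrable mu (\<lambda>x. 1 / w x)"
  proof -
    have "(norm (1 / w x))\<^sup>2 * w x = 1 / w x" for x
      by (simp add: power2_eq_square)
    then show ?thesis
      using inverse_w_integrable by (simp add: square_integrable_def integrable_mu_iff)
  qed
  have nh: "square_integrable mu (\<lambda>x. norm (h x))"
    using h by (simp add: square_integrable_def)
  have AE: "AE x in lebesgue_on D. (1 / w x * norm (h x)) * w x = norm (h x)"
    unfolding AE_on_D using w_pos by eventually_elim auto
  have "integrable mu (\<lambda>x. 1 / w x * norm (h x))"
    using square_integrable_inner[OF inv nh] by simp
  then have "integrable (lebesgue_on D) (\<lambda>x. (1 / w x * norm (h x)) * w x)"
    by (simp add: integrable_mu_iff set_integrable_iff_on_D)
  then have "integrable (lebesgue_on D) (\<lambda>x. norm (h x))"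
    using AE by (subst (asm) integrable_cong_AE[of _ _ "\<lambda>x. norm (h x)"]) auto
  then show "integrable (lebesgue_on D) h"
    by (simp add: integrable_norm_iff)
  have "(LINT x|lebesgue_on D. norm (h x)) = (LINT x|lebesgue_on D. (1 / w x * norm (h x)) * w x)"
    using AE by (intro integral_cong_AE) auto
  also have "\<dots> = L2_inner mu (\<lambda>x. 1 / w x) (\<lambda>x. norm (h x))"
    by (simp add: L2_inner_def integral_mu_eq set_integral_eq_on_D)
  also have "\<dots> \<le> inverse_weight_norm * L2_norm mu (\<lambda>x. norm (h x))"
    using L2_Cauchy_Schwarz[OF inv nh] by (simp add: inverse_weight_norm_def)
  also have "L2_norm mu (\<lambda>x. norm (h x)) = L2_norm mu h"
    by (simp add: L2_norm_def)
  finally show "(LINT x|lebesgue_on D. norm (h x)) \<le> inverse_weight_norm * L2_norm mu h" .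
qed

lemma square_integrable_locally_summable:
  fixes h :: "'a \<Rightarrow> 'b::euclidean_space"
  assumes "square_integrable mu h"
  shows "locally_summable D h"
  unfolding locally_summable_def
proof safe
  fix K assume K: "compact K" "K \<subseteq> D"
  have "set_integrable lebesgue D h"
    using L1_embedding(1)[OF assms] unfolding set_integrable_def by (subst (asm) integrable_restrict_space) auto
  then show "set_integrable lebesgue K h"
    using K by (rule_tac set_integrable_subset) (auto dest: compact_imp_closed)
qed

lemma tendsto_integral_test:
  fixes h :: "nat \<Rightarrow> 'a \<Rightarrow> real"
  assumes h: "\<And>k. square_integrable mu (h k)" "square_integrable mu g"
    and lim: "(\<lambda>k. L2_norm mu (\<lambda>x. h k x - g x)) \<longlonglongrightarrow> 0"
    and p: "continuous_on UNIV p" "\<And>x. \<bar>p x\<bar> \<le> B"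
  shows "(\<lambda>k. LINT x:D|lebesgue. h k x * p x) \<longlonglongrightarrow> (LINT x:D|lebesgue. g x * p x)"
proof -
  have "p \<in> borel_measurable lebesgue"
    using borel_measurable_continuous_onI[OF p(1)] by (auto intro: measurable_completion)
  then have pm [measurable]: "p \<in> borel_measurable (lebesgue_on D)"
    by (rule measurable_restrict_space1)
  have int: "integrable (lebesgue_on D) (\<lambda>x. q x * p x)" if "square_integrable mu q" for q :: "'a \<Rightarrow> real"
  proof (rule Bochner_Integration.integrable_bound)
    show "integrable (lebesgue_on D) (\<lambda>x. B * q x)"
      using L1_embedding(1)[OF that] by simp
    show "(\<lambda>x. q x * p x) \<in> borel_measurable (lebesgue_on D)"
      using L1_embedding(1)[OF that] by measurable
    show "AE x in lebesgue_on D. norm (q x * p x) \<le> norm (B * q x)"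
    proof (rule AE_I2)
      fix x
      have "\<bar>q x\<bar> * \<bar>p x\<bar> \<le> \<bar>q x\<bar> * \<bar>B\<bar>"
        using p(2)[of x] by (intro mult_left_mono) auto
      then show "norm (q x * p x) \<le> norm (B * q x)"
        by (simp add: abs_mult mult.commute)
    qed
  qed
  have B: "0 \<le> B"
    using p(2)[of undefined] by linarith
  have le: "\<bar>(LINT x:D|lebesgue. h k x * p x) - (LINT x:D|lebesgue. g x * p x)\<bar> \<le>
      B * inverse_weight_norm * L2_norm mu (\<lambda>x. h k x - g x)" for k
  proof -
    note d = square_integrable_diff[OF h(1)[of k] h(2)]
    have "(LINT x:D|lebesgue. h k x * p x) - (LINT x:D|lebesgue. g x * p x) =
        (LINT x|lebesgue_on D. (h k x - g x) * p x)"
      unfolding set_integral_eq_on_D using int[OF h(1)[of k]] int[OF h(2)] by (simp add: left_diff_distrib)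
    also have "\<bar>\<dots>\<bar> \<le> (LINT x|lebesgue_on D. \<bar>(h k x - g x) * p x\<bar>)"
      by (rule integral_abs_bound)
    also have "\<dots> \<le> (LINT x|lebesgue_on D. B * \<bar>h k x - g x\<bar>)"
    proof (rule integral_mono)
      show "integrable (lebesgue_on D) (\<lambda>x. \<bar>(h k x - g x) * p x\<bar>)"
        using int[OF d] by (rule integrable_abs)
      show "integrable (lebesgue_on D) (\<lambda>x. B * \<bar>h k x - g x\<bar>)"
        using L1_embedding(1)[OF d] by simp
      show "\<bar>(h k x - g x) * p x\<bar> \<le> B * \<bar>h k x - g x\<bar>" for x
        using mult_left_mono[OF p(2)[of x], of "\<bar>h k x - g x\<bar>"] by (simp add: abs_mult mult.commute)
    qed
    also have "\<dots> \<le> B * (inverse_weight_norm * L2_norm mu (\<lambda>x. h k x - g x))"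
      using L1_embedding(2)[OF d] B by (simp add: mult_left_mono)
    finally show ?thesis by (simp add: mult.assoc)
  qed
  have "(\<lambda>k. B * inverse_weight_norm * L2_norm mu (\<lambda>x. h k x - g x)) \<longlonglongrightarrow> B * inverse_weight_norm * 0"
    by (intro tendsto_intros lim)
  then have lim0: "(\<lambda>k. B * inverse_weight_norm * L2_norm mu (\<lambda>x. h k x - g x)) \<longlonglongrightarrow> 0"
    by simp
  have "(\<lambda>k. (LINT x:D|lebesgue. h k x * p x) - (LINT x:D|lebesgue. g x * p x)) \<longlonglongrightarrow> 0"
  proof (rule Lim_null_comparison[OF _ lim0])
    show "\<forall>\<^sub>F k in sequentially. norm ((LINT x:D|lebesgue. h k x * p x) - (LINT x:D|lebesgue. g x * p x)) \<le>
        B * inverse_weight_norm * L2_norm mu (\<lambda>x. h k x - g x)"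
      unfolding real_norm_def by (intro always_eventually allI le)
  qed
  then show ?thesis
    by (rule LIM_zero_cancel)
qed

text \<open>The weak gradient is a closed operator in the weighted L2 space: a test function and its
  gradient are bounded, so both sides of the defining identity converge by the L1 embedding. This is
  what makes the Sobolev space complete.\<close>

lemma has_weak_gradient_limit:
  assumes \<phi>: "\<And>k. has_weak_gradient D (\<phi> k) (H k)" "\<And>k. square_integrable mu (\<phi> k)" "\<And>k. square_integrable mu (H k)"
    and u: "square_integrable mu u" "(\<lambda>k. L2_norm mu (\<lambda>x. \<phi> k x - u x)) \<longlonglongrightarrow> 0"
    and G: "square_integrable mu G" "(\<lambda>k. L2_norm mu (\<lambda>x. H k x - G x)) \<longlonglongrightarrow> 0"
  shows "has_weak_gradient D u G"
  unfolding has_weak_gradient_def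
proof (intro conjI ballI)
  show "locally_summable D u" "locally_summable D G"
    using u G by (auto intro: square_integrable_locally_summable)
  fix \<psi> :: "'a \<Rightarrow> real" and b :: 'a assume \<psi>: "\<psi> \<in> test_functions D" and b: "b \<in> Basis"
  obtain B where B: "\<And>x. \<bar>\<psi> x\<bar> \<le> B" "\<And>x. norm (grad \<psi> x) \<le> B"
    using test_function_bounded[OF \<psi>] by metis
  have sqb: "square_integrable mu (\<lambda>x. F x \<bullet> b)" "L2_norm mu (\<lambda>x. F x \<bullet> b) \<le> L2_norm mu F"
    if F: "square_integrable mu F" for F :: "'a \<Rightarrow> 'a"
  proof -
    have [measurable]: "F \<in> borel_measurable (lebesgue_on D)"
      using square_integrable_measurable[OF F] by simp
    have "(\<integral>\<^sup>+x. ennreal ((norm (F x \<bullet> b))\<^sup>2) \<partial>mu) \<le> (\<integral>\<^sup>+x. ennreal ((norm (F x))\<^sup>2) \<partial>mu)"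
      using b by (intro nn_integral_mono ennreal_leI power_mono) (auto simp: Basis_le_norm)
    also have "\<dots> = ennreal ((L2_norm mu F)\<^sup>2)"
      by (rule L2_nn_integral[OF F])
    finally show "square_integrable mu (\<lambda>x. F x \<bullet> b)" "L2_norm mu (\<lambda>x. F x \<bullet> b) \<le> L2_norm mu F"
      using square_integrableI_nn[of "\<lambda>x. F x \<bullet> b" mu] by auto
  qed
  have "(\<lambda>k. LINT x:D|lebesgue. \<phi> k x * (grad \<psi> x \<bullet> b)) \<longlonglongrightarrow> (LINT x:D|lebesgue. u x * (grad \<psi> x \<bullet> b))"
  proof (rule tendsto_integral_test[OF \<phi>(2) u])
    show "continuous_on UNIV (\<lambda>x. grad \<psi> x \<bullet> b)"
      using test_function_C1[OF \<psi>] by (intro continuous_intros)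
    show "\<bar>grad \<psi> x \<bullet> b\<bar> \<le> B" for x
      using Basis_le_norm[OF b, of "grad \<psi> x"] B(2)[of x] by linarith
  qed
  moreover have "(\<lambda>k. LINT x:D|lebesgue. (H k x \<bullet> b) * \<psi> x) \<longlonglongrightarrow> (LINT x:D|lebesgue. (G x \<bullet> b) * \<psi> x)"
  proof (rule tendsto_integral_test)
    show "(\<lambda>k. L2_norm mu (\<lambda>x. H k x \<bullet> b - G x \<bullet> b)) \<longlonglongrightarrow> 0"
    proof (rule Lim_null_comparison[OF _ G(2)], rule always_eventually, rule allI)
      show "norm (L2_norm mu (\<lambda>x. H k x \<bullet> b - G x \<bullet> b)) \<le> L2_norm mu (\<lambda>x. H k x - G x)" for k
        using sqb(2)[OF square_integrable_diff[OF \<phi>(3) G(1)], of k] by (simp add: inner_diff_left)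
    qed
  qed (use sqb \<phi> G B test_function_C1[OF \<psi>] in auto)
  moreover have "(LINT x:D|lebesgue. \<phi> k x * (grad \<psi> x \<bullet> b)) = - (LINT x:D|lebesgue. (H k x \<bullet> b) * \<psi> x)" for k
    using \<phi>(1)[of k] \<psi> b by (simp add: has_weak_gradient_def grad_inner_Basis)
  ultimately have "(LINT x:D|lebesgue. u x * (grad \<psi> x \<bullet> b)) = - (LINT x:D|lebesgue. (G x \<bullet> b) * \<psi> x)"
    by (auto dest: tendsto_minus intro: LIMSEQ_unique)
  then show "(LINT x:D|lebesgue. u x * frechet_derivative \<psi> (at x) b) = - (LINT x:D|lebesgue. (G x \<bullet> b) * \<psi> x)"
    by (simp add: grad_inner_Basis b)
qed

end

section \<open>The Dirichlet problem\<close>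

lemma L2_inner_commute: "L2_inner M f g = L2_inner M g f"
  by (simp add: L2_inner_def inner_commute)

lemma L2_inner_self: "L2_inner M f f = (L2_norm M f)\<^sup>2"
  by (simp add: L2_inner_def L2_norm_power2 power2_norm_eq_inner)

lemma L2_inner_lincomb_right:
  assumes "square_integrable M h" "square_integrable M f" "square_integrable M g"
  shows "L2_inner M h (\<lambda>x. f x + c *\<^sub>R g x) = L2_inner M h f + c * L2_inner M h g"
  using square_integrable_inner[OF assms(1,2)] square_integrable_inner[OF assms(1,3)]
  by (simp add: L2_inner_def inner_add_right)

context weighted_domain
begin

abbreviation energy_norm :: "('a \<Rightarrow> real) \<Rightarrow> real" where
  "energy_norm u \<equiv> L2_norm mu (weak_gradient D u)"

abbreviation energy :: "('a \<Rightarrow> real) \<Rightarrow> ('a \<Rightarrow> real) \<Rightarrow> real" where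
  "energy u v \<equiv> L2_inner mu (weak_gradient D u) (weak_gradient D v)"

lemma L2_onD:
  assumes "f \<in> L2_on D"
  shows "square_integrable (lebesgue_on D) f"
proof -
  have "f \<in> borel_measurable (lebesgue_on D)"
    using assms by (subst borel_measurable_restrict_space_iff) (auto simp: L2_on_def set_borel_measurable_def)
  then show ?thesis
    using assms by (simp add: square_integrable_def L2_on_def set_integrable_iff_on_D)
qed

lemma load_bound:
  assumes f: "square_integrable (lebesgue_on D) f" and v: "v \<in> sobolev_W12_0 D w"
  shows "\<bar>L2_inner (lebesgue_on D) f v\<bar> \<le> L2_norm (lebesgue_on D) f * C * energy_norm v"
proof -
  have "\<bar>L2_inner (lebesgue_on D) f v\<bar> \<le> L2_norm (lebesgue_on D) f * L2_norm (lebesgue_on D) v"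
    by (rule L2_Cauchy_Schwarz[OF f Sobolev_square[OF v]])
  also have "\<dots> \<le> L2_norm (lebesgue_on D) f * (C * energy_norm v)"
    by (intro mult_left_mono Sobolev_L2 v) simp
  finally show ?thesis by (simp add: mult.assoc)
qed

lemma load_lincomb:
  assumes "square_integrable (lebesgue_on D) f" "u \<in> sobolev_W12_0 D w" "v \<in> sobolev_W12_0 D w"
  shows "L2_inner (lebesgue_on D) f (\<lambda>x. u x + c * v x) =
    L2_inner (lebesgue_on D) f u + c * L2_inner (lebesgue_on D) f v"
  using L2_inner_lincomb_right[OF assms(1) Sobolev_square[OF assms(2)] Sobolev_square[OF assms(3)], of c] by simp

lemma energy_lincomb:
  assumes "u \<in> sobolev_W12 D w" "v \<in> sobolev_W12 D w" "z \<in> sobolev_W12 D w"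
  shows "energy z (\<lambda>x. u x + c * v x) = energy z u + c * energy z v"
  using L2_inner_weak_gradient_lincomb[OF assms] by (simp add: L2_inner_commute)

text \<open>The equation div(w grad u) = f has no minus sign, hence the plus sign here and in
  \<open>dirichlet_functional\<close>. The residual is half the derivative of that functional at
  \<open>u\<close> in direction \<open>v\<close>, as \<open>dirichlet_functional_expand\<close>
  shows.\<close>

definition residual :: "('a \<Rightarrow> real) \<Rightarrow> ('a \<Rightarrow> real) \<Rightarrow> ('a \<Rightarrow> real) \<Rightarrow> real" where
  "residual f u v = energy u v + L2_inner (lebesgue_on D) f v"

definition dirichlet_functional :: "('a \<Rightarrow> real) \<Rightarrow> ('a \<Rightarrow> real) \<Rightarrow> real" where
  "dirichlet_functional f u = (energy_norm u)\<^sup>2 + 2 * L2_inner (lebesgue_on D) f u"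

text \<open>The integrability of the product of \<open>f\<close> with a competitor is automatic,
  because the Sobolev inequality puts every competitor into the unweighted L2 space.\<close>

lemma dirichlet_weak_solution_iff:
  assumes "f \<in> L2_on D"
  shows "dirichlet_weak_solution D w f u \<longleftrightarrow>
    u \<in> sobolev_W12_0 D w \<and> (\<forall>v\<in>sobolev_W12_0 D w. residual f u v = 0)"
proof -
  have "set_integrable lebesgue D (\<lambda>x. f x * v x) \<and>
      energy_inner D w u v = energy u v \<and>
      (LINT x:D|lebesgue. f x * v x) = L2_inner (lebesgue_on D) f v"
    if "u \<in> sobolev_W12_0 D w" "v \<in> sobolev_W12_0 D w" for v
    using square_integrable_inner[OF L2_onD[OF assms] Sobolev_square[OF that(2)]]
      energy_inner_eq[OF that[THEN W12_0_imp_W12]]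
    by (simp add: set_integrable_iff_on_D set_integral_eq_on_D L2_inner_def)
  then show ?thesis
    by (auto simp: dirichlet_weak_solution_def residual_def)
qed

lemma residual_bound:
  assumes f: "square_integrable (lebesgue_on D) f"
    and u: "u \<in> sobolev_W12_0 D w" and v: "v \<in> sobolev_W12_0 D w"
  shows "\<bar>residual f u v\<bar> \<le> (energy_norm u + L2_norm (lebesgue_on D) f * C) * energy_norm v"
proof -
  have "\<bar>energy u v\<bar> \<le> energy_norm u * energy_norm v"
    using u v by (intro L2_Cauchy_Schwarz W12D W12_0_imp_W12)
  then show ?thesis
    using load_bound[OF f v] by (simp add: residual_def algebra_simps)
qed

lemma residual_lincomb:
  assumes f: "square_integrable (lebesgue_on D) f"
    and u: "u \<in> sobolev_W12_0 D w" and v: "v \<in> sobolev_W12_0 D w" and z: "z \<in> sobolev_W12_0 D w"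
  shows "residual f u (\<lambda>x. v x + c * z x) = residual f u v + c * residual f u z"
  unfolding residual_def load_lincomb[OF f v z]
    energy_lincomb[OF W12_0_imp_W12[OF v] W12_0_imp_W12[OF z] W12_0_imp_W12[OF u]]
  by (simp add: algebra_simps)

lemma dirichlet_functional_expand:
  assumes f: "square_integrable (lebesgue_on D) f"
    and u: "u \<in> sobolev_W12_0 D w" and v: "v \<in> sobolev_W12_0 D w"
  shows "dirichlet_functional f (\<lambda>x. u x + t * v x) =
    dirichlet_functional f u + 2 * t * residual f u v + t\<^sup>2 * (energy_norm v)\<^sup>2"
  unfolding dirichlet_functional_def residual_def load_lincomb[OF f u v]
    L2_norm_weak_gradient_lincomb[OF W12_0_imp_W12[OF u] W12_0_imp_W12[OF v]]
    L2_norm_lincomb[OF W12D(3)[OF W12_0_imp_W12[OF u]] W12D(3)[OF W12_0_imp_W12[OF v]]]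
  by (simp add: algebra_simps)

text \<open>\<open>load_bound\<close> makes the linear term at most a multiple of the energy norm,
  and completing the square does the rest. The infimum over test functions is therefore
  finite.\<close>

lemma dirichlet_functional_lower_bound:
  assumes f: "square_integrable (lebesgue_on D) f" and u: "u \<in> sobolev_W12_0 D w"
  shows "- (L2_norm (lebesgue_on D) f * C)\<^sup>2 \<le> dirichlet_functional f u"
proof -
  have "0 \<le> (energy_norm u - L2_norm (lebesgue_on D) f * C)\<^sup>2" by simp
  then show ?thesis
    using load_bound[OF f u] by (simp add: dirichlet_functional_def power2_diff algebra_simps)
qed

lemma test_functions_nonempty: "test_functions D \<noteq> {}"
proof -
  \<comment> \<open>With the corners reversed the box is empty and lies in any \<open>D\<close>; its
    bump is the zero function.\<close>
  have "cbox One (0::'a) = {}"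
    using SOME_Basis[where 'a = 'a] by (auto simp: box_eq_empty)
  then show ?thesis
    using box_bump_test_function[of One 0 D 0] by auto
qed

lemma minimizing_sequence:
  assumes f: "square_integrable (lebesgue_on D) f"
  obtains \<phi> where "\<And>k. \<phi> k \<in> test_functions D"
    "\<And>k \<psi>. \<psi> \<in> test_functions D \<Longrightarrow>
      dirichlet_functional f (\<phi> k) \<le> dirichlet_functional f \<psi> + 1 / real (Suc k)"
proof -
  let ?J = "dirichlet_functional f"
  have bdd: "bdd_below (?J ` test_functions D)"
    using dirichlet_functional_lower_bound[OF f test_in_W12_0] by (intro bdd_belowI2)
  have "\<exists>\<phi>\<in>test_functions D. ?J \<phi> < Inf (?J ` test_functions D) + 1 / real (Suc k)" for k
    using cInf_lessD[of "?J ` test_functions D" "Inf (?J ` test_functions D) + 1 / real (Suc k)"]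
      test_functions_nonempty by auto
  then obtain \<phi> where \<phi>: "\<And>k. \<phi> k \<in> test_functions D"
      "\<And>k. ?J (\<phi> k) < Inf (?J ` test_functions D) + 1 / real (Suc k)"
    by metis
  have "?J (\<phi> k) \<le> ?J \<psi> + 1 / real (Suc k)" if "\<psi> \<in> test_functions D" for k \<psi>
    using \<phi>(2)[of k] cInf_lower[OF imageI[OF that] bdd] by linarith
  then show ?thesis using \<phi>(1) that by blast
qed

text \<open>The parallelogram identity turns almost minimality into closeness in the energy norm.\<close>

lemma near_minimizers_close:
  assumes f: "square_integrable (lebesgue_on D) f"
    and \<phi>: "\<phi> \<in> test_functions D" and \<psi>: "\<psi> \<in> test_functions D"
    and a: "\<And>\<eta>. \<eta> \<in> test_functions D \<Longrightarrow> dirichlet_functional f \<phi> \<le> dirichlet_functional f \<eta> + a"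
    and b: "\<And>\<eta>. \<eta> \<in> test_functions D \<Longrightarrow> dirichlet_functional f \<psi> \<le> dirichlet_functional f \<eta> + b"
  shows "(energy_norm (\<lambda>x. \<psi> x + (-1) * \<phi> x))\<^sup>2 \<le> 2 * (a + b)"
proof -
  let ?d = "\<lambda>x. \<psi> x + (-1) * \<phi> x"
  have d: "?d \<in> test_functions D"
    by (rule test_functions_lincomb[OF \<psi> \<phi>])
  have m: "(\<lambda>x. \<phi> x + (1 / 2) * ?d x) \<in> test_functions D"
    by (rule test_functions_lincomb[OF \<phi> d])
  note e = dirichlet_functional_expand[OF f test_in_W12_0[OF \<phi>] test_in_W12_0[OF d]]
  have "dirichlet_functional f \<psi> = dirichlet_functional f (\<lambda>x. \<phi> x + 1 * ?d x)"
    by simp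
  \<comment> \<open>The expansion from \<phi> is used at t = 1, which is \<psi>, and at t = 1/2, the
    midpoint. In the sum of the end values minus twice the midpoint value the linear terms cancel
    and half the squared energy distance remains.\<close>
  then show ?thesis
    using e[of 1] e[of "1 / 2"] a[OF m] b[OF m] by (simp add: power_divide)
qed

lemma weak_solution_exists:
  assumes f: "f \<in> L2_on D"
  obtains u where "dirichlet_weak_solution D w f u"
proof -
  note sf = L2_onD[OF f]
  obtain \<phi> where \<phi>: "\<And>k. \<phi> k \<in> test_functions D"
    and min: "\<And>k \<psi>. \<psi> \<in> test_functions D \<Longrightarrow>
      dirichlet_functional f (\<phi> k) \<le> dirichlet_functional f \<psi> + 1 / real (Suc k)"
    using minimizing_sequence[OF sf] by blast
  note \<phi>W = test_in_W12(1)[OF \<phi>]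
  have close: "energy_norm (\<lambda>x. \<phi> m x + (-1) * \<phi> n x) \<le> sqrt (4 / real (Suc N))" if "m \<ge> N" "n \<ge> N" for m n N
  proof (rule real_le_rsqrt)
    have "(energy_norm (\<lambda>x. \<phi> m x + (-1) * \<phi> n x))\<^sup>2 \<le> 2 * (1 / real (Suc n) + 1 / real (Suc m))"
      by (rule near_minimizers_close[OF sf \<phi> \<phi> min min])
    also have "\<dots> \<le> 2 * (1 / real (Suc N) + 1 / real (Suc N))"
      using that by (intro mult_left_mono add_mono divide_left_mono) auto
    finally show "(energy_norm (\<lambda>x. \<phi> m x + (-1) * \<phi> n x))\<^sup>2 \<le> 4 / real (Suc N)"
      by simp
  qed
  \<comment> \<open>The factor \<open>C + 1\<close> dominates both 1, needed for the gradients, and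
    \<open>C\<close>, needed for the functions after the Poincare inequality.\<close>
  have small: "\<exists>N. (C + 1) * sqrt (4 / real (Suc N)) \<le> e" if "e > 0" for e
  proof -
    have "(\<lambda>N. (C + 1) * sqrt (4 * (1 / real (Suc N)))) \<longlonglongrightarrow> (C + 1) * sqrt (4 * 0)"
      by (intro tendsto_intros LIMSEQ_Suc[OF lim_1_over_n])
    then have "\<forall>\<^sub>F N in sequentially. (C + 1) * sqrt (4 * (1 / real (Suc N))) < e"
      using that by (intro order_tendstoD(2)) auto
    then show ?thesis
      by (auto simp: eventually_sequentially intro: less_imp_le)
  qed
  have cauchyG: "\<exists>N. \<forall>m\<ge>N. \<forall>n\<ge>N. L2_norm mu (\<lambda>x. weak_gradient D (\<phi> m) x - weak_gradient D (\<phi> n) x) \<le> e"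
    if "e > 0" for e
  proof -
    obtain N where N: "(C + 1) * sqrt (4 / real (Suc N)) \<le> e"
      using small[OF \<open>e > 0\<close>] by blast
    have "L2_norm mu (\<lambda>x. weak_gradient D (\<phi> m) x - weak_gradient D (\<phi> n) x) \<le> e" if mn: "m \<ge> N" "n \<ge> N" for m n
    proof -
      have "L2_norm mu (\<lambda>x. weak_gradient D (\<phi> m) x - weak_gradient D (\<phi> n) x) = energy_norm (\<lambda>x. \<phi> m x + (-1) * \<phi> n x)"
        using L2_norm_weak_gradient_lincomb[OF \<phi>W \<phi>W, of m "-1" n] by simp
      also have "\<dots> \<le> 1 * sqrt (4 / real (Suc N))"
        using close[OF mn] by simp
      also have "\<dots> \<le> (C + 1) * sqrt (4 / real (Suc N))"
        using C_nonneg by (intro mult_right_mono) auto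
      finally show ?thesis using N by linarith
    qed
    then show ?thesis by blast
  qed
  have cauchyu: "\<exists>N. \<forall>m\<ge>N. \<forall>n\<ge>N. L2_norm mu (\<lambda>x. \<phi> m x - \<phi> n x) \<le> e" if "e > 0" for e
  proof -
    obtain N where N: "(C + 1) * sqrt (4 / real (Suc N)) \<le> e"
      using small[OF \<open>e > 0\<close>] by blast
    have "L2_norm mu (\<lambda>x. \<phi> m x - \<phi> n x) \<le> e" if mn: "m \<ge> N" "n \<ge> N" for m n
    proof -
      have "L2_norm mu (\<lambda>x. \<phi> m x - \<phi> n x) \<le> C * energy_norm (\<lambda>x. \<phi> m x + (-1) * \<phi> n x)"
        using Poincare_test_L2[OF test_functions_lincomb[OF \<phi>[of m] \<phi>[of n], of "-1"]] by simp
      also have "\<dots> \<le> (C + 1) * sqrt (4 / real (Suc N))"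
        using C_nonneg by (intro mult_mono close mn) auto
      finally show ?thesis using N by linarith
    qed
    then show ?thesis by blast
  qed
  \<comment> \<open>Functions and gradients get their limits separately; only the closedness of the
    weak gradient ties \<open>G\<close> to \<open>u\<close>.\<close>
  obtain G where G: "square_integrable mu G" "(\<lambda>k. L2_norm mu (\<lambda>x. weak_gradient D (\<phi> k) x - G x)) \<longlonglongrightarrow> 0"
    using L2_complete[OF W12D(3)[OF \<phi>W] cauchyG] .
  obtain u where u: "square_integrable mu u" "(\<lambda>k. L2_norm mu (\<lambda>x. \<phi> k x - u x)) \<longlonglongrightarrow> 0"
    using L2_complete[OF W12D(2)[OF \<phi>W] cauchyu] .
  have wg: "has_weak_gradient D u G"
    by (rule has_weak_gradient_limit[OF W12D(1)[OF \<phi>W] W12D(2)[OF \<phi>W] W12D(3)[OF \<phi>W] u G])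
  note uW = W12I(1)[OF wg u(1) G(1)]
  have dW: "(\<lambda>x. u x + (-1) * \<phi> k x) \<in> sobolev_W12 D w" for k
    by (rule W12_lincomb(1)[OF uW \<phi>W])
  \<comment> \<open>The energy norm of \<open>u - \<phi> k\<close> is evaluated with the explicit
    weak gradient built from \<open>G\<close>, so the convergence to \<open>G\<close> can be used
    directly.\<close>
  have dG: "energy_norm (\<lambda>x. u x + (-1) * \<phi> k x) = L2_norm mu (\<lambda>x. weak_gradient D (\<phi> k) x - G x)" for k
  proof -
    have sq: "square_integrable mu (\<lambda>x. u x + (-1) * \<phi> k x)" "square_integrable mu (\<lambda>x. G x + (-1) *\<^sub>R weak_gradient D (\<phi> k) x)"
      by (rule W12D(2)[OF dW], rule square_integrable_lincomb[OF G(1) W12D(3)[OF \<phi>W]])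
    have "energy_norm (\<lambda>x. u x + (-1) * \<phi> k x) = L2_norm mu (\<lambda>x. G x + (-1) *\<^sub>R weak_gradient D (\<phi> k) x)"
      by (rule L2_norm_weak_gradient_cong[OF has_weak_gradient_lincomb[OF wg W12D(1)[OF \<phi>W]] sq])
    then show ?thesis
      by (simp add: L2_norm_def norm_minus_commute)
  qed
  have dlim: "(\<lambda>k. energy_norm (\<lambda>x. u x + (-1) * \<phi> k x)) \<longlonglongrightarrow> 0"
    unfolding dG by (rule G(2))
  have "(\<lambda>k. sobolev_norm D w (\<lambda>x. u x + (-1) * \<phi> k x)) \<longlonglongrightarrow> 0 + 0"
    unfolding sobolev_norm_eq[OF dW]
  proof (intro tendsto_add dlim)
    show "(\<lambda>k. L2_norm mu (\<lambda>x. u x + (-1) * \<phi> k x)) \<longlonglongrightarrow> 0"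
      using u(2) by (simp add: L2_norm_def power2_commute)
  qed
  then have slim: "(\<lambda>k. sobolev_norm D w (\<lambda>x. u x - \<phi> k x)) \<longlonglongrightarrow> 0"
    by simp
  have uW0: "u \<in> sobolev_W12_0 D w"
    unfolding sobolev_W12_0_def
  proof (intro CollectI conjI allI impI uW)
    fix \<epsilon> :: real assume "\<epsilon> > 0"
    then obtain k where "sobolev_norm D w (\<lambda>x. u x - \<phi> k x) < \<epsilon>"
      using eventually_happens'[OF sequentially_bot order_tendstoD(2)[OF slim]] by blast
    then show "\<exists>\<phi>\<in>test_functions D. sobolev_norm D w (\<lambda>x. u x - \<phi> x) < \<epsilon>"
      using \<phi> by (intro bexI[of _ "\<phi> k"])
  qed
  have test0: "residual f u \<psi> = 0" if \<psi>: "\<psi> \<in> test_functions D" for \<psi>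
  proof -
    note \<psi>W0 = test_in_W12_0[OF \<psi>]
    have diff: "norm (energy (\<phi> k) \<psi> - energy u \<psi>) \<le> energy_norm (\<lambda>x. u x + (-1) * \<phi> k x) * energy_norm \<psi>" for k
    proof -
      have "energy u \<psi> - energy (\<phi> k) \<psi> = energy (\<lambda>x. u x + (-1) * \<phi> k x) \<psi>"
        using L2_inner_weak_gradient_lincomb[OF uW \<phi>W test_in_W12(1)[OF \<psi>], of "-1" k] by simp
      then show ?thesis
        using L2_Cauchy_Schwarz[OF W12D(3)[OF dW] W12D(3)[OF test_in_W12(1)[OF \<psi>]], of k]
        by (simp add: abs_minus_commute)
    qed
    have "(\<lambda>k. energy_norm (\<lambda>x. u x + (-1) * \<phi> k x) * energy_norm \<psi>) \<longlonglongrightarrow> 0"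
      by (rule tendsto_mult_left_zero[OF dlim])
    then have "(\<lambda>k. energy (\<phi> k) \<psi> - energy u \<psi>) \<longlonglongrightarrow> 0"
      by (rule Lim_null_comparison[OF always_eventually[OF allI[OF diff]]])
    then have "(\<lambda>k. energy (\<phi> k) \<psi>) \<longlonglongrightarrow> energy u \<psi>"
      by (rule LIM_zero_cancel)
    then have rlim: "(\<lambda>k. residual f (\<phi> k) \<psi>) \<longlonglongrightarrow> residual f u \<psi>"
      unfolding residual_def by (intro tendsto_intros)
    \<comment> \<open>Almost minimality of \<open>\<phi> k\<close> against its perturbation by
      \<open>t\<close> times \<psi> gives this inequality with the additional error
      \<open>1 / real (Suc k)\<close>. The term \<open>0\<^sup>2\<close> only matches the
      discriminant lemma with \<open>a = 0\<close>.\<close>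
    have "0 \<le> 0\<^sup>2 + 2 * t * residual f u \<psi> + t\<^sup>2 * (energy_norm \<psi>)\<^sup>2" for t
    proof (rule LIMSEQ_le_const)
      show "(\<lambda>k. 1 / real (Suc k) + 2 * t * residual f (\<phi> k) \<psi> + t\<^sup>2 * (energy_norm \<psi>)\<^sup>2) \<longlonglongrightarrow>
          0\<^sup>2 + 2 * t * residual f u \<psi> + t\<^sup>2 * (energy_norm \<psi>)\<^sup>2"
        unfolding zero_power2 by (intro tendsto_intros rlim LIMSEQ_Suc[OF lim_1_over_n])
      show "\<exists>N. \<forall>k\<ge>N. 0 \<le> 1 / real (Suc k) + 2 * t * residual f (\<phi> k) \<psi> + t\<^sup>2 * (energy_norm \<psi>)\<^sup>2"
      proof (intro exI allI impI)
        fix k :: nat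
        show "0 \<le> 1 / real (Suc k) + 2 * t * residual f (\<phi> k) \<psi> + t\<^sup>2 * (energy_norm \<psi>)\<^sup>2"
          using min[OF test_functions_lincomb[OF \<phi>[of k] \<psi>, of t], of k]
            dirichlet_functional_expand[OF sf test_in_W12_0[OF \<phi>[of k]] \<psi>W0, of t] by linarith
      qed
    qed
    from nonneg_quadratic_discriminant[OF this] show ?thesis by simp
  qed
  have "residual f u v = 0" if v: "v \<in> sobolev_W12_0 D w" for v
  proof (rule ccontr)
    assume neq: "residual f u v \<noteq> 0"
    \<comment> \<open>By \<open>residual_bound\<close>, \<open>A - 1\<close> bounds the functional
      \<open>residual f u\<close> with respect to the energy norm; adding 1 makes the divisor
      positive. A test function closer to \<open>v\<close> than
      \<open>\<bar>residual f u v\<bar> / A\<close> has residual 0, which contradicts that bound for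
      the difference.\<close>
    define A where "A = energy_norm u + L2_norm (lebesgue_on D) f * C + 1"
    have A: "A > 0"
      using C_nonneg by (simp add: A_def add_nonneg_pos)
    have "\<bar>residual f u v\<bar> / A > 0"
      using neq A by simp
    then obtain \<psi> where \<psi>: "\<psi> \<in> test_functions D" "sobolev_norm D w (\<lambda>x. v x - \<psi> x) < \<bar>residual f u v\<bar> / A"
      using W12_0_approx[OF v] by blast
    let ?d = "\<lambda>x. v x + (-1) * \<psi> x"
    have d: "?d \<in> sobolev_W12_0 D w"
      by (rule W12_0_lincomb[OF v test_in_W12_0[OF \<psi>(1)]])
    have "energy_norm ?d \<le> sobolev_norm D w ?d"
      unfolding sobolev_norm_eq[OF W12_0_imp_W12[OF d]] by simp
    also have "\<dots> < \<bar>residual f u v\<bar> / A"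
      using \<psi>(2) by simp
    finally have "A * energy_norm ?d < \<bar>residual f u v\<bar>"
      using A by (simp add: pos_less_divide_eq mult.commute)
    moreover have "residual f u ?d = residual f u v"
      using residual_lincomb[OF sf uW0 v test_in_W12_0[OF \<psi>(1)], of "-1"] test0[OF \<psi>(1)] by simp
    moreover have "\<bar>residual f u ?d\<bar> \<le> (A - 1) * energy_norm ?d"
      using residual_bound[OF sf uW0 d] by (simp add: A_def)
    moreover have "(A - 1) * energy_norm ?d \<le> A * energy_norm ?d"
      by (intro mult_right_mono) auto
    ultimately show False by linarith
  qed
  then have "dirichlet_weak_solution D w f u"
    using uW0 by (simp add: dirichlet_weak_solution_iff[OF f])
  then show ?thesis
    by (rule that)
qed

text \<open>Testing both equations with the difference of the solutions shows that its energy is 0.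
  The Sobolev inequality then makes its unweighted L2 norm 0.\<close>

lemma weak_solution_unique:
  assumes f: "f \<in> L2_on D" and u: "dirichlet_weak_solution D w f u" and v: "dirichlet_weak_solution D w f v"
  shows "AE x in lebesgue. x \<in> D \<longrightarrow> v x = u x"
proof -
  have W0: "u \<in> sobolev_W12_0 D w" "v \<in> sobolev_W12_0 D w"
    and r: "\<And>z. z \<in> sobolev_W12_0 D w \<Longrightarrow> residual f u z = 0 \<and> residual f v z = 0"
    using u v by (auto simp: dirichlet_weak_solution_iff[OF f])
  let ?d = "\<lambda>x. v x + (-1) * u x"
  have d: "?d \<in> sobolev_W12_0 D w"
    by (rule W12_0_lincomb[OF W0(2,1)])
  have "energy ?d ?d = energy v ?d - energy u ?d"
    using L2_inner_weak_gradient_lincomb[OF W12_0_imp_W12[OF W0(2)] W12_0_imp_W12[OF W0(1)] W12_0_imp_W12[OF d], of "-1"]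
    by simp
  also have "\<dots> = residual f v ?d - residual f u ?d"
    by (simp add: residual_def)
  also have "\<dots> = 0"
    using r[OF d] by simp
  finally have "energy_norm ?d = 0"
    by (simp add: L2_inner_self)
  then have "L2_norm (lebesgue_on D) ?d = 0"
    using Sobolev_L2[OF d] L2_norm_nonneg[of "lebesgue_on D" ?d] by (simp del: L2_norm_nonneg)
  then have "AE x in lebesgue_on D. ?d x = 0"
    by (rule L2_norm_eq_0[OF Sobolev_square[OF d]])
  then show ?thesis
    unfolding AE_on_D by eventually_elim auto
qed

end

section \<open>From the hypotheses on the weight to the assumptions of the locale\<close>

lemma weight_measurable:
  assumes "weight w"
  shows "w \<in> borel_measurable lebesgue"
proof -
  have "w \<in> borel_measurable (lebesgue_on UNIV)"
    using assms by (intro locally_summable_measurable) (auto simp: weight_def)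
  then show ?thesis by simp
qed

text \<open>The averaging argument exchanges Borel integrals, whereas the weight is only Lebesgue
  measurable; it is therefore run for a Borel version of the weight and the result is transferred
  back a.e.\<close>

lemma A2_Poincare:
  fixes w :: "'a::euclidean_space \<Rightarrow> real"
  assumes w: "weight w" "A2_condition w" and D: "open D" "bounded D"
    and pos: "AE x in lebesgue. x \<in> D \<longrightarrow> 0 < w x"
  obtains c where "c < top" "\<And>\<phi>. \<phi> \<in> test_functions D \<Longrightarrow>
    (\<integral>\<^sup>+x. ennreal ((\<phi> x)\<^sup>2 * w x) \<partial>lebesgue) \<le>
    c * (\<integral>\<^sup>+x. ennreal ((norm (grad \<phi> x))\<^sup>2 * w x) \<partial>lebesgue)"
proof -
  obtain w' where [measurable]: "w' \<in> borel_measurable lborel" and w': "AE x in lborel. w x = w' x"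
    using completion_ex_borel_measurable_real[OF weight_measurable[OF w(1)]] by auto
  have [measurable]: "D \<in> sets borel"
    using D by simp
  \<comment> \<open>At points of \<open>D\<close> where the Borel version is 0 after truncation to
    \<open>ennreal\<close> the value 1 is used. These points form a null set, so the integrals keep
    their values, and \<open>W x * S x = 1\<close> holds at every point of \<open>D\<close>, as the
    Poincare inequality demands.\<close>
  define W where "W x = (if x \<in> D \<and> ennreal (w' x) = 0 then 1 else ennreal (w' x))" for x
  define S where "S x = inverse (W x)" for x
  have [measurable]: "W \<in> borel_measurable borel" "S \<in> borel_measurable borel"
    unfolding W_def S_def by measurable
  have AE: "AE x in lborel. W x = ennreal (w x)"
    using w' pos unfolding AE_completion_iff by eventually_elim (auto simp: W_def)
  have WS: "W x * S x = 1" if "x \<in> D" for x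
    using that by (auto simp: W_def S_def ennreal_inverse_mult divide_ennreal_def[symmetric] ennreal_divide_self less_top[symmetric])
  define k where "k = (SUP (c, r) \<in> UNIV \<times> {0<..}.
        ((\<integral>\<^sup>+x\<in>ball c r. ennreal (w x) \<partial>lebesgue) / emeasure lebesgue (ball c r)) *
        ((\<integral>\<^sup>+x\<in>ball c r. inverse (ennreal (w x)) \<partial>lebesgue) / emeasure lebesgue (ball c r)))"
  have k: "k < top"
    using w(2) by (simp add: k_def A2_condition_def)
  have A2: "(\<integral>\<^sup>+x\<in>ball y r. W x \<partial>lborel) / emeasure lborel (ball y r) *
      ((\<integral>\<^sup>+x\<in>ball y r. S x \<partial>lborel) / emeasure lborel (ball y r)) \<le> k" if "r > 0" for y r
  proof -
    have "(\<integral>\<^sup>+x\<in>ball y r. W x \<partial>lborel) = (\<integral>\<^sup>+x\<in>ball y r. ennreal (w x) \<partial>lebesgue)"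
      unfolding nn_integral_completion using AE by (intro nn_integral_cong_AE) auto
    moreover have "(\<integral>\<^sup>+x\<in>ball y r. S x \<partial>lborel) = (\<integral>\<^sup>+x\<in>ball y r. inverse (ennreal (w x)) \<partial>lebesgue)"
      unfolding nn_integral_completion S_def using AE by (intro nn_integral_cong_AE) auto
    moreover have "emeasure lborel (ball y r) = emeasure lebesgue (ball y r)"
      by simp
    ultimately show ?thesis
      unfolding k_def using that by (intro SUP_upper2[of "(y, r)"]) auto
  qed
  obtain R where R: "R > 0" "D \<subseteq> ball 0 R"
    using D(2) by (metis bounded_subset_ballD)
  define m where "m = emeasure lborel (ball (0::'a) (1 / 4))"
  have m: "m \<noteq> 0" "m \<noteq> top"
    using content_ball_pos[of "1 / 4" "0::'a"] emeasure_lborel_ball_finite[of "0::'a" "1 / 4"]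
    by (auto simp: measure_def m_def)
  define K where "K = (ennreal (4 * R))\<^sup>2 * (k * (emeasure lborel (ball (0::'a) 2))\<^sup>2)"
  have K: "K < top"
    using k emeasure_lborel_ball_finite[of "0::'a" 2]
    by (auto simp: K_def ennreal_mult_less_top power2_eq_square)
  show ?thesis
  proof
    show "K / m\<^sup>2 < top"
      using K m by (simp add: ennreal_divide_eq_top_iff less_top[symmetric])
    fix \<phi> :: "'a \<Rightarrow> real" assume \<phi>: "\<phi> \<in> test_functions D"
    obtain Q where Q: "compact Q" "Q \<subseteq> D" "\<And>x. x \<notin> Q \<Longrightarrow> \<phi> x = 0" "\<And>x. x \<notin> Q \<Longrightarrow> grad \<phi> x = 0"
      using test_function_support[OF \<phi>] by metis
    have nn: "0 \<le> w x" for x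
      using w(1) by (simp add: weight_def)
    have "(\<integral>\<^sup>+x. ennreal ((\<phi> x)\<^sup>2 * w x) \<partial>lebesgue) = (\<integral>\<^sup>+x. (ennreal \<bar>\<phi> x\<bar>)\<^sup>2 * W x \<partial>lborel)"
      unfolding nn_integral_completion using AE nn
      by (intro nn_integral_cong_AE) (auto simp: ennreal_mult ennreal_power elim!: eventually_mono)
    moreover have "(\<integral>\<^sup>+x. ennreal ((norm (grad \<phi> x))\<^sup>2 * w x) \<partial>lebesgue) =
        (\<integral>\<^sup>+x. (ennreal (norm (grad \<phi> x)))\<^sup>2 * W x \<partial>lborel)"
      unfolding nn_integral_completion using AE nn
      by (intro nn_integral_cong_AE) (auto simp: ennreal_mult ennreal_power elim!: eventually_mono)
    moreover have "(\<integral>\<^sup>+x. (ennreal \<bar>\<phi> x\<bar>)\<^sup>2 * W x \<partial>lborel) * m\<^sup>2 \<le> K * (\<integral>\<^sup>+x. (ennreal (norm (grad \<phi> x)))\<^sup>2 * W x \<partial>lborel)"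
      unfolding m_def K_def using Q(2-4)
      by (intro weighted_Poincare_inequality[OF test_function_C1(1,2)[OF \<phi>] R(2) _ _ _ _ WS A2 R(1)]) auto
    moreover have "X \<le> K / m\<^sup>2 * Y" if "X * m\<^sup>2 \<le> K * Y" for X Y
    proof -
      have "X = X * m\<^sup>2 / m\<^sup>2"
        using m by (simp add: ennreal_times_divide[symmetric] ennreal_divide_self less_top power_less_top_ennreal)
      also have "\<dots> \<le> K * Y / m\<^sup>2"
        by (rule divide_right_mono_ennreal[OF that])
      also have "\<dots> = K / m\<^sup>2 * Y"
        by (simp add: ennreal_times_divide mult.commute[of _ Y])
      finally show ?thesis .
    qed
    ultimately show "(\<integral>\<^sup>+x. ennreal ((\<phi> x)\<^sup>2 * w x) \<partial>lebesgue) \<le>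
        K / m\<^sup>2 * (\<integral>\<^sup>+x. ennreal ((norm (grad \<phi> x))\<^sup>2 * w x) \<partial>lebesgue)"
      by simp
  qed
qed

lemma weighted_domain_A2:
  fixes D :: "'a::euclidean_space set"
  assumes n: "DIM('a) \<ge> 2" and D: "open D" "bounded D" and w: "weight w" "A2_condition w"
    and fin: "(\<integral>\<^sup>+x\<in>D. inverse (ennreal (w x powr (real DIM('a) / 2))) \<partial>lebesgue) < \<infinity>"
  obtains C where "weighted_domain D w C"
proof -
  let ?p = "real DIM('a) / 2"
  let ?I = "\<integral>\<^sup>+x\<in>D. inverse (ennreal (w x powr ?p)) \<partial>lebesgue"
  note wm [measurable] = weight_measurable[OF w(1)]
  have nn: "0 \<le> w x" for x
    using w(1) by (simp add: weight_def)
  have [measurable]: "D \<in> sets lebesgue"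
    using D by auto
  \<comment> \<open>The reciprocal is infinite where the weight vanishes, so a finite integral
    forces the weight to be positive a.e. on \<open>D\<close>.\<close>
  have "AE x in lebesgue. inverse (ennreal (w x powr ?p)) * indicator D x \<noteq> \<infinity>"
    using fin by (intro nn_integral_PInf_AE) auto
  then have pos: "AE x in lebesgue. x \<in> D \<longrightarrow> 0 < w x"
  proof eventually_elim
    case (elim x)
    then show ?case
      using nn[of x] by (cases "w x = 0") (auto simp: less_le)
  qed
  have loc: "locally_summable D w"
    using w(1) by (auto simp: weight_def locally_summable_def)
  have inv: "set_integrable lebesgue D (\<lambda>x. 1 / w x)"
    unfolding set_integrable_def
  proof (rule integrableI_bounded)
    show "(\<lambda>x. indicator D x *\<^sub>R (1 / w x)) \<in> borel_measurable lebesgue"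
      by measurable
    have "(\<integral>\<^sup>+x. ennreal (norm (indicator D x *\<^sub>R (1 / w x))) \<partial>lebesgue) \<le>
        (\<integral>\<^sup>+x. indicator D x + inverse (ennreal (w x powr ?p)) * indicator D x \<partial>lebesgue)"
    proof (rule nn_integral_mono_AE)
      show "AE x in lebesgue. ennreal (norm (indicator D x *\<^sub>R (1 / w x))) \<le>
          indicator D x + inverse (ennreal (w x powr ?p)) * indicator D x"
        using pos
      proof eventually_elim
        case (elim x)
        show ?case
        proof (cases "x \<in> D")
          case True
          then have wx: "0 < w x" using elim by simp
          \<comment> \<open>For \<open>w x < 1\<close> this uses that the exponent n/2 is at least
            1. The constant 1 is summable because \<open>D\<close> is bounded.\<close>
          have "1 / w x \<le> 1 + inverse (w x powr ?p)"
          proof (cases "w x \<ge> 1")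
            case True
            then have "1 / w x \<le> 1" by simp
            moreover have "0 \<le> inverse (w x powr ?p)" by simp
            ultimately show ?thesis by linarith
          next
            case False
            then have "w x powr ?p \<le> w x powr 1"
              using wx n by (intro powr_mono') auto
            then have "inverse (w x) \<le> inverse (w x powr ?p)"
              using wx by (intro le_imp_inverse_le) auto
            then show ?thesis by (simp add: inverse_eq_divide)
          qed
          then have "ennreal (1 / w x) \<le> ennreal (1 + inverse (w x powr ?p))"
            by (rule ennreal_leI)
          also have "\<dots> = ennreal 1 + ennreal (inverse (w x powr ?p))"
            by (rule ennreal_plus) auto
          finally have "ennreal (1 / w x) \<le> ennreal 1 + ennreal (inverse (w x powr ?p))" .
          then show ?thesis
            using True wx by (simp add: inverse_ennreal)
        qed simp
      qed
    qed
    also have "\<dots> = emeasure lebesgue D + ?I"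
      by (subst nn_integral_add) auto
    also have "\<dots> < \<infinity>"
      using fin D emeasure_bounded_finite[OF D(2)] by (simp add: less_top)
    finally show "(\<integral>\<^sup>+x. ennreal (norm (indicator D x *\<^sub>R (1 / w x))) \<partial>lebesgue) < \<infinity>" .
  qed
  obtain c where c: "c < top" "\<And>\<phi>. \<phi> \<in> test_functions D \<Longrightarrow>
    (\<integral>\<^sup>+x. ennreal ((\<phi> x)\<^sup>2 * w x) \<partial>lebesgue) \<le>
    c * (\<integral>\<^sup>+x. ennreal ((norm (grad \<phi> x))\<^sup>2 * w x) \<partial>lebesgue)"
    using A2_Poincare[OF w D pos] by blast
  define s where "s = ennreal ((2 * (real DIM('a) - 1) / real DIM('a))\<^sup>2) * epow ?I (2 / real DIM('a))"
  have "epow ?I (2 / real DIM('a)) < top"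
    using fin by (simp add: less_top[symmetric])
  then have s: "s < top"
    by (simp add: s_def ennreal_mult_less_top)
  have Sob: "(\<integral>\<^sup>+x. ennreal ((\<phi> x)\<^sup>2) \<partial>lebesgue) \<le> s * (\<integral>\<^sup>+x. ennreal ((norm (grad \<phi> x))\<^sup>2 * w x) \<partial>lebesgue)"
    if \<phi>: "\<phi> \<in> test_functions D" for \<phi>
  proof -
    obtain Q where Q: "compact Q" "Q \<subseteq> D" "\<And>x. x \<notin> Q \<Longrightarrow> \<phi> x = 0" "\<And>x. x \<notin> Q \<Longrightarrow> grad \<phi> x = 0"
      using test_function_support[OF \<phi>] by metis
    show ?thesis
      unfolding s_def by (rule weighted_Sobolev_inequality[OF n test_function_C1(1,2)[OF \<phi>] Q _ wm pos]) measurable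
  qed
  \<comment> \<open>The square of \<open>C\<close> is the sum of the two finite constants and hence
    dominates each.\<close>
  define C where "C = sqrt (enn2real (c + s))"
  have C: "ennreal (C\<^sup>2) = c + s"
    using c(1) s by (simp add: C_def ennreal_enn2real)
  have "weighted_domain D w C"
  proof
    fix \<phi> :: "'a \<Rightarrow> real" assume \<phi>: "\<phi> \<in> test_functions D"
    show "(\<integral>\<^sup>+x. ennreal ((\<phi> x)\<^sup>2 * w x) \<partial>lebesgue) \<le>
      ennreal (C\<^sup>2) * (\<integral>\<^sup>+x. ennreal ((norm (grad \<phi> x))\<^sup>2 * w x) \<partial>lebesgue)"
      unfolding C by (rule order_trans[OF c(2)[OF \<phi>]]) (auto intro!: mult_right_mono)
    show "(\<integral>\<^sup>+x. ennreal ((\<phi> x)\<^sup>2) \<partial>lebesgue) \<le>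
      ennreal (C\<^sup>2) * (\<integral>\<^sup>+x. ennreal ((norm (grad \<phi> x))\<^sup>2 * w x) \<partial>lebesgue)"
      unfolding C by (rule order_trans[OF Sob[OF \<phi>]]) (auto intro!: mult_right_mono)
  qed (use D wm nn pos loc inv in \<open>auto simp: C_def\<close>)
  then show ?thesis by (rule that)
qed

theorem theorem11:
  fixes D :: "(real ^ 'n) set" and w f :: "real ^ 'n \<Rightarrow> real"
  assumes "CARD('n) \<ge> 2"
    and "open D" "connected D" "D \<noteq> {}" "bounded D"
    and "weight w" "A2_condition w"
    and "C_k_on 1 D w"
    and "(\<integral>\<^sup>+x\<in>D. inverse (ennreal (w x powr (real CARD('n) / 2))) \<partial>lebesgue) < \<infinity>"
    and "f \<in> L2_on D"
  shows "\<exists>u. dirichlet_weak_solution D w f u \<and>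
    (\<forall>v. dirichlet_weak_solution D w f v \<longrightarrow> (AE x in lebesgue. x \<in> D \<longrightarrow> v x = u x))"
proof -
  obtain C where "weighted_domain D w C"
    by (rule weighted_domain_A2[of D w]) (use assms in simp_all)
  then interpret weighted_domain D w C .
  obtain u where "dirichlet_weak_solution D w f u"
    by (rule weak_solution_exists[OF \<open>f \<in> L2_on D\<close>])
  then show ?thesis
    using weak_solution_unique[OF \<open>f \<in> L2_on D\<close>] by blast
qed

end
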